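(* Let $\psi: \mathbb{N} \rightarrow [0,\infty)$ be a function. Assume that there is a constant $\varepsilon >0$ such that $$ \sum_{n=1}^\infty \frac{\psi(n) \varphi(n)}{n(\log \log n)^\varepsilon} = \infty. $$ Then $\lambda(W(\psi))=1$.
   Context: $\mathbb{N}$ is the set of positive integers, $\varphi$ is the Euler totient function, and $\lambda$ is Lebesgue measure. Convention: $\log x$ is understood as $\max(1,\log x)$ (also in iterated logarithms), so that all logarithms and iterated logarithms are positive and well-defined. For a function $\psi:\mathbb{N}\to[0,\infty)$ and $n \in \mathbb{N}$, define the set $\mathcal{E}_n \subset \mathbb{R}/\mathbb{Z}$ by $$\mathcal{E}_n := \bigcup_{\substack{1 \leq a \leq n,\\ \gcd(a,n)=1}} \left( \frac{a - \psi(n)}{n},\frac{a+\psi(n)}{n} \right),$$ and let $W(\psi)$ be the set of those $x \in [0,1]$ which are contained (modulo 1) in infinitely many of the sets $\mathcal{E}_n$. *)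

theory Defs
  imports "HOL-Analysis.Analysis" "HOL-Number_Theory.Totient"
begin

text \<open>
  The convention on logarithms: \<open>log x\<close> stands for \<open>max(1, log x)\<close>, at every
  level of an iterated logarithm. So \<open>log log n\<close> is \<open>plog (plog n)\<close>.
\<close>

definition plog :: "real \<Rightarrow> real" where
  "plog x = max 1 (ln x)"

text \<open>
  The positive integers are represented inside \<open>nat\<close>; the value \<open>\<psi> 0\<close> is never used.
  The set \<open>approx_set \<psi> n\<close> consists of real representatives: its image in \<open>\<real>/\<int>\<close> is the
  set \<open>\<E>\<^sub>n\<close>, and \<open>x\<close> lies in that image iff some integer translate of \<open>x\<close> lies in
  \<open>approx_set \<psi> n\<close>.
\<close>

definition approx_set :: "(nat \<Rightarrow> real) \<Rightarrow> nat \<Rightarrow> real set" where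
  "approx_set \<psi> n =
     (\<Union>a\<in>{a. 1 \<le> a \<and> a \<le> n \<and> gcd a n = 1}.
        {(real a - \<psi> n) / real n <..< (real a + \<psi> n) / real n})"

definition W :: "(nat \<Rightarrow> real) \<Rightarrow> real set" where
  "W \<psi> = {x \<in> {0..1}.
      infinite {n. 1 \<le> n \<and> (\<exists>k::int. x + of_int k \<in> approx_set \<psi> n)}}"

end

theory Submission
  imports Defs "HOL-Number_Theory.Number_Theory"
begin

text \<open>
  Write \<open>u\<^sub>n = 2 \<psi>(n) \<phi>(n) / n\<close>, \<open>t = m n / gcd(m, n)\<^sup>2\<close> and
  \<open>D = max (n \<psi>(m)) (m \<psi>(n)) / gcd(m, n)\<close>. Counting pairs of reduced fractions with denominators
  \<open>m\<close>, \<open>n\<close> at a given distance bounds the overlap of the corresponding intervals by \<open>u\<^sub>m u\<^sub>n\<close> times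
  \<open>t / \<phi>(t)\<close> times a mean of \<open>c / \<phi>(c)\<close> over the \<open>c \<le> 2 D\<close> coprime to \<open>t\<close>.

  Group the \<open>n\<close> into blocks \<open>2\<^sup>h \<le> log log n < 2\<^sup>h\<^sup>+\<^sup>1\<close>. Extra divergence gives infinitely many blocks with
  \<open>\<Sum>u\<^sub>n \<ge> 2\<^sup>K\<close>, \<open>K\<close> proportional to \<open>h\<close>, so \<open>\<psi>\<close> may be replaced there by \<open>\<psi> / 2\<^sup>k\<close> for any \<open>k \<le> K\<close>.
  Averaging over \<open>k\<close> turns the means into the logarithmic sum \<open>\<Sum> 1 / \<phi>(c)\<close>, which by Mertens' bound
  cancels \<open>t / \<phi>(t)\<close> as far as prime factors below \<open>4\<^sup>h\<close> are concerned. Pairs for which \<open>t\<close> has many larger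
  prime factors and \<open>D\<close> is small contribute little: on exponents of prime factorizations, the kernel \<open>t\<^sup>-\<^sup>1\<^sup>/\<^sup>4\<close> is
  bounded from \<open>\<ell>\<^sup>4\<^sup>/\<^sup>3\<close> to \<open>\<ell>\<^sup>4\<close> with norm \<open>\<Prod>(1 + O(1/p))\<close>, a power of \<open>log n\<close>, and this remains true after
  weighting the primes \<open>p > y = 4\<^sup>h\<close> by \<open>exp (y / p)\<close>, which gains the factor \<open>exp (- y)\<close>.

  The second moment method then yields a limsup set of positive measure. Applied to
  \<open>\<psi> / (log log n)\<^sup>\<epsilon>\<^sup>/\<^sup>2\<close>, it does so for a set that stays in \<open>W(\<psi>)\<close> under all fixed dilations of \<open>\<psi>\<close>. The union over
  dilations is invariant under \<open>x \<mapsto> p x\<close> (support on \<open>p \<nmid> n\<close>), under \<open>x \<mapsto> p x + 1/p\<close> (support on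
  \<open>p\<close> exactly dividing \<open>n\<close>), or, if neither support carries the divergence for any \<open>p\<close>, under all
  \<open>x \<mapsto> x + 1/p\<close>; each of these forces full measure.
\<close>

section \<open>Prime sums and multiplicative means\<close>

text \<open>At a single scale the mean over \<open>c\<close> cancels in \<open>t / \<phi>(t)\<close>
  only the primes up to about \<open>D\<close>; the primes between \<open>D\<close> and
  \<open>4^h\<close> can leave a factor of order \<open>h\<close>. Summed over \<open>K\<close>
  scales, these losses share one Mertens product over primes up to about \<open>4^h * 2^K\<close>,
  which is of order \<open>h\<close>, so their average is bounded once \<open>K\<close> is a fixed
  multiple of \<open>h\<close>. In a block \<open>log log n\<close> is about \<open>2^h\<close>,
  hence \<open>2^K\<close> is a power of it with small exponent: this is what the weight
  \<open>(log log n)^\<epsilon>\<close> buys, and why the blocks are dyadic in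
  \<open>log log n\<close>. The cut-off \<open>y = 4^h\<close> meets two demands:
  \<open>exp (- y)\<close> beats every fixed power of \<open>log n\<close>, that is
  \<open>exp (b * 2^h)\<close>, while \<open>ln y\<close> is still of order \<open>h\<close>. The
  kernel exponent \<open>3/4\<close> lies above \<open>1/2\<close> for a reason. In an
  \<open>\<ell>^2\<close> bound the local norm would be \<open>1 + O(p^(-1/4))\<close>, with a
  product far beyond any power of \<open>log n\<close>. At \<open>3/4\<close>, spreading over
  several exponents costs mass, and next to the dominant exponent the kernel enters through its
  fourth power, of order \<open>1/p\<close>.\<close>

lemma mangoldt_floor_sum:
  "(\<Sum>d=1..n. mangoldt d * real (n div d)) = ln (fact n)"
proof (induction n)
  case 0
  then show ?case by simp
next
  case (Suc n)
  have dS: "Suc n div d = n div d + (if d dvd Suc n then 1 else 0)" for d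
    by (auto simp: div_Suc dvd_eq_mod_eq_0)
  have "(\<Sum>d=1..Suc n. mangoldt d * real (Suc n div d))
      = (\<Sum>d=1..Suc n. mangoldt d * real (n div d)) + (\<Sum>d=1..Suc n. if d dvd Suc n then mangoldt d else 0)"
    unfolding sum.distrib[symmetric] dS by (intro sum.cong) (auto simp: algebra_simps)
  also have "(\<Sum>d=1..Suc n. mangoldt d * real (n div d)) = ln (fact n)"
    using Suc by simp
  also have "(\<Sum>d=1..Suc n. if d dvd Suc n then mangoldt d else 0) = (\<Sum>d | d dvd Suc n. mangoldt d :: real)"
    by (subst sum.inter_filter[symmetric])
       (auto intro!: sum.cong Nat.gr0I simp: dvd_imp_le Suc_le_eq)
  also have "\<dots> = ln (real (Suc n))"
    by (subst mangoldt_sum) auto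
  also have "ln (fact n) + ln (real (Suc n)) = ln (fact (Suc n))"
    by (simp add: ln_mult add.commute)
  finally show ?case by simp
qed

text \<open>The logarithm of \<open>(2*m) choose m\<close> is the sum of \<open>mangoldt d\<close>
  times \<open>2*m div d - 2 * (m div d)\<close>; this bracket is nonnegative, and at least 1 for
  \<open>m < d \<le> 2*m\<close>. Since the binomial is at most \<open>4^m\<close>, the range above
  \<open>m\<close> carries at most \<open>2*m\<close>. Halving \<open>n\<close> then costs
  \<open>4*m\<close> by induction, \<open>2*m\<close> for this range, and at most \<open>2*m\<close>
  for the last term when \<open>n\<close> is odd.\<close>

lemma chebyshev_mangoldt_le: "(\<Sum>d=1..n. mangoldt d :: real) \<le> 4 * real n"
proof (induction n rule: less_induct)
  case (less n)
  show ?case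
  proof (cases "n = 0")
    case True then show ?thesis by simp
  next
    case False
    define m where "m = n div 2"
    have m: "m < n" using False by (simp add: m_def)
    have "ln (fact (2*m) :: real) - 2 * ln (fact m :: real)
        = (\<Sum>d=1..2*m. mangoldt d * real (2*m div d)) - 2 * (\<Sum>d=1..2*m. mangoldt d * real (m div d))"
      unfolding mangoldt_floor_sum[symmetric]
      by (intro arg_cong2[where f="(-)"] refl arg_cong[where f="(*) 2"] sum.mono_neutral_left) auto
    also have "\<dots> = (\<Sum>d=1..2*m. mangoldt d * (real (2*m div d) - 2 * real (m div d)))"
      by (simp add: sum_subtractf sum_distrib_left algebra_simps)
    also have "\<dots> \<ge> (\<Sum>d=m+1..2*m. mangoldt d)"
    proof -
      have ge: "real (2*m div d) - 2 * real (m div d) \<ge> 0" for d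
      proof -
        have "2 * (m div d) \<le> (2 * m) div d"
          by (cases "d = 0") (auto simp: less_eq_div_iff_mult_less_eq mult.assoc)
        then show ?thesis by linarith
      qed
      have "(\<Sum>d=m+1..2*m. mangoldt d) \<le> (\<Sum>d=m+1..2*m. mangoldt d * (real (2*m div d) - 2 * real (m div d)))"
      proof (rule sum_mono)
        fix d assume d: "d \<in> {m+1..2*m}"
        then have "m div d = 0" by auto
        moreover have "2*m div d \<ge> 1" using d by (simp add: less_eq_div_iff_mult_less_eq)
        ultimately show "mangoldt d \<le> mangoldt d * (real (2*m div d) - 2 * real (m div d))"
          using mangoldt_nonneg[of d] by (simp add: mult_le_cancel_left1)
      qed
      also have "\<dots> \<le> (\<Sum>d=1..2*m. mangoldt d * (real (2*m div d) - 2 * real (m div d)))"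
        using ge mangoldt_nonneg by (intro sum_mono2) auto
      finally show ?thesis .
    qed
    finally have 1: "(\<Sum>d=m+1..2*m. mangoldt d) \<le> ln (fact (2*m) :: real) - 2 * ln (fact m :: real)" .
    have "ln (fact (2*m) :: real) - 2 * ln (fact m :: real) = ln (real ((2*m) choose m))"
    proof -
      have "fact (2*m) = (fact m * fact m * real ((2*m) choose m))"
        using binomial_fact[of m "2*m", where 'a=real] by (simp add: field_simps)
      moreover have "real ((2*m) choose m) > 0" by simp
      ultimately show ?thesis by (simp add: ln_mult)
    qed
    also have "\<dots> \<le> ln (2 ^ (2*m))"
    proof -
      have "(2*m) choose m \<le> 2 ^ (2*m)" by (rule binomial_le_pow2)
      then have "real ((2*m) choose m) \<le> 2 ^ (2*m)" by (metis of_nat_le_iff of_nat_numeral of_nat_power)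
      then show ?thesis by (subst ln_le_cancel_iff) auto
    qed
    also have "\<dots> = 2 * real m * ln 2" by (simp add: ln_realpow)
    also have "\<dots> \<le> 2 * real m * 1" using ln_2_less_1 by (intro mult_left_mono) auto
    finally have 2: "(\<Sum>d=m+1..2*m. mangoldt d :: real) \<le> 2 * real m" using 1 by linarith
    have "(\<Sum>d=1..n. mangoldt d :: real) \<le> (\<Sum>d=1..2*m. mangoldt d) + 2 * real m"
    proof (cases "even n")
      case True then show ?thesis by (simp add: m_def)
    next
      case False
      then have n: "n = Suc (2*m)" by (simp add: m_def)
      have "mangoldt n \<le> ln (real n)" using n by (intro mangoldt_le) auto
      also have "\<dots> \<le> 2 * real m" using ln_le_minus_one[of "real n"] n by auto
      finally show ?thesis using n by simp
    qed
    also have "(\<Sum>d=1..2*m. mangoldt d :: real) = (\<Sum>d=1..m. mangoldt d) + (\<Sum>d=m+1..2*m. mangoldt d)"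
      using sum.ub_add_nat[of 1 m "mangoldt :: nat \<Rightarrow> real" m] by (simp add: mult_2)
    finally have "(\<Sum>d=1..n. mangoldt d :: real) \<le> 4 * real m + 4 * real m"
      using 2 less[OF m] by linarith
    also have "\<dots> \<le> 4 * real n" unfolding m_def by linarith
    finally show ?thesis .
  qed
qed

text \<open>After multiplication by \<open>n\<close>, replacing \<open>n / d\<close> by
  \<open>n div d + 1\<close> splits the sum into \<open>ln (fact n) \<le> n * ln n\<close> and a
  Chebyshev sum, which contributes the 4.\<close>

lemma mangoldt_over_self_le:
  assumes "n \<ge> 1"
  shows "(\<Sum>d=1..n. mangoldt d / real d) \<le> ln (real n) + 4"
proof -
  have "real n * (\<Sum>d=1..n. mangoldt d / real d) = (\<Sum>d=1..n. mangoldt d * (real n / real d))"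
    by (simp add: sum_distrib_left algebra_simps)
  also have "\<dots> \<le> (\<Sum>d=1..n. mangoldt d * (real (n div d) + 1))"
  proof (intro sum_mono mult_left_mono mangoldt_nonneg)
    fix d assume d: "d \<in> {1..n}"
    then have "n < d * (n div d + 1)"
      by (metis add.commute atLeastAtMost_iff d dividend_less_times_div le_zero_eq mult.right_neutral add_mult_distrib2 not_gr0 not_one_le_zero)
    then have "real n \<le> real d * (real (n div d) + 1)"
      by (metis less_imp_le of_nat_1 of_nat_add of_nat_le_iff of_nat_mult)
    then show "real n / real d \<le> real (n div d) + 1"
      using d by (simp add: field_simps)
  qed
  also have "\<dots> = ln (fact n) + (\<Sum>d=1..n. mangoldt d)"
    by (simp add: mangoldt_floor_sum[symmetric] sum.distrib algebra_simps)
  also have "\<dots> \<le> real n * ln (real n) + 4 * real n"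
  proof -
    have "(fact n :: real) \<le> real n ^ n"
      using fact_le_power[of n, where 'a=real] by simp
    then have "ln (fact n :: real) \<le> ln (real n ^ n)" using assms by (subst ln_le_cancel_iff) auto
    also have "\<dots> = real n * ln (real n)" using assms by (simp add: ln_realpow)
    finally show ?thesis using chebyshev_mangoldt_le[of n] by linarith
  qed
  finally have "real n * (\<Sum>d=1..n. mangoldt d / real d) \<le> real n * (ln (real n) + 4)"
    by (simp add: algebra_simps)
  then show ?thesis using assms by (simp add: mult_le_cancel_left)
qed

text \<open>Partial summation, arranged as an induction on \<open>B n - A n / ln n\<close>: its
  increment is \<open>A n * (1 / ln n - 1 / ln (n + 1))\<close>, so only the upper bound for
  \<open>A n\<close> enters, and \<open>1 - a/b \<le> ln b - ln a\<close> makes the main terms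
  telescope.\<close>

lemma mangoldt_over_ln_le:
  assumes "n \<ge> 2"
  shows "(\<Sum>d=2..n. mangoldt d / (real d * ln (real d))) \<le> ln (ln (real n)) + (1 - ln (ln 2) + 4 / ln 2)"
proof -
  define A where "A n = (\<Sum>d=2..n. mangoldt d / real d :: real)" for n :: nat
  define B where "B n = (\<Sum>d=2..n. mangoldt d / (real d * ln (real d)) :: real)" for n :: nat
  have A_le: "A n \<le> ln (real n) + 4" if "n \<ge> 2" for n
  proof -
    have "A n = (\<Sum>d=1..n. mangoldt d / real d :: real)"
      unfolding A_def using that by (subst (2) sum.atLeast_Suc_atMost) (auto simp: numeral_2_eq_2)
    then show ?thesis using mangoldt_over_self_le[of n] that by simp
  qed
  have "B n - A n / ln (real n) \<le> ln (ln (real n)) - ln (ln 2) + 4 / ln 2 - 4 / ln (real n)"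
    using assms
  proof (induction n rule: dec_induct)
    case base
    show ?case by (simp add: A_def B_def)
  next
    case (step n)
    define a b where "a = ln (real n)" and "b = ln (real (Suc n))"
    have ab: "0 < a" "a < b" using step by (auto simp: a_def b_def)
    have "B (Suc n) - A (Suc n) / b = B n - A n / b"
      using step ab by (simp add: A_def B_def b_def add_divide_distrib del: of_nat_Suc)
    also have "\<dots> = (B n - A n / a) + A n * (1/a - 1/b)" by (simp add: algebra_simps)
    also have "\<dots> \<le> (ln a - ln (ln 2) + 4 / ln 2 - 4 / a) + (a + 4) * (1/a - 1/b)"
    proof (intro add_mono mult_right_mono)
      show "0 \<le> 1/a - 1/b" using ab by (simp add: field_simps)
    qed (use step.IH A_le[OF step(1)] a_def in auto)
    also have "(a + 4) * (1/a - 1/b) = (1 - a/b) + 4 / a - 4 / b"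
      using ab by (simp add: field_simps)
    also have "1 - a/b \<le> ln b - ln a"
    proof -
      have "ln (a/b) \<le> a/b - 1" using ab by (intro ln_le_minus_one) auto
      then show ?thesis using ab by (simp add: ln_div)
    qed
    finally show ?case by (simp add: a_def b_def del: of_nat_Suc)
  qed
  moreover have "A n / ln (real n) \<le> 1 + 4 / ln (real n)"
    using A_le[OF assms] assms by (simp add: field_simps)
  ultimately show ?thesis unfolding B_def by linarith
qed

lemma sum_inverse_square_le: "(\<Sum>k=1..n. 1 / (real k)\<^sup>2) \<le> 2"
proof -
  have "n \<ge> 1 \<Longrightarrow> (\<Sum>k=1..n. 1 / (real k)\<^sup>2) \<le> 2 - 1 / real n"
  proof (induction n rule: dec_induct)
    case base show ?case by simp
  next
    case (step n)
    have "1 / (real (Suc n))\<^sup>2 \<le> 1 / (real n * real (Suc n))"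
      using step by (intro divide_left_mono) (auto simp: power2_eq_square)
    also have "\<dots> = 1 / real n - 1 / real (Suc n)"
      using step by (simp add: field_simps)
    finally have "1 / (real (Suc n))\<^sup>2 \<le> 1 / real n - 1 / real (Suc n)" .
    then show ?case using step by simp
  qed
  then show ?thesis by (cases "n = 0") (auto intro: order.trans)
qed

lemma sum_inverse_pred_square_le:
  assumes "finite P" "\<And>p. p \<in> P \<Longrightarrow> p \<ge> 2"
  shows "(\<Sum>p\<in>P. 1 / (real (p - 1))\<^sup>2) \<le> 2"
proof -
  have inj: "inj_on (\<lambda>p. p - 1) P"
    by (rule inj_onI) (metis One_nat_def Suc_1 Suc_le_lessD Suc_pred le_SucI lessI less_imp_Suc_add assms(2) zero_less_Suc le_less_trans not_less_eq less_trans)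
  have "(\<Sum>p\<in>P. 1 / (real (p - 1))\<^sup>2) = (\<Sum>k\<in>(\<lambda>p. p - 1) ` P. 1 / (real k)\<^sup>2)"
    by (subst sum.reindex[OF inj]) (simp add: o_def)
  also have "\<dots> \<le> (\<Sum>k=1..Max (insert 1 P). 1 / (real k)\<^sup>2)"
  proof (rule sum_mono2)
    show "(\<lambda>p. p - 1) ` P \<subseteq> {1..Max (insert 1 P)}"
    proof safe
      fix p assume "p \<in> P"
      moreover have "p \<le> Max (insert 1 P)" using \<open>p \<in> P\<close> assms(1) by (intro Max_ge) auto
      ultimately show "p - 1 \<in> {1..Max (insert 1 P)}" using assms(2)[of p] by auto
    qed
  qed auto
  also have "\<dots> \<le> 2" by (rule sum_inverse_square_le)
  finally show ?thesis .
qed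

text \<open>Each factor is \<open>1 + 1/p + 1/(p * (p - 1))\<close>. The second-order parts sum to
  at most 2, whence the factor \<open>exp 2\<close>.\<close>

lemma prod_primes_inverse_le_exp:
  assumes "finite P" "\<And>p. p \<in> P \<Longrightarrow> prime p"
  shows "(\<Prod>p\<in>P. 1 / (1 - 1 / real p)) \<le> exp 2 * exp (\<Sum>p\<in>P. 1 / real p)"
proof -
  have p2: "p \<ge> 2" if "p \<in> P" for p using assms(2)[OF that] by (simp add: prime_ge_2_nat)
  have "(\<Prod>p\<in>P. 1 / (1 - 1 / real p)) \<le> (\<Prod>p\<in>P. exp (1 / real p + 1 / (real (p - 1))\<^sup>2))"
  proof (intro prod_mono conjI)
    fix p assume "p \<in> P"
    note p = p2[OF this]
    show "0 \<le> 1 / (1 - 1 / real p)" using p by (simp add: field_simps)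
    have "1 / (1 - 1 / real p) = 1 + 1 / real (p - 1)" using p by (simp add: field_simps of_nat_diff)
    also have "1 / real (p - 1) = 1 / real p + 1 / (real p * real (p - 1))"
      using p by (simp add: field_simps of_nat_diff)
    also have "1 / (real p * real (p - 1)) \<le> 1 / (real (p - 1))\<^sup>2"
      using p by (intro divide_left_mono) (auto simp: power2_eq_square)
    finally have "1 / (1 - 1 / real p) \<le> 1 + (1 / real p + 1 / (real (p - 1))\<^sup>2)" by simp
    also have "\<dots> \<le> exp (1 / real p + 1 / (real (p - 1))\<^sup>2)" by (rule exp_ge_add_one_self)
    finally show "1 / (1 - 1 / real p) \<le> exp (1 / real p + 1 / (real (p - 1))\<^sup>2)" .
  qed
  also have "\<dots> = exp (\<Sum>p\<in>P. 1 / real p) * exp (\<Sum>p\<in>P. 1 / (real (p - 1))\<^sup>2)"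
    using assms(1) by (simp add: exp_sum exp_add prod.distrib)
  also have "(\<Sum>p\<in>P. 1 / (real (p - 1))\<^sup>2) \<le> 2" using assms(1) p2 by (rule sum_inverse_pred_square_le)
  finally show ?thesis by (simp add: mult.commute)
qed

text \<open>For a prime, \<open>1/p\<close> equals \<open>mangoldt p / (p * ln p)\<close>; higher
  prime powers only enlarge the sum, and exponentiating \<open>ln (ln n) + c\<close> gives
  \<open>ln n\<close>.\<close>

lemma mertens_upper:
  "\<exists>C\<ge>1. \<forall>n\<ge>2. (\<Prod>p | prime p \<and> p \<le> n. 1 / (1 - 1 / real p)) \<le> C * ln (real n)"
proof -
  define c where "c = 1 - ln (ln 2) + 4 / ln (2::real)"
  have "(\<Prod>p | prime p \<and> p \<le> n. 1 / (1 - 1 / real p)) \<le> exp (2 + c) * ln (real n)" if n: "n \<ge> 2" for n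
  proof -
    have fin: "finite {p. prime p \<and> p \<le> n}" by (rule finite_subset[of _ "{..n}"]) auto
    have "(\<Sum>p | prime p \<and> p \<le> n. 1 / real p)
        = (\<Sum>p | prime p \<and> p \<le> n. mangoldt p / (real p * ln (real p)))"
      by (intro sum.cong refl) (auto simp: prime_gt_1_nat dest: prime_gt_1_nat)
    also have "\<dots> \<le> (\<Sum>p=2..n. mangoldt p / (real p * ln (real p)))"
      by (intro sum_mono2) (auto intro: prime_ge_2_nat divide_nonneg_nonneg mangoldt_nonneg)
    also have "\<dots> \<le> ln (ln (real n)) + c" using mangoldt_over_ln_le[OF n] by (simp add: c_def)
    finally have 1: "(\<Sum>p | prime p \<and> p \<le> n. 1 / real p) \<le> ln (ln (real n)) + c" .
    have "(\<Prod>p | prime p \<and> p \<le> n. 1 / (1 - 1 / real p)) \<le> exp 2 * exp (\<Sum>p | prime p \<and> p \<le> n. 1 / real p)"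
      using fin by (intro prod_primes_inverse_le_exp) auto
    also have "\<dots> \<le> exp 2 * exp (ln (ln (real n)) + c)" using 1 by simp
    also have "\<dots> = exp (2 + c) * ln (real n)" using n by (simp add: exp_add)
    finally show ?thesis .
  qed
  moreover have "exp (2 + c) \<ge> 1"
  proof -
    have "ln (ln 2) \<le> (0::real)" using ln_2_less_1 by (subst ln_le_zero_iff) auto
    moreover have "4 / ln (2::real) \<ge> 0" by simp
    ultimately have "c \<ge> 0" unfolding c_def by linarith
    then show ?thesis by simp
  qed
  ultimately show ?thesis by blast
qed

section \<open>Euler products for sums over coprime integers\<close>

lemma one_minus_inverse_prime:
  assumes "prime p"
  shows "0 < 1 - 1 / real p" "1 - 1 / real p < 1" "1 \<le> 1 / (1 - 1 / real p)" "1 / (1 - 1 / real p) \<le> 2"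
    "1 / real p < 1" "1 / real p \<le> 1"
  using prime_ge_2_nat[OF assms] by (auto simp: field_simps)

text \<open>An upper bound by a truncated Euler product, by induction on the set of primes:
  \<open>n\<close> is determined by its exponent at \<open>p\<close> and its part prime to
  \<open>p\<close>. The exponent is below \<open>K\<close> because
  \<open>2 ^ v n \<le> p ^ v n \<le> n < 2 ^ K\<close>.\<close>

lemma sum_multiplicative_le_prod:
  fixes f :: "nat \<Rightarrow> real"
  assumes "finite P" "\<And>p. p \<in> P \<Longrightarrow> prime p"
    and "\<And>n. f n \<ge> 0" "f 1 = 1"
    and mult: "\<And>p k b. prime p \<Longrightarrow> b > 0 \<Longrightarrow> \<not> p dvd b \<Longrightarrow> f (p ^ k * b) = f (p ^ k) * f b"
    and "finite A" "\<And>n. n \<in> A \<Longrightarrow> n > 0 \<and> prime_factors n \<subseteq> P \<and> n < 2 ^ K"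
  shows "(\<Sum>n\<in>A. f n) \<le> (\<Prod>p\<in>P. \<Sum>k<K. f (p ^ k))"
  using assms(1,2,6,7)
proof (induction P arbitrary: A rule: finite_induct)
  case empty
  have "A \<subseteq> {1}"
  proof
    fix n assume "n \<in> A"
    then have "n > 0" "prime_factors n = {}" using empty by auto
    then show "n \<in> {1}" by (simp add: prime_factorization_empty_iff)
  qed
  then have "(\<Sum>n\<in>A. f n) \<le> (\<Sum>n\<in>{1}. f n)" by (intro sum_mono2 assms) auto
  then show ?case using assms(4) by simp
next
  case (insert p P)
  have p: "prime p" using insert by simp
  define v where "v n = multiplicity p n" for n
  define r where "r n = n div p ^ v n" for n
  have nr: "n = p ^ v n * r n" for n unfolding r_def v_def by (simp add: multiplicity_dvd)
  have r: "r n > 0" "\<not> p dvd r n" "prime_factors (r n) \<subseteq> P" "r n < 2 ^ K" "v n < K" if "n \<in> A" for n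
  proof -
    have n: "n > 0" "prime_factors n \<subseteq> insert p P" "n < 2 ^ K" using insert.prems(3)[OF that] by auto
    show r0: "r n > 0" using n nr[of n] by (metis gr0I mult_0_right not_gr0)
    show nd: "\<not> p dvd r n" unfolding r_def v_def
      using n p by (intro multiplicity_decompose) auto
    have "r n dvd n" using nr[of n] by (metis dvd_triv_right)
    then have "prime_factors (r n) \<subseteq> prime_factors n" using n by (intro dvd_prime_factors) auto
    moreover have "p \<notin> prime_factors (r n)" using nd by auto
    ultimately show "prime_factors (r n) \<subseteq> P" using n by auto
    show "r n < 2 ^ K" using n(3) \<open>r n dvd n\<close> n(1) by (meson dvd_imp_le le_less_trans)
    have "2 ^ v n \<le> p ^ v n" using p by (intro power_mono prime_ge_2_nat) auto
    also have "\<dots> \<le> n" using multiplicity_dvd[of p n] n unfolding v_def by (intro dvd_imp_le) auto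
    also have "\<dots> < 2 ^ K" by fact
    finally show "v n < K" by simp
  qed
  have "(\<Sum>n\<in>A. f n) = (\<Sum>n\<in>A. (case (v n, r n) of (k, b) \<Rightarrow> f (p ^ k) * f b))"
  proof (rule sum.cong)
    fix n assume "n \<in> A"
    have "f n = f (p ^ v n * r n)" using nr[of n] by simp
    also have "\<dots> = f (p ^ v n) * f (r n)" using r[OF \<open>n \<in> A\<close>] p by (intro mult) auto
    finally show "f n = (case (v n, r n) of (k, b) \<Rightarrow> f (p ^ k) * f b)" by simp
  qed simp
  also have "\<dots> = (\<Sum>(k, b)\<in>(\<lambda>n. (v n, r n)) ` A. f (p ^ k) * f b)"
  proof (subst sum.reindex)
    show "inj_on (\<lambda>n. (v n, r n)) A" using nr by (intro inj_onI) (metis prod.inject)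
  qed simp
  also have "\<dots> \<le> (\<Sum>(k, b)\<in>{..<K} \<times> r ` A. f (p ^ k) * f b)"
    using r insert.prems assms(3) by (intro sum_mono2) auto
  also have "\<dots> = (\<Sum>k<K. f (p ^ k)) * (\<Sum>b\<in>r ` A. f b)"
    by (simp add: sum_product sum.cartesian_product)
  also have "\<dots> \<le> (\<Sum>k<K. f (p ^ k)) * (\<Prod>p\<in>P. \<Sum>k<K. f (p ^ k))"
    using r insert.prems assms(3) by (intro mult_left_mono insert.IH sum_nonneg) auto
  finally show ?case using insert by simp
qed

text \<open>The bound is factored into a Mertens factor, to be cancelled later, and a factor whose
  product over all primes converges.\<close>

lemma sum_inverse_totient_prime_power_le:
  assumes "prime p"
  shows "(\<Sum>k<K. 1 / real (totient (p ^ k))) \<le> 1 / (1 - 1 / real p) * (1 + 1 / (real (p - 1))\<^sup>2)"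
proof -
  have p: "p \<ge> 2" using assms by (simp add: prime_ge_2_nat)
  define u where "u = real (p - 1)"
  have u: "u \<ge> 1" "real p = u + 1" using p by (auto simp: u_def of_nat_diff)
  have geo: "(\<Sum>k<K. (1 / real p) ^ k) \<le> real p / u" for K
  proof -
    have "(\<Sum>k<K. (1 / real p) ^ k) = (1 - (1 / real p) ^ K) / (1 - 1 / real p)"
      using p by (subst sum_gp_strict) auto
    also have "\<dots> \<le> 1 / (1 - 1 / real p)" using p by (intro divide_right_mono) auto
    also have "\<dots> = real p / u" using u by (simp add: field_simps)
    finally show ?thesis .
  qed
  have "(\<Sum>k<K. 1 / real (totient (p ^ k))) \<le> (\<Sum>k<Suc K. 1 / real (totient (p ^ k)))" by simp
  also have "\<dots> = 1 + (\<Sum>k<K. 1 / real (totient (p ^ Suc k)))"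
    by (subst sum.lessThan_Suc_shift) simp
  also have "(\<Sum>k<K. 1 / real (totient (p ^ Suc k))) = (\<Sum>k<K. (1 / real p) ^ k) / u"
    unfolding totient_prime_power_Suc[OF assms] u_def
    by (simp add: sum_divide_distrib power_divide)
  also have "\<dots> \<le> (real p / u) / u" using geo u by (intro divide_right_mono) auto
  also have "1 + (real p / u) / u \<le> 1 / (1 - 1 / real p) * (1 + 1 / u\<^sup>2)"
  proof -
    have "1 / (1 - 1 / real p) = 1 + 1 / u" using u by (simp add: field_simps)
    moreover have "(real p / u) / u = 1 / u + 1 / u\<^sup>2" using u by (simp add: field_simps power2_eq_square)
    moreover have "1 + (1 / u + 1 / u\<^sup>2) \<le> (1 + 1 / u) * (1 + 1 / u\<^sup>2)"
      using u by (simp add: field_simps power2_eq_square)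
    ultimately show ?thesis by simp
  qed
  finally show ?thesis unfolding u_def by simp
qed

lemma sum_inverse_totient_coprime_le:
  "(\<Sum>c | c \<in> {1..X} \<and> coprime c t. 1 / real (totient c))
     \<le> exp 2 * (\<Prod>p | prime p \<and> p \<le> X \<and> \<not> p dvd t. 1 / (1 - 1 / real p))"
proof -
  define P where "P = {p. prime p \<and> p \<le> X \<and> \<not> p dvd t}"
  have fin: "finite P" unfolding P_def by (rule finite_subset[of _ "{..X}"]) auto
  have p2: "p \<ge> 2" if "p \<in> P" for p using that by (simp add: P_def prime_ge_2_nat)
  have "(\<Sum>c | c \<in> {1..X} \<and> coprime c t. 1 / real (totient c))
      \<le> (\<Prod>p\<in>P. \<Sum>k<X. 1 / real (totient (p ^ k)))"
  proof (rule sum_multiplicative_le_prod[OF fin])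
    fix p k b :: nat assume "prime p" "\<not> p dvd b"
    then have "coprime (p ^ k) b" by (simp add: prime_imp_coprime)
    then show "1 / real (totient (p ^ k * b)) = 1 / real (totient (p ^ k)) * (1 / real (totient b))"
      by (simp add: totient_mult_coprime)
  next
    fix n assume n: "n \<in> {c. c \<in> {1..X} \<and> coprime c t}"
    have "n < 2 ^ n" by simp
    also have "(2::nat) ^ n \<le> 2 ^ X" using n by (intro power_increasing) auto
    finally have "n < 2 ^ X" .
    moreover have "prime_factors n \<subseteq> P"
    proof
      fix p assume p: "p \<in> prime_factors n"
      then have "p dvd n" "prime p" by auto
      moreover have "p \<le> n" using p n by (intro dvd_imp_le) auto
      moreover have "\<not> p dvd t" using n \<open>p dvd n\<close> \<open>prime p\<close>
        by (metis (no_types, lifting) coprime_common_divisor mem_Collect_eq not_prime_unit)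
      ultimately show "p \<in> P" using n by (auto simp: P_def)
    qed
    ultimately show "n > 0 \<and> prime_factors n \<subseteq> P \<and> n < 2 ^ X" using n by auto
  qed (auto simp: P_def)
  also have "\<dots> \<le> (\<Prod>p\<in>P. 1 / (1 - 1 / real p) * exp (1 / (real (p - 1))\<^sup>2))"
  proof (intro prod_mono conjI sum_nonneg)
    fix p assume p: "p \<in> P"
    have "(\<Sum>k<X. 1 / real (totient (p ^ k))) \<le> 1 / (1 - 1 / real p) * (1 + 1 / (real (p - 1))\<^sup>2)"
      using p by (intro sum_inverse_totient_prime_power_le) (auto simp: P_def)
    also have "\<dots> \<le> 1 / (1 - 1 / real p) * exp (1 / (real (p - 1))\<^sup>2)"
      using p2[OF p] by (intro mult_left_mono exp_ge_add_one_self) auto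
    finally show "(\<Sum>k<X. 1 / real (totient (p ^ k))) \<le> 1 / (1 - 1 / real p) * exp (1 / (real (p - 1))\<^sup>2)" .
  qed auto
  also have "\<dots> = (\<Prod>p\<in>P. 1 / (1 - 1 / real p)) * exp (\<Sum>p\<in>P. 1 / (real (p - 1))\<^sup>2)"
    using fin by (simp only: exp_sum prod.distrib)
  also have "\<dots> \<le> (\<Prod>p\<in>P. 1 / (1 - 1 / real p)) * exp 2"
  proof (intro mult_left_mono prod_nonneg)
    show "exp (\<Sum>p\<in>P. 1 / (real (p - 1))\<^sup>2) \<le> exp 2"
      using sum_inverse_pred_square_le[of P] fin p2 by simp
  qed (auto simp: P_def one_minus_inverse_prime)
  finally show ?thesis by (simp add: P_def mult.commute)
qed

text \<open>Expand \<open>ln c\<close> as a sum of \<open>mangoldt d\<close> over \<open>d dvd c\<close> and apply Chebyshev's bound to the sum over \<open>d\<close>.\<close>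
lemma sum_le_logarithmic_mean:
  fixes f :: "nat \<Rightarrow> real"
  assumes f: "\<And>n. f n \<ge> 0"
    and sub: "\<And>q b. primepow q \<Longrightarrow> b > 0 \<Longrightarrow> f (q * b) \<le> 2 * f b"
    and X: "X \<ge> 1"
  shows "ln (real X) * (\<Sum>c=1..X. f c) \<le> 9 * real X * (\<Sum>c=1..X. f c / real c)"
proof -
  have "(\<Sum>c=1..X. f c * ln (real c)) = (\<Sum>c=1..X. \<Sum>d | d dvd c. f c * mangoldt d)"
    by (intro sum.cong refl) (simp add: mangoldt_sum sum_distrib_left[symmetric])
  also have "\<dots> = (\<Sum>(c, d)\<in>(SIGMA c:{1..X}. {d. d dvd c}). f c * mangoldt d)"
    by (subst sum.Sigma) auto
  also have "\<dots> = (\<Sum>(b, d)\<in>(SIGMA b:{1..X}. {1..X div b}). f (d * b) * mangoldt d)"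
  proof (rule sum.reindex_bij_witness[of _ "\<lambda>(b, d). (d * b, d)" "\<lambda>(c, d). (c div d, d)"])
    fix a assume "a \<in> (SIGMA c:{1..X}. {d. d dvd c})"
    then obtain c d where a: "a = (c, d)" "c \<in> {1..X}" "d dvd c" by auto
    then obtain b where c: "c = d * b" by (auto elim: dvdE)
    have pos: "d > 0" "b > 0" using a c by (auto intro: Nat.gr0I)
    have "b \<le> d * b" using pos by simp
    moreover have "d \<le> X div b" using a c pos by (simp add: less_eq_div_iff_mult_less_eq)
    moreover have "d * b \<le> X" using a c by simp
    ultimately show "(case a of (c, d) \<Rightarrow> (c div d, d)) \<in> (SIGMA b:{1..X}. {1..X div b})"
      using a c pos order.trans[OF \<open>b \<le> d * b\<close> \<open>d * b \<le> X\<close>] by auto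
    show "(case case a of (c, d) \<Rightarrow> (c div d, d) of (b, d) \<Rightarrow> (d * b, d)) = a"
      "(case case a of (c, d) \<Rightarrow> (c div d, d) of (b, d) \<Rightarrow> f (d * b) * mangoldt d) = (case a of (c, d) \<Rightarrow> f c * mangoldt d)"
      using a c pos by auto
  next
    fix a assume "a \<in> (SIGMA b:{1..X}. {1..X div b})"
    then obtain b d where a: "a = (b, d)" "b \<in> {1..X}" "d \<in> {1..X div b}" by auto
    then have "d * b \<le> X" by (simp add: less_eq_div_iff_mult_less_eq)
    then show "(case a of (b, d) \<Rightarrow> (d * b, d)) \<in> (SIGMA c:{1..X}. {d. d dvd c})"
      using a by (auto simp: Suc_le_eq)
    show "(case case a of (b, d) \<Rightarrow> (d * b, d) of (c, d) \<Rightarrow> (c div d, d)) = a"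
      using a by auto
  qed
  also have "\<dots> = (\<Sum>b=1..X. \<Sum>d=1..X div b. f (d * b) * mangoldt d)"
    by (subst sum.Sigma) auto
  \<comment> \<open>Only prime powers \<open>d\<close> carry weight, and there \<open>sub\<close>
    removes \<open>d\<close> from the argument of \<open>f\<close>; the inner sum becomes a
    Chebyshev sum of size \<open>4 * X / b\<close>.\<close>
  also have "\<dots> \<le> (\<Sum>b=1..X. \<Sum>d=1..X div b. 2 * f b * mangoldt d)"
  proof (intro sum_mono)
    fix b d assume "b \<in> {1..X}" 
    show "f (d * b) * mangoldt d \<le> 2 * f b * mangoldt d"
    proof (cases "primepow d")
      case True
      then show ?thesis using \<open>b \<in> {1..X}\<close> by (intro mult_right_mono sub mangoldt_nonneg) auto
    qed (simp add: mangoldt_def)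
  qed
  also have "\<dots> = (\<Sum>b=1..X. 2 * f b * (\<Sum>d=1..X div b. mangoldt d))"
    by (simp add: sum_distrib_left)
  also have "\<dots> \<le> (\<Sum>b=1..X. 2 * f b * (4 * (real X / real b)))"
  proof (intro sum_mono mult_left_mono)
    fix b assume "b \<in> {1..X}"
    have "(\<Sum>d=1..X div b. mangoldt d :: real) \<le> 4 * real (X div b)" by (rule chebyshev_mangoldt_le)
    also have "real (X div b) \<le> real X / real b" by (rule of_nat_div_le_of_nat)
    finally show "(\<Sum>d=1..X div b. mangoldt d :: real) \<le> 4 * (real X / real b)" by simp
  qed (use f in auto)
  also have "\<dots> = 8 * real X * (\<Sum>b=1..X. f b / real b)"
    by (simp add: sum_distrib_left algebra_simps)
  finally have 1: "(\<Sum>c=1..X. f c * ln (real c)) \<le> 8 * real X * (\<Sum>b=1..X. f b / real b)" .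
  \<comment> \<open>The defect between \<open>ln X\<close> and \<open>ln c\<close> is at most
    \<open>X / c\<close>, which already is a logarithmic mean; together with the 8 above this gives
    the 9.\<close>
  have "(\<Sum>c=1..X. f c * (ln (real X) - ln (real c))) \<le> (\<Sum>c=1..X. f c * (real X / real c))"
  proof (intro sum_mono mult_left_mono f)
    fix c assume c: "c \<in> {1..X}"
    then have "ln (real X) - ln (real c) = ln (real X / real c)" by (simp add: ln_div)
    also have "\<dots> \<le> real X / real c" using c by (intro ln_bound) auto
    finally show "ln (real X) - ln (real c) \<le> real X / real c" .
  qed
  also have "\<dots> = real X * (\<Sum>b=1..X. f b / real b)" by (simp add: sum_distrib_left algebra_simps)
  finally have 2: "(\<Sum>c=1..X. f c * (ln (real X) - ln (real c))) \<le> real X * (\<Sum>b=1..X. f b / real b)" .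
  have "ln (real X) * (\<Sum>c=1..X. f c)
      = (\<Sum>c=1..X. f c * ln (real c)) + (\<Sum>c=1..X. f c * (ln (real X) - ln (real c)))"
    by (simp add: sum_distrib_left sum.distrib[symmetric] algebra_simps)
  also have "\<dots> \<le> 9 * real X * (\<Sum>c=1..X. f c / real c)" using 1 2 by linarith
  finally show ?thesis .
qed

section \<open>Mean values of \<open>c / totient c\<close>\<close>

lemma of_nat_div_totient_eq:
  assumes "n > 0"
  shows "real n / real (totient n) = (\<Prod>p\<in>prime_factors n. 1 / (1 - 1 / real p))"
proof -
  have "(\<Prod>p\<in>prime_factors n. 1 - 1 / real p) > 0"
    by (intro prod_pos) (auto simp: one_minus_inverse_prime in_prime_factors_iff)
  then show ?thesis using assms by (simp add: totient_formula2 prod_dividef)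
qed

text \<open>A prime power introduces at most one new prime, whose factor is at most 2. This supplies
  the hypothesis \<open>sub\<close> of \<open>sum_le_logarithmic_mean\<close>.\<close>

lemma div_totient_primepow_mult_le:
  assumes "primepow q" "b > 0"
  shows "real (q * b) / real (totient (q * b)) \<le> 2 * (real b / real (totient b))"
proof -
  obtain p k where q: "q = p ^ k" "prime p" "k > 0" using assms(1) by (auto simp: primepow_def)
  have "q > 0" using q by (simp add: prime_gt_0_nat)
  have pf: "prime_factors (q * b) = insert p (prime_factors b)"
    using q assms(2) \<open>q > 0\<close> by (simp add: prime_factors_product prime_factors_power prime_prime_factors)
  have "real (q * b) / real (totient (q * b)) = (\<Prod>p\<in>insert p (prime_factors b). 1 / (1 - 1 / real p))"
    using assms \<open>q > 0\<close> by (subst of_nat_div_totient_eq) (auto simp: pf)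
  also have "\<dots> \<le> 2 * (\<Prod>p\<in>prime_factors b. 1 / (1 - 1 / real p))"
  proof (cases "p \<in> prime_factors b")
    case True
    have "0 \<le> (\<Prod>p\<in>prime_factors b. 1 / (1 - 1 / real p))"
      by (intro prod_nonneg) (auto simp: one_minus_inverse_prime in_prime_factors_iff)
    then show ?thesis using True by (simp add: insert_absorb)
  next
    case False
    have "0 \<le> (\<Prod>p\<in>prime_factors b. 1 / (1 - 1 / real p))"
      by (intro prod_nonneg) (auto simp: one_minus_inverse_prime in_prime_factors_iff)
    then show ?thesis using False mult_right_mono[OF one_minus_inverse_prime(4)[OF q(2)]]
      by (simp add: mult_right_mono del: divide_divide_eq_left times_divide_eq_left)
  qed
  finally show ?thesis using assms by (simp add: of_nat_div_totient_eq)
qed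

text \<open>The logarithmic mean is the sum of \<open>1 / totient c\<close>, bounded by the Mertens
  product over the primes up to \<open>X\<close> not dividing \<open>t\<close>. Completing that
  product costs \<open>ln X\<close>, which cancels the gain of
  \<open>sum_le_logarithmic_mean\<close>, and leaves exactly the factors that will cancel the primes
  up to \<open>X\<close> in \<open>t / totient t\<close>.\<close>

lemma sum_coprime_div_totient_le:
  "\<exists>C\<ge>1. \<forall>t. \<forall>X\<ge>2. (\<Sum>c | c \<in> {1..X} \<and> coprime c t. real c / real (totient c))
      \<le> C * real X * (\<Prod>p | prime p \<and> p \<le> X \<and> p dvd t. 1 - 1 / real p)"
proof -
  obtain M where M: "M \<ge> 1" "\<And>n. n \<ge> 2 \<Longrightarrow> (\<Prod>p | prime p \<and> p \<le> n. 1 / (1 - 1 / real p)) \<le> M * ln (real n)"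
    using mertens_upper by blast
  have "(\<Sum>c | c \<in> {1..X} \<and> coprime c t. real c / real (totient c))
      \<le> (9 * exp 2 * M) * real X * (\<Prod>p | prime p \<and> p \<le> X \<and> p dvd t. 1 - 1 / real p)"
    if X: "X \<ge> 2" for t X
  proof -
    define f where "f c = (if coprime c t then real c / real (totient c) else 0)" for c
    have fin: "finite {p. prime p \<and> p \<le> X \<and> Q p}" for Q by (rule finite_subset[of _ "{..X}"]) auto
    have lnX: "ln (real X) > 0" using X by simp
    have e1: "(\<Sum>c | c \<in> {1..X} \<and> coprime c t. real c / real (totient c)) = (\<Sum>c=1..X. f c)"
      unfolding f_def by (subst sum.inter_filter[symmetric]) auto
    have e2: "ln (real X) * (\<Sum>c=1..X. f c) \<le> 9 * real X * (\<Sum>c=1..X. f c / real c)"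
    proof (rule sum_le_logarithmic_mean)
      fix q b :: nat assume "primepow q" "b > 0"
      then show "f (q * b) \<le> 2 * f b"
        using div_totient_primepow_mult_le[of q b] by (auto simp: f_def)
    qed (use X in \<open>auto simp: f_def\<close>)
    have e3: "(\<Sum>c=1..X. f c / real c) = (\<Sum>c | c \<in> {1..X} \<and> coprime c t. 1 / real (totient c))"
      by (subst sum.inter_filter) (auto simp: f_def intro!: sum.cong)
    have e4: "(\<Prod>p | prime p \<and> p \<le> X \<and> \<not> p dvd t. 1 / (1 - 1 / real p))
        \<le> M * ln (real X) * (\<Prod>p | prime p \<and> p \<le> X \<and> p dvd t. 1 - 1 / real p)" (is "?N \<le> _ * ?D")
    proof -
      have Dpos: "?D > 0" by (intro prod_pos) (auto simp: one_minus_inverse_prime in_prime_factors_iff)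
      have "(\<Prod>p | prime p \<and> p \<le> X. 1 / (1 - 1 / real p))
          = ?N * (\<Prod>p | prime p \<and> p \<le> X \<and> p dvd t. 1 / (1 - 1 / real p))"
        by (subst prod.union_disjoint[symmetric]) (auto intro!: fin prod.cong)
      also have "(\<Prod>p | prime p \<and> p \<le> X \<and> p dvd t. 1 / (1 - 1 / real p)) = 1 / ?D"
        by (simp add: prod_dividef)
      finally have "?N / ?D \<le> M * ln (real X)" using M(2)[OF X] by simp
      then show ?thesis using Dpos by (simp add: field_simps)
    qed
    have "ln (real X) * (\<Sum>c=1..X. f c)
        \<le> 9 * real X * (exp 2 * (M * ln (real X) * (\<Prod>p | prime p \<and> p \<le> X \<and> p dvd t. 1 - 1 / real p)))"
      using order.trans[OF sum_inverse_totient_coprime_le[of X t] mult_left_mono[OF e4, of "exp 2"]]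
      unfolding e3[symmetric] by (intro order.trans[OF e2] mult_left_mono) auto
    then have "ln (real X) * (\<Sum>c=1..X. f c)
        \<le> ln (real X) * ((9 * exp 2 * M) * real X * (\<Prod>p | prime p \<and> p \<le> X \<and> p dvd t. 1 - 1 / real p))"
      by (simp add: algebra_simps)
    then show ?thesis using lnX unfolding e1 by (simp only: mult_le_cancel_left_pos)
  qed
  moreover have "9 * exp 2 * M \<ge> 1"
  proof -
    have "exp 2 \<ge> (1::real)" by simp
    then have "9 * exp 2 * M \<ge> 1 * 1 * (1::real)" using M(1) by (intro mult_mono) auto
    then show ?thesis by simp
  qed
  ultimately show ?thesis by blast
qed

section \<open>A hypercontractive inequality for geometric kernels\<close>

text \<open>With truncated subtraction, \<open>(i - j) + (j - i)\<close> is the distance of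
  \<open>i\<close> and \<open>j\<close>. Each positive distance occurs at most once on either side
  of \<open>i\<close>, hence two geometric series.\<close>

lemma sum_power_dist_le:
  fixes r :: real
  assumes "0 \<le> r" "r < 1" "finite I"
  shows "(\<Sum>j\<in>I - {i}. r ^ ((i - j) + (j - i))) \<le> 2 * (r / (1 - r))"
proof -
  have geo: "(\<Sum>j\<in>J. r ^ h j) \<le> r / (1 - r)"
    if "finite J" "inj_on h J" "\<And>j. j \<in> J \<Longrightarrow> h j \<ge> 1" for J :: "nat set" and h :: "nat \<Rightarrow> nat"
  proof -
    define N where "N = Max (insert 1 (h ` J))"
    have "(\<Sum>j\<in>J. r ^ h j) = (\<Sum>d\<in>h ` J. r ^ d)" using that by (simp add: sum.reindex)
    also have "\<dots> \<le> (\<Sum>d\<in>{1..N}. r ^ d)"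
    proof (rule sum_mono2)
      show "h ` J \<subseteq> {1..N}" unfolding N_def using that by (auto intro!: Max_ge)
    qed (use assms in auto)
    also have "\<dots> = r * (\<Sum>d<N. r ^ d)"
      unfolding sum_distrib_left
      by (rule sum.reindex_bij_witness[of _ Suc "\<lambda>d. d - 1"]) (auto simp flip: power_Suc)
    also have "(\<Sum>d<N. r ^ d) = (1 - r ^ N) / (1 - r)" using assms by (subst sum_gp_strict) auto
    also have "\<dots> \<le> 1 / (1 - r)" using assms by (intro divide_right_mono) auto
    finally show ?thesis using assms by (simp add: mult_left_mono)
  qed
  have "(\<Sum>j\<in>I - {i}. r ^ ((i - j) + (j - i)))
      = (\<Sum>j\<in>{j\<in>I. j < i}. r ^ ((i - j) + (j - i))) + (\<Sum>j\<in>{j\<in>I. j > i}. r ^ ((i - j) + (j - i)))"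
    using assms by (subst sum.union_disjoint[symmetric]) (auto intro!: sum.cong)
  also have "(\<Sum>j\<in>{j\<in>I. j < i}. r ^ ((i - j) + (j - i))) \<le> r / (1 - r)"
    using assms by (intro geo) (auto simp: inj_on_def)
  also have "(\<Sum>j\<in>{j\<in>I. j > i}. r ^ ((i - j) + (j - i))) \<le> r / (1 - r)"
    using assms by (intro geo) (auto simp: inj_on_def)
  finally show ?thesis by simp
qed

text \<open>A weighted Young inequality for the conjugate exponents \<open>4/3\<close> and
  \<open>4\<close>. With \<open>z\<close> the fourth root of \<open>x\<close>, one of the two terms
  on the right dominates according to whether \<open>y \<le> \<eta> * z\<close>.\<close>

lemma powr_three_quarters_le:
  fixes x y :: real
  assumes "0 \<le> x" "0 \<le> y" "0 < \<eta>"
  shows "x powr (3/4) * y \<le> \<eta> * x + y ^ 4 / \<eta> ^ 3"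
proof (cases "x = 0 \<or> y = 0")
  case True then show ?thesis using assms by (auto simp: zero_power)
next
  case False
  then have pos: "x > 0" "y > 0" using assms by auto
  define z where "z = x powr (1/4)"
  have z: "z > 0" using pos by (simp add: z_def)
  have x: "x = z ^ 4" using pos by (simp add: z_def powr_powr flip: powr_realpow)
  have x34: "x powr (3/4) = z ^ 3" using pos by (simp add: z_def powr_powr flip: powr_realpow)
  show ?thesis
  proof (cases "y \<le> \<eta> * z")
    case True
    have "z ^ 3 * y \<le> z ^ 3 * (\<eta> * z)" using True z by (intro mult_left_mono) auto
    also have "\<dots> = \<eta> * x" by (simp add: x power4_eq_xxxx power3_eq_cube)
    finally show ?thesis using assms pos by (simp add: x34 add_increasing2)
  next
    case False
    then have "z \<le> y / \<eta>" using assms by (simp add: field_simps)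
    then have "z ^ 3 * y \<le> (y / \<eta>) ^ 3 * y" using z pos by (intro mult_right_mono power_mono) auto
    also have "\<dots> = y ^ 4 / \<eta> ^ 3" by (simp add: power_divide power4_eq_xxxx power3_eq_cube)
    finally show ?thesis using assms pos by (simp add: x34 add_increasing)
  qed
qed

text \<open>On the unit interval the exponent may be lowered to \<open>1/2\<close>, where the
  inequality of means applies.\<close>

lemma powr_three_quarters_mult_le_mean:
  fixes x y :: real
  assumes "0 \<le> x" "x \<le> 1" "0 \<le> y" "y \<le> 1"
  shows "(x * y) powr (3/4) \<le> (x + y) / 2"
proof -
  have "(x * y) powr (3/4) \<le> (x * y) powr (1/2)"
    using assms by (intro powr_mono') (auto intro: mult_le_one)
  also have "\<dots> = sqrt (x * y)" using assms by (simp add: powr_half_sqrt)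
  also have "\<dots> \<le> (x + y) / 2" using assms by (intro arith_geo_mean_sqrt)
  finally show ?thesis .
qed

text \<open>The two summands serve two ranges of \<open>p\<close> in the next lemma:
  \<open>42 * 112 ^ 4\<close> makes the claim trivial for \<open>p\<close> below
  \<open>112 ^ 4\<close>, and \<open>24 * 48 ^ 3\<close> is the cost of the dominant row and column
  for larger \<open>p\<close>.\<close>

definition kernel_const :: nat where
  "kernel_const = 42 * 112 ^ 4 + 24 * 48 ^ 3"

text \<open>
  Because the exponent exceeds \<open>1/2\<close>, the diagonal contributes at most \<open>1 - u/4\<close>, where \<open>u\<close> is the mass
  of \<open>f\<close> and \<open>g\<close> outside the index \<open>m\<close> maximizing \<open>f m * g m\<close>. Up to \<open>O(1/p)\<close>, this gain pays for the
  off-diagonal terms once \<open>p\<close> is large.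
\<close>
lemma bilinear_geometric_kernel_normalized:
  fixes f g :: "nat \<Rightarrow> real" and k :: "nat \<Rightarrow> nat \<Rightarrow> real"
  assumes p: "p \<ge> 2" and I: "finite I"
    and f: "\<And>i. f i \<ge> 0" "(\<Sum>i\<in>I. f i) = 1" and g: "\<And>i. g i \<ge> 0" "(\<Sum>i\<in>I. g i) = 1"
    and diag: "\<And>i. k i i \<le> 1"
    and off: "\<And>i j. i \<noteq> j \<Longrightarrow> k i j \<le> 3 * (real p powr (- 1/4)) ^ ((i - j) + (j - i))"
  shows "(\<Sum>i\<in>I. \<Sum>j\<in>I. (f i * g j) powr (3/4) * k i j) \<le> 1 + real kernel_const / real p"
proof -
  have kernel_const: "real kernel_const = 42 * 112 ^ 4 + 24 * 48 ^ 3" by (simp add: kernel_const_def)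
  define \<rho> where "\<rho> = real p powr (- 1/4)"
  define d where "d i j = (i - j) + (j - i)" for i j :: nat
  define e where "e i j = (f i * g j) powr (3/4) * \<rho> ^ d i j" for i j
  have \<rho>0: "\<rho> > 0" using p by (simp add: \<rho>_def)
  have \<rho>4: "\<rho> ^ 4 = 1 / real p"
  proof -
    have "\<rho> ^ 4 = real p powr (-1)" using p by (simp add: \<rho>_def powr_powr flip: powr_realpow)
    then show ?thesis using p by (simp add: powr_minus_divide)
  qed
  \<comment> \<open>From \<open>p \<ge> 2\<close>, because \<open>(17/20) ^ 4\<close> exceeds
    \<open>1/2\<close>; this keeps \<open>1 / (1 - \<rho>)\<close> below 7.\<close>
  have \<rho>1: "\<rho> \<le> 17/20"
  proof (rule ccontr)
    assume "\<not> \<rho> \<le> 17/20"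
    then have "(17/20) ^ 4 < \<rho> ^ 4" by (intro power_strict_mono) auto
    also have "\<dots> \<le> 1/2" using p by (simp add: \<rho>4 field_simps)
    finally show False by (simp add: power4_eq_xxxx)
  qed
  have f1: "f i \<le> 1" if "i \<in> I" for i
    using member_le_sum[of i I f] that f I by simp
  have g1: "g i \<le> 1" if "i \<in> I" for i
    using member_le_sum[of i I g] that g I by simp
  have ker: "(\<Sum>j\<in>J - {i}. \<rho> ^ d i j) \<le> 14 * \<rho>" if "finite J" for i J
  proof -
    have "(\<Sum>j\<in>J - {i}. \<rho> ^ d i j) \<le> 2 * (\<rho> / (1 - \<rho>))"
      unfolding d_def using \<rho>0 \<rho>1 that by (intro sum_power_dist_le) auto
    also have "\<rho> / (1 - \<rho>) \<le> 7 * \<rho>" using \<rho>0 \<rho>1 by (simp add: field_simps)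
    finally show ?thesis by simp
  qed
  have ker4: "(\<Sum>j\<in>I - {i}. (\<rho> ^ d i j) ^ 4) \<le> 4 / real p" for i
  proof -
    have "(\<Sum>j\<in>I - {i}. (\<rho> ^ d i j) ^ 4) = (\<Sum>j\<in>I - {i}. (1 / real p) ^ ((i - j) + (j - i)))"
      unfolding d_def \<rho>4[symmetric] by (simp add: power_mult[symmetric] mult.commute)
    also have "\<dots> \<le> 2 * ((1 / real p) / (1 - 1 / real p))"
      using p I by (intro sum_power_dist_le) auto
    also have "(1 / real p) / (1 - 1 / real p) \<le> 2 / real p" using p by (simp add: field_simps)
    finally show ?thesis by simp
  qed
  \<comment> \<open>Inequality of means and row or column sums of the kernel. The loss is of order
    \<rho>, affordable only when multiplied by a mass that the diagonal gains back.\<close>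
  have mean: "(\<Sum>i\<in>J. \<Sum>j\<in>J - {i}. e i j) \<le> ((\<Sum>i\<in>J. f i) + (\<Sum>i\<in>J. g i)) / 2 * (14 * \<rho>)" if J: "J \<subseteq> I" for J
  proof -
    have finJ: "finite J" using J I finite_subset by blast
    have "(\<Sum>i\<in>J. \<Sum>j\<in>J - {i}. e i j) \<le> (\<Sum>i\<in>J. \<Sum>j\<in>J - {i}. (f i + g j) / 2 * \<rho> ^ d i j)"
      unfolding e_def using J f g f1 g1 \<rho>0
      by (intro sum_mono mult_right_mono powr_three_quarters_mult_le_mean) auto
    also have "\<dots> = (\<Sum>i\<in>J. f i / 2 * (\<Sum>j\<in>J - {i}. \<rho> ^ d i j)) + (\<Sum>i\<in>J. \<Sum>j\<in>J - {i}. g j / 2 * \<rho> ^ d i j)"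
      by (simp add: add_divide_distrib distrib_right sum.distrib sum_distrib_left)
    also have "(\<Sum>i\<in>J. \<Sum>j\<in>J - {i}. g j / 2 * \<rho> ^ d i j) = (\<Sum>i\<in>J. \<Sum>j\<in>J. if i = j then 0 else g j / 2 * \<rho> ^ d i j)"
      using finJ by (intro sum.cong refl sum.mono_neutral_cong_left) auto
    also have "\<dots> = (\<Sum>j\<in>J. \<Sum>i\<in>J. if i = j then 0 else g j / 2 * \<rho> ^ d i j)" by (rule sum.swap)
    also have "\<dots> = (\<Sum>j\<in>J. g j / 2 * (\<Sum>i\<in>J - {j}. \<rho> ^ d j i))"
      unfolding sum_distrib_left
      using finJ by (intro sum.cong refl sum.mono_neutral_cong_right) (auto simp: d_def add.commute)
    also have "(\<Sum>i\<in>J. f i / 2 * (\<Sum>j\<in>J - {i}. \<rho> ^ d i j)) \<le> (\<Sum>i\<in>J. f i / 2 * (14 * \<rho>))"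
      using f finJ by (intro sum_mono mult_left_mono ker) auto
    also have "(\<Sum>i\<in>J. g i / 2 * (\<Sum>j\<in>J - {i}. \<rho> ^ d i j)) \<le> (\<Sum>i\<in>J. g i / 2 * (14 * \<rho>))"
      using g finJ by (intro sum_mono mult_left_mono ker) auto
    finally show ?thesis
      unfolding add_divide_distrib distrib_right sum_divide_distrib sum_distrib_right by linarith
  qed
  have diag_le: "(\<Sum>i\<in>I. (f i * g i) powr (3/4)) \<le> (\<Sum>i\<in>I. (f i + g i) / 2)"
    using f g f1 g1 by (intro sum_mono powr_three_quarters_mult_le_mean) auto
  have total: "(\<Sum>i\<in>I. \<Sum>j\<in>I. (f i * g j) powr (3/4) * k i j)
      \<le> (\<Sum>i\<in>I. (f i * g i) powr (3/4)) + 3 * (\<Sum>i\<in>I. \<Sum>j\<in>I - {i}. e i j)"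
  proof -
    have "(\<Sum>j\<in>I. (f i * g j) powr (3/4) * k i j) \<le> (f i * g i) powr (3/4) + 3 * (\<Sum>j\<in>I - {i}. e i j)"
      if i: "i \<in> I" for i
    proof -
      have "(\<Sum>j\<in>I. (f i * g j) powr (3/4) * k i j)
          = (f i * g i) powr (3/4) * k i i + (\<Sum>j\<in>I - {i}. (f i * g j) powr (3/4) * k i j)"
        using I i by (rule sum.remove)
      also have "(f i * g i) powr (3/4) * k i i \<le> (f i * g i) powr (3/4)"
        using diag[of i] by (simp add: mult_left_le)
      also have "(\<Sum>j\<in>I - {i}. (f i * g j) powr (3/4) * k i j) \<le> (\<Sum>j\<in>I - {i}. (f i * g j) powr (3/4) * (3 * \<rho> ^ d i j))"
        using off unfolding \<rho>_def d_def by (intro sum_mono mult_left_mono) auto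
      also have "\<dots> = 3 * (\<Sum>j\<in>I - {i}. e i j)" by (simp add: e_def sum_distrib_left algebra_simps)
      finally show ?thesis by simp
    qed
    then show ?thesis unfolding sum_distrib_left sum.distrib[symmetric] by (intro sum_mono) (simp add: sum_distrib_left)
  qed
  show ?thesis
  \<comment> \<open>The threshold balances the second case: there the terms linear in
    \<open>u\<close> are at most \<open>3 * (u/48 + 7 * \<rho> * u)\<close>, and
    \<open>\<rho> \<le> 1/112\<close> makes this at most \<open>u/4\<close>, precisely the gain on
    the diagonal.\<close>
  proof (cases "\<rho> \<le> 1/112")
    case False
    have "(\<Sum>i\<in>I. \<Sum>j\<in>I. (f i * g j) powr (3/4) * k i j) \<le> 1 + 3 * (14 * \<rho>)"
      using total diag_le mean[of I] f g by (simp add: sum.distrib sum_divide_distrib[symmetric])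
    also have "\<dots> \<le> 1 + 42 * 1" using \<rho>1 by simp
    also have "42 * 1 \<le> 42 * (112 ^ 4 / real p)"
    proof (intro mult_left_mono)
      have "(1/112) ^ 4 \<le> \<rho> ^ 4" using False by (intro power_mono) auto
      then show "1 \<le> 112 ^ 4 / real p" by (simp add: \<rho>4 field_simps)
    qed simp
    also have "1 + 42 * (112 ^ 4 / real p) \<le> 1 + (42 * 112 ^ 4 + 24 * 48 ^ 3) / real p"
      using p by (simp add: divide_right_mono)
    finally show ?thesis unfolding kernel_const by simp
  next
    case True
    have "I \<noteq> {}" using f by auto
    then have "Max ((\<lambda>i. f i * g i) ` I) \<in> (\<lambda>i. f i * g i) ` I" using I by (intro Max_in) auto
    then obtain m where m1: "m \<in> I" "Max ((\<lambda>i. f i * g i) ` I) = f m * g m" by auto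
    have m: "m \<in> I" "\<And>i. i \<in> I \<Longrightarrow> f i * g i \<le> f m * g m"
      unfolding m1(2)[symmetric] using m1(1) I by (auto intro: Max_ge)
    define u where "u = (1 - f m) + (1 - g m)"
    have f0: "(\<Sum>i\<in>I - {m}. f i) = 1 - f m" using sum.remove[OF I m(1), of f] f by simp
    have g0: "(\<Sum>i\<in>I - {m}. g i) = 1 - g m" using sum.remove[OF I m(1), of g] g by simp
    have "(\<Sum>i\<in>I. (f i * g i) powr (3/4)) \<le> (\<Sum>i\<in>I. (f m * g m) powr (1/4) * ((f i + g i) / 2))"
    proof (rule sum_mono)
      fix i assume i: "i \<in> I"
      have "(f i * g i) powr (3/4) = (f i * g i) powr (1/4) * (f i * g i) powr (1/2)"
        by (simp flip: powr_add)
      also have "\<dots> \<le> (f m * g m) powr (1/4) * ((f i + g i) / 2)"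
      proof (intro mult_mono)
        have "(f i * g i) powr (1/2) = sqrt (f i * g i)" using f g by (simp add: powr_half_sqrt)
        also have "\<dots> \<le> (f i + g i) / 2" using f g by (intro arith_geo_mean_sqrt)
        finally show "(f i * g i) powr (1/2) \<le> (f i + g i) / 2" .
      qed (use m i f g in \<open>auto intro: powr_mono2\<close>)
      finally show "(f i * g i) powr (3/4) \<le> (f m * g m) powr (1/4) * ((f i + g i) / 2)" .
    qed
    also have "\<dots> = (f m * g m) powr (1/4)"
      using f g by (simp add: sum_distrib_left[symmetric] sum_divide_distrib[symmetric] sum.distrib)
    \<comment> \<open>The product \<open>f m * g m\<close> is at most \<open>(1 - u/2)^2\<close>,
      hence at most \<open>(1 - u/4)^4\<close>, and a fourth root is taken.\<close>
    also have "\<dots> \<le> 1 - u / 4"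
    proof -
      have u: "0 \<le> u" "u \<le> 2" using f1[OF m(1)] g1[OF m(1)] f(1)[of m] g(1)[of m] by (auto simp: u_def)
      have "f m * g m \<le> ((f m + g m) / 2)\<^sup>2"
        using zero_le_power2[of "f m - g m"] by (simp add: power2_eq_square field_simps)
      also have "(f m + g m) / 2 = 1 - u / 2" by (simp add: u_def field_simps)
      also have "(1 - u / 2)\<^sup>2 \<le> ((1 - u / 4)\<^sup>2)\<^sup>2"
        using u by (intro power_mono) (auto simp: power2_eq_square field_simps)
      also have "\<dots> = (1 - u / 4) powr 4" using u by (subst powr_numeral) auto
      finally have "(f m * g m) powr (1/4) \<le> ((1 - u / 4) powr 4) powr (1/4)"
        using f g by (intro powr_mono2) auto
      also have "((1 - u / 4) powr 4) powr (1/4) = 1 - u / 4" unfolding powr_powr using u by simp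
      finally show ?thesis .
    qed
    finally have 1: "(\<Sum>i\<in>I. (f i * g i) powr (3/4)) \<le> 1 - u / 4" .
    \<comment> \<open>Young's inequality raises the kernel to the fourth power, and
      \<open>\<rho> ^ 4 = 1/p\<close>: the row and the column through \<open>m\<close> cost
      \<open>O(1/p)\<close> plus a small multiple of the mass off \<open>m\<close>.\<close>
    have row: "(\<Sum>j\<in>I - {m}. h j powr (3/4) * \<rho> ^ d m j) \<le> (\<Sum>j\<in>I - {m}. h j) / 48 + 4 * 48 ^ 3 / real p"
      if h: "\<And>j. h j \<ge> 0" for h
    proof -
      have "(\<Sum>j\<in>I - {m}. h j powr (3/4) * \<rho> ^ d m j) \<le> (\<Sum>j\<in>I - {m}. 1/48 * h j + (\<rho> ^ d m j) ^ 4 / (1/48) ^ 3)"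
        using h \<rho>0 by (intro sum_mono powr_three_quarters_le) auto
      also have "\<dots> = (\<Sum>j\<in>I - {m}. h j) / 48 + 48 ^ 3 * (\<Sum>j\<in>I - {m}. (\<rho> ^ d m j) ^ 4)"
        unfolding sum.distrib sum_divide_distrib sum_distrib_left
        by (intro arg_cong2[where f="(+)"] sum.cong refl) (auto simp: power_divide)
      also have "\<dots> \<le> (\<Sum>j\<in>I - {m}. h j) / 48 + 48 ^ 3 * (4 / real p)"
        by (intro add_left_mono mult_left_mono ker4) auto
      finally show ?thesis by simp
    qed
    have "(\<Sum>j\<in>I - {m}. e m j) \<le> (\<Sum>j\<in>I - {m}. g j powr (3/4) * \<rho> ^ d m j)"
      unfolding e_def using f g f1[OF m(1)] \<rho>0
      by (intro sum_mono mult_right_mono powr_mono2) (auto simp: mult_left_le_one_le)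
    with row[of g, OF g(1)] have 2: "(\<Sum>j\<in>I - {m}. e m j) \<le> (1 - g m) / 48 + 4 * 48 ^ 3 / real p"
      by (simp add: g0)
    have "(\<Sum>i\<in>I - {m}. e i m) \<le> (\<Sum>i\<in>I - {m}. f i powr (3/4) * \<rho> ^ d m i)"
      unfolding e_def d_def using f g g1[OF m(1)] \<rho>0
      by (subst (2) add.commute, intro sum_mono mult_right_mono powr_mono2) (auto simp: mult_left_le)
    with row[of f, OF f(1)] have 3: "(\<Sum>i\<in>I - {m}. e i m) \<le> (1 - f m) / 48 + 4 * 48 ^ 3 / real p"
      by (simp add: f0)
    \<comment> \<open>Both indices now avoid \<open>m\<close>, so the total mass is only
      \<open>u\<close> and the cruder bound \<open>mean\<close> is enough.\<close>
    have 4: "(\<Sum>i\<in>I - {m}. \<Sum>j\<in>I - {m} - {i}. e i j) \<le> u / 2 * (14 * \<rho>)"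
      using mean[of "I - {m}"] by (simp add: f0 g0 u_def)
    have "(\<Sum>i\<in>I. \<Sum>j\<in>I - {i}. e i j) = (\<Sum>j\<in>I - {m}. e m j) + (\<Sum>i\<in>I - {m}. \<Sum>j\<in>I - {i}. e i j)"
      using I m(1) by (rule sum.remove)
    also have "(\<Sum>i\<in>I - {m}. \<Sum>j\<in>I - {i}. e i j) = (\<Sum>i\<in>I - {m}. e i m + (\<Sum>j\<in>I - {m} - {i}. e i j))"
    proof (intro sum.cong refl)
      fix i assume "i \<in> I - {m}"
      then have "(\<Sum>j\<in>I - {i}. e i j) = e i m + (\<Sum>j\<in>I - {i} - {m}. e i j)"
        using I m(1) by (intro sum.remove) auto
      also have "I - {i} - {m} = I - {m} - {i}" by auto
      finally show "(\<Sum>j\<in>I - {i}. e i j) = e i m + (\<Sum>j\<in>I - {m} - {i}. e i j)" .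
    qed
    also have "\<dots> = (\<Sum>i\<in>I - {m}. e i m) + (\<Sum>i\<in>I - {m}. \<Sum>j\<in>I - {m} - {i}. e i j)" by (rule sum.distrib)
    finally have 5: "(\<Sum>i\<in>I. \<Sum>j\<in>I - {i}. e i j) \<le> u / 48 + 8 * 48 ^ 3 / real p + u / 2 * (14 * \<rho>)"
      using 2 3 4 by (simp add: u_def field_simps)
    have "u / 2 * (14 * \<rho>) \<le> u / 2 * (14 * (1/112))"
      using True f1[OF m(1)] g1[OF m(1)] by (intro mult_left_mono) (auto simp: u_def)
    with 1 5 total have "(\<Sum>i\<in>I. \<Sum>j\<in>I. (f i * g j) powr (3/4) * k i j) \<le> 1 + 24 * 48 ^ 3 / real p"
      by simp
    also have "\<dots> \<le> 1 + (42 * 112 ^ 4 + 24 * 48 ^ 3) / real p"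
      using p by (intro add_left_mono divide_right_mono) auto
    finally show ?thesis unfolding kernel_const .
  qed
qed

lemma bilinear_geometric_kernel:
  fixes f g :: "nat \<Rightarrow> real" and k :: "nat \<Rightarrow> nat \<Rightarrow> real"
  assumes p: "p \<ge> 2" and I: "finite I"
    and f: "\<And>i. f i \<ge> 0" and g: "\<And>i. g i \<ge> 0"
    and diag: "\<And>i. k i i \<le> 1"
    and off: "\<And>i j. i \<noteq> j \<Longrightarrow> k i j \<le> 3 * (real p powr (- 1/4)) ^ ((i - j) + (j - i))"
  shows "(\<Sum>i\<in>I. \<Sum>j\<in>I. (f i * g j) powr (3/4) * k i j)
      \<le> (1 + real kernel_const / real p) * ((\<Sum>i\<in>I. f i) * (\<Sum>i\<in>I. g i)) powr (3/4)"
proof -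
  define F G where "F = (\<Sum>i\<in>I. f i)" and "G = (\<Sum>i\<in>I. g i)"
  have FG: "F \<ge> 0" "G \<ge> 0" using f g by (auto simp: F_def G_def sum_nonneg)
  show ?thesis
  proof (cases "F = 0 \<or> G = 0")
    case True
    have "f i * g j = 0" if "i \<in> I" "j \<in> I" for i j
      using True that f g I by (auto simp: F_def G_def sum_nonneg_eq_0_iff)
    then have "(\<Sum>i\<in>I. \<Sum>j\<in>I. (f i * g j) powr (3/4) * k i j) = 0"
      by (intro sum.neutral ballI) simp
    then show ?thesis by simp
  next
    case False
    then have pos: "F > 0" "G > 0" using FG by auto
    have "(\<Sum>i\<in>I. \<Sum>j\<in>I. (f i / F * (g j / G)) powr (3/4) * k i j) \<le> 1 + real kernel_const / real p"
      using assms pos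
      by (intro bilinear_geometric_kernel_normalized) (auto simp: sum_divide_distrib[symmetric] F_def[symmetric] G_def[symmetric])
    moreover have "(f i / F * (g j / G)) powr (3/4) = (f i * g j) powr (3/4) / (F * G) powr (3/4)" for i j
      using f g pos by (simp add: powr_divide powr_mult)
    moreover have "(F * G) powr (3/4) > 0" using pos by simp
    ultimately have "(\<Sum>i\<in>I. \<Sum>j\<in>I. (f i * g j) powr (3/4) * k i j) / (F * G) powr (3/4) \<le> 1 + real kernel_const / real p"
      by (simp add: sum_divide_distrib)
    with \<open>(F * G) powr (3/4) > 0\<close> show ?thesis by (simp add: F_def[symmetric] G_def[symmetric] pos_divide_le_eq)
  qed
qed

text \<open>The one-prime inequality tensorizes. The sets are split into fibres of the exponent at
  \<open>q\<close>, the induction hypothesis bounds each pair of fibres, and the one-prime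
  inequality is applied to the fibre masses, which reappear with the same power \<open>3/4\<close>.
  Separation of points by the exponents leaves at most one element on each side when no prime
  remains.\<close>

lemma bilinear_geometric_kernel_prod:
  fixes v :: "nat \<Rightarrow> 'a \<Rightarrow> nat" and f g :: "'a \<Rightarrow> real" and k :: "nat \<Rightarrow> nat \<Rightarrow> nat \<Rightarrow> real"
  assumes "finite P" and "\<And>p. p \<in> P \<Longrightarrow> p \<ge> 2"
    and f: "\<And>i. f i \<ge> 0" and g: "\<And>i. g i \<ge> 0"
    and nonneg: "\<And>p i j. k p i j \<ge> 0"
    and diag: "\<And>p i. k p i i \<le> 1"
    and off: "\<And>p i j. i \<noteq> j \<Longrightarrow> k p i j \<le> 3 * (real p powr (- 1/4)) ^ ((i - j) + (j - i))"
    and "finite S" "finite T"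
    and "\<And>m n. m \<in> S \<Longrightarrow> n \<in> S \<Longrightarrow> (\<forall>p\<in>P. v p m = v p n) \<Longrightarrow> m = n"
    and "\<And>m n. m \<in> T \<Longrightarrow> n \<in> T \<Longrightarrow> (\<forall>p\<in>P. v p m = v p n) \<Longrightarrow> m = n"
  shows "(\<Sum>m\<in>S. \<Sum>n\<in>T. (f m * g n) powr (3/4) * (\<Prod>p\<in>P. k p (v p m) (v p n)))
      \<le> (\<Prod>p\<in>P. 1 + real kernel_const / real p) * ((\<Sum>m\<in>S. f m) * (\<Sum>n\<in>T. g n)) powr (3/4)"
  using assms(1,2,8-)
proof (induction P arbitrary: S T rule: finite_induct)
  case empty
  have "S = {} \<or> (\<exists>m. S = {m})" using empty by blast
  moreover have "T = {} \<or> (\<exists>m. T = {m})" using empty by blast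
  ultimately show ?case by auto
next
  case (insert q P)
  define C where "C = (\<Prod>p\<in>P. 1 + real kernel_const / real p)"
  have C: "C \<ge> 0" unfolding C_def by (intro prod_nonneg) auto
  define I where "I = v q ` S \<union> v q ` T"
  have I: "finite I" using insert by (simp add: I_def)
  define Sf where "Sf i = {m\<in>S. v q m = i}" for i
  define Tf where "Tf i = {m\<in>T. v q m = i}" for i
  have S: "(\<Sum>m\<in>S. h m) = (\<Sum>i\<in>I. \<Sum>m\<in>Sf i. h m)" for h :: "'a \<Rightarrow> real"
    unfolding Sf_def using insert I by (subst sum.group) (auto simp: I_def)
  have T: "(\<Sum>m\<in>T. h m) = (\<Sum>i\<in>I. \<Sum>m\<in>Tf i. h m)" for h :: "'a \<Rightarrow> real"
    unfolding Tf_def using insert I by (subst sum.group) (auto simp: I_def)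
  have "(\<Sum>m\<in>S. \<Sum>n\<in>T. (f m * g n) powr (3/4) * (\<Prod>p\<in>insert q P. k p (v p m) (v p n)))
      = (\<Sum>i\<in>I. \<Sum>j\<in>I. k q i j * (\<Sum>m\<in>Sf i. \<Sum>n\<in>Tf j. (f m * g n) powr (3/4) * (\<Prod>p\<in>P. k p (v p m) (v p n))))"
  proof -
    have "(\<Sum>m\<in>Sf i. \<Sum>j\<in>I. \<Sum>n\<in>Tf j. (f m * g n) powr (3/4) * (\<Prod>p\<in>insert q P. k p (v p m) (v p n)))
        = (\<Sum>j\<in>I. k q i j * (\<Sum>m\<in>Sf i. \<Sum>n\<in>Tf j. (f m * g n) powr (3/4) * (\<Prod>p\<in>P. k p (v p m) (v p n))))" for i
      unfolding sum_distrib_left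
      by (subst sum.swap, intro sum.cong refl) (use insert in \<open>auto simp: Sf_def Tf_def\<close>)
    then show ?thesis unfolding S T by simp
  qed
  also have "\<dots> \<le> (\<Sum>i\<in>I. \<Sum>j\<in>I. k q i j * (C * ((\<Sum>m\<in>Sf i. f m) * (\<Sum>n\<in>Tf j. g n)) powr (3/4)))"
    unfolding C_def
    by (intro sum_mono mult_left_mono nonneg insert.IH) (use insert.prems in \<open>auto simp: Sf_def Tf_def\<close>)
  also have "\<dots> = C * (\<Sum>i\<in>I. \<Sum>j\<in>I. ((\<Sum>m\<in>Sf i. f m) * (\<Sum>n\<in>Tf j. g n)) powr (3/4) * k q i j)"
    by (simp add: sum_distrib_left algebra_simps)
  also have "\<dots> \<le> C * ((1 + real kernel_const / real q) * ((\<Sum>i\<in>I. \<Sum>m\<in>Sf i. f m) * (\<Sum>i\<in>I. \<Sum>m\<in>Tf i. g m)) powr (3/4))"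
    using insert.prems I C f g diag off
    by (intro mult_left_mono bilinear_geometric_kernel) (auto intro: sum_nonneg)
  finally show ?case using insert by (simp add: C_def S T mult_ac)
qed

section \<open>Counting pairs of reduced residues\<close>

lemma bij_betw_affine_mod:
  fixes u q r :: nat
  assumes "coprime u q" "q > 0"
  shows "bij_betw (\<lambda>x. (u * x + r) mod q) {..<q} {..<q}"
proof -
  have inj: "inj_on (\<lambda>x. (u * x + r) mod q) {..<q}"
  proof (rule inj_onI)
    fix x y assume xy: "x \<in> {..<q}" "y \<in> {..<q}" "(u * x + r) mod q = (u * y + r) mod q"
    then have "[u * x + r = u * y + r] (mod q)" by (simp add: cong_def)
    then have "[u * x = u * y] (mod q)" by (simp add: cong_add_rcancel_nat)
    then have "[x = y] (mod q)" using assms by (simp add: cong_mult_lcancel_nat)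
    then show "x = y" using xy by (simp add: cong_def)
  qed
  moreover have "(\<lambda>x. (u * x + r) mod q) ` {..<q} = {..<q}"
    using assms by (intro endo_inj_surj inj) auto
  ultimately show ?thesis by (simp add: bij_betw_def)
qed

text \<open>A Chinese remainder count. Writing \<open>j = p * i + r\<close> turns the condition
  modulo another prime \<open>q\<close> into one on \<open>i\<close> with forbidden set
  \<open>R' r q\<close>; it has as many elements as \<open>R q\<close>, because \<open>p\<close> is
  invertible modulo \<open>q\<close>.\<close>

lemma card_mod_avoiding:
  assumes "finite P" "\<And>p. p \<in> P \<Longrightarrow> prime p" "\<Prod>P dvd g" "\<And>p. p \<in> P \<Longrightarrow> R p \<subseteq> {..<p}"
  shows "real (card {j\<in>{..<g}. \<forall>p\<in>P. j mod p \<notin> R p}) = real g * (\<Prod>p\<in>P. 1 - real (card (R p)) / real p)"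
  using assms
proof (induction P arbitrary: g R rule: finite_induct)
  case empty
  then show ?case by simp
next
  case (insert p P)
  have p: "prime p" using insert by auto
  have pdvd: "p * \<Prod>P dvd g" using insert by simp
  define h where "h = g div p"
  have g: "g = p * h" using pdvd by (auto simp: h_def dvd_def)
  have Ph: "\<Prod>P dvd h" using pdvd p by (auto simp: g)
  define R' where "R' r q = {x\<in>{..<q}. (p * x + r) mod q \<in> R q}" for r q
  have card_R': "card (R' r q) = card (R q)" if q: "q \<in> P" for r q
  proof (rule bij_betw_same_card)
    have q': "prime q" "q \<noteq> p" using insert that by auto
    then have cop: "coprime p q" using p by (simp add: primes_coprime)
    have inj: "inj_on (\<lambda>x. (p * x + r) mod q) {..<q}" and "(\<lambda>x. (p * x + r) mod q) ` {..<q} = {..<q}"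
      using bij_betw_affine_mod[OF cop, of r] q' by (auto simp: bij_betw_def prime_gt_0_nat)
    then have "(\<lambda>x. (p * x + r) mod q) ` R' r q = R q"
      using insert.prems(3)[of q] q unfolding R'_def by (auto simp: image_iff)
    then show "bij_betw (\<lambda>x. (p * x + r) mod q) (R' r q) (R q)"
      unfolding bij_betw_def using inj by (auto intro: inj_on_subset simp: R'_def)
  qed
  have "{j\<in>{..<g}. \<forall>q\<in>insert p P. j mod q \<notin> R q}
      = (\<Union>r\<in>{..<p} - R p. (\<lambda>i. p * i + r) ` {i\<in>{..<h}. \<forall>q\<in>P. i mod q \<notin> R' r q})" (is "?A = ?B")
  proof (intro equalityI subsetI)
    fix j assume j: "j \<in> ?A"
    define r i where "r = j mod p" and "i = j div p"
    have ji: "j = p * i + r" by (simp add: r_def i_def)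
    have "r < p" using p by (simp add: r_def prime_gt_0_nat)
    moreover have "i < h" using j p by (simp add: i_def g less_mult_imp_div_less mult.commute)
    moreover have "i mod q \<notin> R' r q" if "q \<in> P" for q
    proof -
      have "(p * (i mod q) + r) mod q = j mod q" unfolding ji
        by (metis mod_add_left_eq mod_mult_right_eq)
      then show ?thesis using j that by (auto simp: R'_def)
    qed
    moreover have "r \<notin> R p" using j by (simp add: r_def)
    ultimately show "j \<in> ?B" by (intro UN_I[of r] image_eqI[of _ _ i] ji) auto
  next
    fix j assume "j \<in> ?B"
    then obtain r i where ri: "j = p * i + r" "r < p" "r \<notin> R p" "i < h" "\<forall>q\<in>P. i mod q \<notin> R' r q" by auto
    have "p * i + r < p * (i + 1)" using ri by simp
    also have "\<dots> \<le> p * h" using ri by (intro mult_le_mono) auto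
    finally have "j < g" using ri g by simp
    moreover have "j mod p = r" using ri by simp
    moreover have "j mod q \<notin> R q" if "q \<in> P" for q
    proof -
      have "q > 0" using insert that by (auto simp: prime_gt_0_nat)
      moreover have "(p * (i mod q) + r) mod q = j mod q" unfolding ri
        by (metis mod_add_left_eq mod_mult_right_eq)
      ultimately show ?thesis using ri(5) that by (auto simp: R'_def)
    qed
    ultimately show "j \<in> ?A" using ri by auto
  qed
  also have "card \<dots> = (\<Sum>r\<in>{..<p} - R p. card ((\<lambda>i. p * i + r) ` {i\<in>{..<h}. \<forall>q\<in>P. i mod q \<notin> R' r q}))"
  proof (intro card_UN_disjoint ballI impI)
    fix r s assume rs: "r \<in> {..<p} - R p" "s \<in> {..<p} - R p" "r \<noteq> s"
    show "(\<lambda>i. p * i + r) ` {i\<in>{..<h}. \<forall>q\<in>P. i mod q \<notin> R' r q} \<inter> (\<lambda>i. p * i + s) ` {i\<in>{..<h}. \<forall>q\<in>P. i mod q \<notin> R' s q} = {}"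
    proof (intro equalityI subsetI)
      fix x assume "x \<in> (\<lambda>i. p * i + r) ` {i\<in>{..<h}. \<forall>q\<in>P. i mod q \<notin> R' r q} \<inter> (\<lambda>i. p * i + s) ` {i\<in>{..<h}. \<forall>q\<in>P. i mod q \<notin> R' s q}"
      then obtain i i' where x: "x = p * i + r" "x = p * i' + s" by blast
      have "x mod p = r" unfolding x(1) using rs by simp
      moreover have "x mod p = s" unfolding x(2) using rs by simp
      ultimately have "x mod p = r" "x mod p = s" .
      then show "x \<in> {}" using rs by simp
    qed simp
  qed auto
  also have "\<dots> = (\<Sum>r\<in>{..<p} - R p. card {i\<in>{..<h}. \<forall>q\<in>P. i mod q \<notin> R' r q})"
    using p by (intro sum.cong refl card_image) (auto simp: inj_on_def prime_gt_0_nat)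
  finally have "real (card ?A) = (\<Sum>r\<in>{..<p} - R p. real (card {i\<in>{..<h}. \<forall>q\<in>P. i mod q \<notin> R' r q}))"
    by simp
  also have "\<dots> = (\<Sum>r\<in>{..<p} - R p. real h * (\<Prod>q\<in>P. 1 - real (card (R q)) / real q))"
  proof (intro sum.cong refl)
    fix r
    have "real (card {i\<in>{..<h}. \<forall>q\<in>P. i mod q \<notin> R' r q}) = real h * (\<Prod>q\<in>P. 1 - real (card (R' r q)) / real q)"
      using insert.prems Ph by (intro insert.IH) (auto simp: R'_def)
    then show "real (card {i\<in>{..<h}. \<forall>q\<in>P. i mod q \<notin> R' r q}) = real h * (\<Prod>q\<in>P. 1 - real (card (R q)) / real q)"
      by (simp add: card_R')
  qed
  also have "\<dots> = (real p - real (card (R p))) * (real h * (\<Prod>q\<in>P. 1 - real (card (R q)) / real q))"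
  proof -
    have "R p \<subseteq> {..<p}" using insert by auto
    then have "card ({..<p} - R p) = p - card (R p)" "card (R p) \<le> p"
      using card_mono[of "{..<p}" "R p"] by (auto simp: card_Diff_subset finite_subset)
    then show ?thesis by (simp add: of_nat_diff)
  qed
  also have "\<dots> = real g * (\<Prod>q\<in>insert p P. 1 - real (card (R q)) / real q)"
    using insert p by (simp add: g field_simps prime_gt_0_nat)
  finally show ?case .
qed

lemma prod_prime_factors_dvd:
  fixes g :: nat
  assumes "g > 0"
  shows "\<Prod>(prime_factors g) dvd g"
proof -
  have "(\<Prod>p\<in>prime_factors g. p) dvd (\<Prod>p\<in>prime_factors g. p ^ multiplicity p g)"
    by (intro prod_dvd_prod dvd_power) (auto simp: prime_factors_multiplicity)
  also have "\<dots> = g" using assms by (simp add: prod_prime_factors)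
  finally show ?thesis .
qed

lemma exists_root_mod_prime:
  fixes p u r :: nat
  assumes "prime p" "\<not> p dvd u"
  shows "\<exists>x<p. p dvd r + u * x"
proof -
  have "coprime u p" using assms by (simp add: prime_imp_coprime coprime_commute)
  then have "(\<lambda>x. (u * x + r) mod p) ` {..<p} = {..<p}"
    using bij_betw_affine_mod[of u p r] assms by (simp add: bij_betw_def prime_gt_0_nat)
  moreover have "0 \<in> {..<p}" using assms by (simp add: prime_gt_0_nat)
  ultimately obtain x where "x < p" "(u * x + r) mod p = 0" by (metis (mono_tags, lifting) imageE lessThan_iff)
  then show ?thesis by (auto simp: add.commute mod_eq_0_iff_dvd)
qed

text \<open>
  The solutions of \<open>a v - b u = c\<close> form a progression \<open>a\<^sub>0 + u j\<close>, \<open>b\<^sub>0 + v j\<close>, and each prime \<open>p\<close> dividing \<open>g\<close>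
  forbids at least one residue of \<open>j\<close> modulo \<open>p\<close>, and two if \<open>p\<close> does not divide \<open>u v c\<close>.
\<close>
lemma card_coprime_pairs_le:
  fixes m n g u v :: nat and c :: int
  assumes "m > 0" "n > 0" and g: "g = gcd m n" and u: "m = g * u" and v: "n = g * v"
  shows "real (card {(a, b). a \<in> {1..m} \<and> b \<in> {1..n} \<and> coprime a m \<and> coprime b n \<and> int a * int v - int b * int u = c})
     \<le> real g * (\<Prod>p\<in>prime_factors g. 1 - 1 / real p)
        * (\<Prod>p\<in>{p\<in>prime_factors g. \<not> p dvd u * v \<and> \<not> int p dvd c}. 1 - 1 / real p)"
    (is "real (card ?S) \<le> ?B")
proof -
  define S where "S = ?S"
  have S_iff: "(a, b) \<in> S \<longleftrightarrow> a \<in> {1..m} \<and> b \<in> {1..n} \<and> coprime a m \<and> coprime b n \<and> int a * int v - int b * int u = c" for a b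
    by (simp add: S_def)
  have "real (card S) \<le> ?B"
  proof (cases "S = {}")
    case True
    have "?B \<ge> 0" by (intro mult_nonneg_nonneg prod_nonneg) (auto simp: one_minus_inverse_prime in_prime_factors_iff)
    then show ?thesis by (simp add: True)
  next
    case False
    have "g * u > 0" "g * v > 0" using assms(1,2) unfolding u[symmetric] v[symmetric] .
    then have pos: "g > 0" "u > 0" "v > 0" by auto
    have cop: "coprime u v"
    proof -
      have "g * gcd u v = g" using g u v by (metis gcd_mult_distrib_nat)
      then have "gcd u v = 1" using pos by simp
      then show ?thesis by (simp only: coprime_iff_gcd_eq_1)
    qed
    have fin: "finite S" by (rule finite_subset[of _ "{1..m} \<times> {1..n}"]) (auto simp: S_iff)
    \<comment> \<open>Starting from the smallest first coordinate makes the progression parameter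
      \<open>j\<close> a natural number; \<open>a \<le> m = g * u\<close> then forces
      \<open>j < g\<close>.\<close>
    obtain a0 b0 where ab0: "(a0, b0) \<in> S" "\<And>a b. (a, b) \<in> S \<Longrightarrow> a0 \<le> a"
    proof -
      have "Min (fst ` S) \<in> fst ` S" using False fin by (intro Min_in) auto
      then obtain z where "z \<in> S" "fst z = Min (fst ` S)" by auto
      moreover have "Min (fst ` S) \<le> a" if "(a, b) \<in> S" for a b
        using that fin by (intro Min_le) (auto intro: image_eqI[of _ _ "(a, b)"])
      ultimately show ?thesis using that[of "fst z" "snd z"] by (metis prod.collapse)
    qed
    define R where "R p = {x\<in>{..<p}. p dvd a0 + u * x \<or> p dvd b0 + v * x}" for p
    define J where "J = {j\<in>{..<g}. \<forall>p\<in>prime_factors g. j mod p \<notin> R p}"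
    have par: "\<exists>j. a = a0 + u * j \<and> b = b0 + v * j \<and> j \<in> J" if ab: "(a, b) \<in> S" for a b
    proof -
      have "a0 \<le> a" using ab0(2)[OF ab] .
      have "int a * int v - int b * int u = int a0 * int v - int b0 * int u" using ab ab0(1) by (auto simp: S_iff)
      then have eq: "int v * (int a - int a0) = int u * (int b - int b0)" by (simp add: algebra_simps)
      then have "int u dvd int v * (int a - int a0)" by simp
      then have "int u dvd int a - int a0" using cop by (simp add: coprime_dvd_mult_right_iff)
      then have "u dvd a - a0" using \<open>a0 \<le> a\<close> by (metis of_nat_diff of_nat_dvd_iff)
      then obtain j where "a - a0 = u * j" by (auto elim: dvdE)
      then have j: "a = a0 + u * j" using \<open>a0 \<le> a\<close> by simp
      then have "int u * (int b - int b0) = int u * (int v * int j)" using eq by (simp add: algebra_simps)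
      then have "int b = int (b0 + v * j)" using pos by simp
      then have b: "b = b0 + v * j" by (simp only: of_nat_eq_iff)
      have "a \<le> m" "a0 \<ge> 1" using ab ab0(1) by (auto simp: S_iff)
      then have "u * j < u * g" using j u mult.commute[of g u] by linarith
      then have "j < g" by simp
      moreover have "j mod p \<notin> R p" if p: "p \<in> prime_factors g" for p
      proof
        assume "j mod p \<in> R p"
        moreover have "p dvd x + y * (j mod p) \<longleftrightarrow> p dvd x + y * j" for x y
          by (simp add: dvd_eq_mod_eq_0) (metis mod_add_right_eq mod_mult_right_eq)
        ultimately have "p dvd a \<or> p dvd b" using j b by (auto simp: R_def)
        moreover have "p dvd m" "p dvd n" "prime p" using p u v by auto
        ultimately show False using ab not_prime_unit[of p] coprime_common_divisor[of a m p] coprime_common_divisor[of b n p] by (auto simp: S_iff)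
      qed
      ultimately show ?thesis using j b by (auto simp: J_def)
    qed
    have "S \<subseteq> (\<lambda>j. (a0 + u * j, b0 + v * j)) ` J" using par by fastforce
    then have "card S \<le> card J"
      using surj_card_le[of J S] by (simp add: J_def)
    then have "real (card S) \<le> real (card J)" by simp
    also have "\<dots> = real g * (\<Prod>p\<in>prime_factors g. 1 - real (card (R p)) / real p)"
      unfolding J_def using pos by (intro card_mod_avoiding prod_prime_factors_dvd) (auto simp: R_def)
    also have "\<dots> \<le> real g * (\<Prod>p\<in>prime_factors g. (1 - 1 / real p) * (if \<not> p dvd u * v \<and> \<not> int p dvd c then 1 - 1 / real p else 1))"
    proof (intro mult_left_mono prod_mono conjI)
      fix p assume pg: "p \<in> prime_factors g"
      then have p: "prime p" by auto
      then have p0: "p > 0" by (simp add: prime_gt_0_nat)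
      have finR: "finite (R p)" by (simp add: R_def)
      have "card (R p) \<le> card {..<p}" by (intro card_mono) (auto simp: R_def)
      then show "0 \<le> 1 - real (card (R p)) / real p" using p0 by simp
      have one: "card (R p) \<ge> 1"
      proof -
        have "\<not> p dvd u \<or> \<not> p dvd v" using cop p coprime_common_divisor not_prime_unit by blast
        then have "R p \<noteq> {}"
          using exists_root_mod_prime[OF p, of u a0] exists_root_mod_prime[OF p, of v b0] by (auto simp: R_def)
        then show ?thesis using finR by (simp add: Suc_le_eq card_gt_0_iff)
      qed
      show "1 - real (card (R p)) / real p \<le> (1 - 1 / real p) * (if \<not> p dvd u * v \<and> \<not> int p dvd c then 1 - 1 / real p else 1)"
      proof (cases "\<not> p dvd u * v \<and> \<not> int p dvd c")
        case True
        then have nd: "\<not> p dvd u" "\<not> p dvd v" by auto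
        obtain x where x: "x < p" "p dvd a0 + u * x" using exists_root_mod_prime[OF p nd(1), of a0] by auto
        obtain y where y: "y < p" "p dvd b0 + v * y" using exists_root_mod_prime[OF p nd(2), of b0] by auto
        \<comment> \<open>A common root would let \<open>p\<close> divide both terms of the
          invariant \<open>a * v - b * u = c\<close>.\<close>
        have "x \<noteq> y"
        proof
          assume "x = y"
          have "int p dvd int (a0 + u * x) * int v" "int p dvd int (b0 + v * x) * int u"
            using x y \<open>x = y\<close> by (auto simp only: int_dvd_int_iff intro!: dvd_mult2)
          then have "int p dvd int (a0 + u * x) * int v - int (b0 + v * x) * int u" by (rule dvd_diff)
          also have "\<dots> = int a0 * int v - int b0 * int u" by (simp add: algebra_simps)
          also have "\<dots> = c" using ab0 by (auto simp: S_iff)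
          finally show False using True by simp
        qed
        have "card {x, y} \<le> card (R p)" using x y finR by (intro card_mono) (auto simp: R_def)
        then have "real (card (R p)) \<ge> 2" using \<open>x \<noteq> y\<close> by simp
        then have "1 - real (card (R p)) / real p \<le> 1 - 2 / real p" using p0 by (simp add: divide_right_mono)
        also have "\<dots> \<le> (1 - 1 / real p) * (1 - 1 / real p)" by (simp add: algebra_simps)
        finally show ?thesis using True by simp
      next
        case False
        have "1 - real (card (R p)) / real p \<le> 1 - 1 / real p" using p0 one by (simp add: divide_right_mono)
        then show ?thesis unfolding if_not_P[OF False] by simp
      qed
    qed auto
    also have "(\<Prod>p\<in>prime_factors g. (1 - 1 / real p) * (if \<not> p dvd u * v \<and> \<not> int p dvd c then 1 - 1 / real p else 1))
        = (\<Prod>p\<in>prime_factors g. 1 - 1 / real p) * (\<Prod>p\<in>{p\<in>prime_factors g. \<not> p dvd u * v \<and> \<not> int p dvd c}. 1 - 1 / real p)"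
      unfolding prod.distrib by (subst prod.inter_filter) auto
    finally show ?thesis by (simp add: mult.assoc)
  qed
  then show ?thesis unfolding S_def .
qed

text \<open>All factors become products over one set \<open>U\<close> of primes and are compared one
  prime at a time. For \<open>p\<close> dividing \<open>g\<close>, both totient ratios contribute
  \<open>w p\<close>, and the excess is undone when \<open>p\<close> divides \<open>u * v\<close> or
  \<open>c\<close>. Otherwise \<open>p\<close> divides at most one of \<open>m\<close> and
  \<open>n\<close>, and this factor is cancelled by that of \<open>u * v\<close>.\<close>

lemma card_coprime_pairs_le_totient:
  fixes m n g u v :: nat and c :: int
  assumes "m > 0" "n > 0" and g: "g = gcd m n" and u: "m = g * u" and v: "n = g * v" and "c \<noteq> 0"
  shows "real (card {(a, b). a \<in> {1..m} \<and> b \<in> {1..n} \<and> coprime a m \<and> coprime b n \<and> int a * int v - int b * int u = c})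
     \<le> real g * (real (totient m) / real m) * (real (totient n) / real n)
        * (real (u * v) / real (totient (u * v))) * (real (nat \<bar>c\<bar>) / real (totient (nat \<bar>c\<bar>)))"
proof -
  have "g * u > 0" "g * v > 0" using assms(1,2) unfolding u[symmetric] v[symmetric] .
  then have pos: "g > 0" "u > 0" "v > 0" by auto
  define C where "C = nat \<bar>c\<bar>"
  have C: "C > 0" "int p dvd c \<longleftrightarrow> p dvd C" for p using assms(6) by (auto simp: C_def dvd_nat_abs_iff)
  define U where "U = prime_factors (m * n * C)"
  define w where "w p = 1 - 1 / real p" for p :: nat
  have w: "0 < w p" "w p \<le> 1" if "p \<in> U" for p
    using that one_minus_inverse_prime[of p] by (auto simp: w_def U_def in_prime_factors_iff)
  have pf: "prime_factors k = {p\<in>U. p dvd k}" if "k dvd m * n * C" "k > 0" for k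
    using dvd_trans[OF _ that(1)] that(2) assms(1,2) C(1) unfolding U_def
    by (auto simp only: in_prime_factors_iff mult_eq_0_iff)
  have phi: "real (totient k) / real k = (\<Prod>p\<in>U. if p dvd k then w p else 1)" if "k dvd m * n * C" "k > 0" for k
  proof -
    have "real (totient k) / real k = (\<Prod>p\<in>prime_factors k. w p)" using that by (simp add: totient_formula2 w_def)
    also have "prime_factors k = {p\<in>U. p dvd k}" by (rule pf[OF that])
    also have "(\<Prod>p\<in>{p\<in>U. p dvd k}. w p) = (\<Prod>p\<in>U. if p dvd k then w p else 1)"
      by (subst prod.inter_filter) (auto simp: U_def)
    finally show ?thesis .
  qed
  have inv: "real k / real (totient k) = (\<Prod>p\<in>U. 1 / (if p dvd k then w p else 1))" if "k dvd m * n * C" "k > 0" for k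
    using phi[OF that] by (simp add: prod_dividef) (metis inverse_divide inverse_eq_divide)
  have gd: "g dvd m * n * C" by (simp add: u)
  have uv: "u * v dvd m * n * C" using u v by (metis dvd_mult2 dvd_triv_right mult_dvd_mono)
  have "real (card {(a, b). a \<in> {1..m} \<and> b \<in> {1..n} \<and> coprime a m \<and> coprime b n \<and> int a * int v - int b * int u = c})
     \<le> real g * ((\<Prod>p\<in>prime_factors g. w p) * (\<Prod>p\<in>{p\<in>prime_factors g. \<not> p dvd u * v \<and> \<not> int p dvd c}. w p))"
    using card_coprime_pairs_le[OF assms(1-5)] by (simp add: w_def mult.assoc)
  also have "(\<Prod>p\<in>prime_factors g. w p) = (\<Prod>p\<in>U. if p dvd g then w p else 1)"
  proof -
    have "prime_factors g = {p\<in>U. p dvd g}" using gd pos(1) by (rule pf)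
    then show ?thesis by (simp, subst prod.inter_filter) (auto simp: U_def)
  qed
  also have "(\<Prod>p\<in>{p\<in>prime_factors g. \<not> p dvd u * v \<and> \<not> int p dvd c}. w p)
      = (\<Prod>p\<in>U. if p dvd g \<and> \<not> p dvd u * v \<and> \<not> p dvd C then w p else 1)"
  proof -
    have "{p\<in>prime_factors g. \<not> p dvd u * v \<and> \<not> int p dvd c} = {p\<in>U. p dvd g \<and> \<not> p dvd u * v \<and> \<not> p dvd C}"
      unfolding pf[OF gd pos(1)] C(2) by blast
    then show ?thesis by (simp, subst prod.inter_filter) (auto simp: U_def)
  qed
  also have "(\<Prod>p\<in>U. if p dvd g then w p else 1) * (\<Prod>p\<in>U. if p dvd g \<and> \<not> p dvd u * v \<and> \<not> p dvd C then w p else 1)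
      \<le> (\<Prod>p\<in>U. (if p dvd m then w p else 1) * (if p dvd n then w p else 1)
           * (1 / (if p dvd u * v then w p else 1)) * (1 / (if p dvd C then w p else 1)))"
    unfolding prod.distrib[symmetric]
  proof (intro prod_mono conjI)
    fix p assume p: "p \<in> U"
    note w' = w[OF p]
    show "0 \<le> (if p dvd g then w p else 1) * (if p dvd g \<and> \<not> p dvd u * v \<and> \<not> p dvd C then w p else 1)"
      using w' by auto
    have pr: "prime p" using p by (auto simp: U_def)
    have dm: "p dvd m \<longleftrightarrow> p dvd g \<or> p dvd u" using u pr by (auto simp: prime_dvd_mult_iff)
    have dn: "p dvd n \<longleftrightarrow> p dvd g \<or> p dvd v" using v pr by (auto simp: prime_dvd_mult_iff)
    have dg: "p dvd g \<longleftrightarrow> p dvd m \<and> p dvd n" by (simp add: g)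
    have duv: "p dvd u * v \<longleftrightarrow> p dvd u \<or> p dvd v" using pr by (simp add: prime_dvd_mult_iff)
    have i1: "1 \<le> 1 / w p" using w' by simp
    have i2: "1 * 1 \<le> 1 / w p * (1 / w p)" using i1 w' by (intro mult_mono) auto
    have i3: "w p \<le> 1 / w p" using i1 w' by linarith
    show "(if p dvd g then w p else 1) * (if p dvd g \<and> \<not> p dvd u * v \<and> \<not> p dvd C then w p else 1)
      \<le> (if p dvd m then w p else 1) * (if p dvd n then w p else 1)
           * (1 / (if p dvd u * v then w p else 1)) * (1 / (if p dvd C then w p else 1))"
    proof (cases "p dvd g")
      case True
      then have "p dvd m" "p dvd n" by (auto simp: dg)
      then show ?thesis using True w' i1 by (cases "p dvd u * v"; cases "p dvd C") auto
    next
      case False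
      then have "\<not> (p dvd m \<and> p dvd n)" by (simp add: dg)
      moreover have "p dvd m \<or> p dvd n \<longleftrightarrow> p dvd u * v" using False dm dn duv by auto
      ultimately show ?thesis using False w' i1 i2
        by (cases "p dvd m"; cases "p dvd n"; cases "p dvd C") auto
    qed
  qed
  also have "\<dots> = (real (totient m) / real m) * (real (totient n) / real n)
        * (real (u * v) / real (totient (u * v))) * (real C / real (totient C))"
  proof -
    have "m dvd m * n * C" "n dvd m * n * C" "C dvd m * n * C" "u * v > 0" using pos by auto
    then show ?thesis
      unfolding prod.distrib using phi[of m] phi[of n] inv[of "u * v"] inv[of C] assms(1,2) C(1) uv by simp
  qed
  finally show ?thesis using pos by (simp add: C_def mult.assoc mult_left_mono)
qed

section \<open>Overlap estimates\<close>

definition coprime_residues :: "nat \<Rightarrow> nat set" where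
  "coprime_residues n = {a\<in>{1..n}. coprime a n}"

definition approx_interval :: "(nat \<Rightarrow> real) \<Rightarrow> nat \<Rightarrow> nat \<Rightarrow> real set" where
  "approx_interval \<psi> n a = {(real a - \<psi> n) / real n <..< (real a + \<psi> n) / real n}"

text \<open>The total length of the intervals with denominator \<open>n\<close>, counted with
  multiplicity.\<close>

definition mass :: "(nat \<Rightarrow> real) \<Rightarrow> nat \<Rightarrow> real" where
  "mass \<psi> n = 2 * \<psi> n * real (totient n) / real n"

text \<open>The integral of the product of the two functions counting the intervals that contain a
  point; these are the entries of the second moment.\<close>

definition overlap :: "(nat \<Rightarrow> real) \<Rightarrow> nat \<Rightarrow> nat \<Rightarrow> real" where
  "overlap \<psi> m n = (\<Sum>a\<in>coprime_residues m. \<Sum>b\<in>coprime_residues n.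
      measure lborel (approx_interval \<psi> m a \<inter> approx_interval \<psi> n b))"

definition reduced_mult :: "nat \<Rightarrow> nat \<Rightarrow> nat" where
  "reduced_mult m n = (m div gcd m n) * (n div gcd m n)"

text \<open>The larger half-length in units of \<open>1 / lcm m n\<close>, the unit in which
  differences of fractions with denominators \<open>m\<close> and \<open>n\<close> are
  integers.\<close>

definition spacing :: "(nat \<Rightarrow> real) \<Rightarrow> nat \<Rightarrow> nat \<Rightarrow> real" where
  "spacing \<psi> m n = max (real n * \<psi> m) (real m * \<psi> n) / real (gcd m n)"

text \<open>The range \<open>2 * D\<close> arises because the two half-lengths add up to at most
  twice the larger one. At \<open>D = 0\<close> the value is 0 by the convention for
  division.\<close>

definition coprime_mean :: "nat \<Rightarrow> real \<Rightarrow> real" where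
  "coprime_mean t D = real t / real (totient t)
     * ((\<Sum>c | c \<in> {1..nat \<lfloor>2 * D\<rfloor>} \<and> coprime c t. real c / real (totient c)) / D)"

lemma finite_coprime_residues [simp]: "finite (coprime_residues n)"
  by (simp add: coprime_residues_def)

lemma card_coprime_residues: "card (coprime_residues n) = totient n"
proof -
  have "coprime_residues n = totatives n" by (auto simp: coprime_residues_def totatives_def)
  then show ?thesis by (simp add: totient_def)
qed

lemma measure_interval_Int_le:
  fixes x y \<delta> \<Delta> :: real
  assumes "\<delta> \<ge> 0" "\<Delta> \<ge> 0"
  shows "measure lborel ({x - \<delta><..<x + \<delta>} \<inter> {y - \<Delta><..<y + \<Delta>})
      \<le> (if \<bar>x - y\<bar> < \<delta> + \<Delta> then 2 * min \<delta> \<Delta> else 0)"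
proof (cases "\<bar>x - y\<bar> < \<delta> + \<Delta>")
  case True
  have "{x - \<delta><..<x + \<delta>} \<inter> {y - \<Delta><..<y + \<Delta>} = {max (x - \<delta>) (y - \<Delta>)<..<min (x + \<delta>) (y + \<Delta>)}" by auto
  then show ?thesis using True assms by (auto simp: measure_lborel_Ioo min_def max_def split: if_splits)
next
  case False
  then have "{x - \<delta><..<x + \<delta>} \<inter> {y - \<Delta><..<y + \<Delta>} = {}" using assms by (auto simp: abs_if split: if_splits)
  then show ?thesis using False by simp
qed

text \<open>A prime dividing \<open>c\<close> and \<open>u\<close> divides \<open>a * v\<close>,
  against coprimality of \<open>a\<close> to \<open>m\<close> and of \<open>u\<close> to
  \<open>v\<close>; symmetrically for \<open>v\<close>. This restriction on \<open>c\<close> is the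
  source of all cancellation against \<open>t / totient t\<close>.\<close>

lemma coprime_difference:
  fixes a b m n u v g :: nat and c :: int
  assumes "coprime a m" "coprime b n" "u dvd m" "v dvd n" "coprime u v" "int a * int v - int b * int u = c"
  shows "coprime (nat \<bar>c\<bar>) (u * v)"
proof (rule ccontr)
  assume "\<not> coprime (nat \<bar>c\<bar>) (u * v)"
  then have "gcd (nat \<bar>c\<bar>) (u * v) \<noteq> 1" by (simp only: coprime_iff_gcd_eq_1 simp_thms)
  then obtain p where pr: "prime p" and "p dvd gcd (nat \<bar>c\<bar>) (u * v)" using prime_factor_nat by blast
  then have "p dvd nat \<bar>c\<bar>" "p dvd u * v" using dvd_trans gcd_dvd1 gcd_dvd2 by blast+
  then have p: "prime p" "int p dvd c" "p dvd u \<or> p dvd v"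
    using pr by (simp_all add: prime_dvd_mult_iff dvd_nat_abs_iff)
  have nu: "\<not> is_unit p" using p(1) by auto
  from p(3) show False
  proof
    assume pu: "p dvd u"
    then have "int p dvd c + int b * int u" using p(2) by auto
    moreover have "c + int b * int u = int (a * v)" using assms(6) by simp
    ultimately have "int p dvd int (a * v)" by simp
    then have "p dvd a \<or> p dvd v" using p(1) by (simp only: int_dvd_int_iff prime_dvd_mult_iff)
    then show False using pu assms(1,3,5) nu by (meson coprime_common_divisor dvd_trans)
  next
    assume pv: "p dvd v"
    then have "int p dvd int a * int v - c" using p(2) by auto
    moreover have "int a * int v - c = int (b * u)" using assms(6) by simp
    ultimately have "int p dvd int (b * u)" by simp
    then have "p dvd b \<or> p dvd u" using p(1) by (simp only: int_dvd_int_iff prime_dvd_mult_iff)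
    then show False using pv assms(2,4,5) nu by (meson coprime_common_divisor dvd_trans)
  qed
qed

text \<open>Each pair of intersecting intervals contributes at most
  \<open>2 * min \<delta> \<Delta>\<close>, and the pairs are sorted by the numerator
  \<open>c\<close> of the difference of their centres over \<open>lcm m n\<close>. The value
  \<open>c = 0\<close> forces equal reduced fractions and yields the diagonal term.\<close>

lemma overlap_le:
  assumes "m > 0" "n > 0" and \<psi>: "\<psi> m \<ge> 0" "\<psi> n \<ge> 0"
  shows "overlap \<psi> m n \<le> (if m = n then mass \<psi> m else 0)
      + mass \<psi> m * mass \<psi> n * coprime_mean (reduced_mult m n) (spacing \<psi> m n)"
proof -
  define g where "g = gcd m n"
  define u v where "u = m div g" and "v = n div g"
  have u: "m = g * u" and v: "n = g * v" by (auto simp: u_def v_def g_def)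
  have "g * u > 0" "g * v > 0" using assms(1,2) unfolding u[symmetric] v[symmetric] .
  then have pos: "g > 0" "u > 0" "v > 0" by auto
  have cop: "coprime u v" using assms(1,2) unfolding u_def v_def g_def by (intro div_gcd_coprime) auto
  define \<delta> \<Delta> D where "\<delta> = \<psi> m / real m" and "\<Delta> = \<psi> n / real n" and "D = spacing \<psi> m n"
  have \<delta>: "\<delta> \<ge> 0" "\<Delta> \<ge> 0" using \<psi> by (auto simp: \<delta>_def \<Delta>_def)
  have D: "D = real g * real u * real v * max \<delta> \<Delta>"
  proof -
    have "real n * \<psi> m = real g * (real g * real u * real v) * \<delta>"
      "real m * \<psi> n = real g * (real g * real u * real v) * \<Delta>"
      using pos by (simp_all add: \<delta>_def \<Delta>_def u v)
    then have "max (real n * \<psi> m) (real m * \<psi> n) = real g * (real g * real u * real v) * max \<delta> \<Delta>"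
      by (simp add: max_mult_distrib_left)
    then show ?thesis using pos by (simp add: D_def spacing_def g_def[symmetric])
  qed
  define K where "K = nat \<lfloor>2 * D\<rfloor>"
  define S where "S c = {(a, b). a \<in> {1..m} \<and> b \<in> {1..n} \<and> coprime a m \<and> coprime b n \<and> int a * int v - int b * int u = c}" for c
  have finS: "finite (S c)" for c by (rule finite_subset[of _ "{1..m} \<times> {1..n}"]) (auto simp: S_def)
  define H where "H = {(a, b) \<in> coprime_residues m \<times> coprime_residues n. \<bar>real a / real m - real b / real n\<bar> < \<delta> + \<Delta>}"
  define Cs where "Cs = {c. c \<in> {1..K} \<and> coprime c (u * v)}"
  define w where "w c = real c / real (totient c)" for c
  define B where "B = real g * (real (totient m) / real m) * (real (totient n) / real n) * w (u * v)"
  have "overlap \<psi> m n \<le> (\<Sum>a\<in>coprime_residues m. \<Sum>b\<in>coprime_residues n.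
      if \<bar>real a / real m - real b / real n\<bar> < \<delta> + \<Delta> then 2 * min \<delta> \<Delta> else 0)"
    unfolding overlap_def approx_interval_def diff_divide_distrib add_divide_distrib \<delta>_def[symmetric] \<Delta>_def[symmetric]
    by (intro sum_mono measure_interval_Int_le \<delta>)
  also have "\<dots> = (\<Sum>(a, b)\<in>coprime_residues m \<times> coprime_residues n.
      if \<bar>real a / real m - real b / real n\<bar> < \<delta> + \<Delta> then 2 * min \<delta> \<Delta> else 0)"
    by (simp add: sum.cartesian_product)
  also have "\<dots> = (\<Sum>z\<in>H. 2 * min \<delta> \<Delta>)"
    unfolding H_def by (intro sum.mono_neutral_cong_right) (auto split: if_splits)
  also have "\<dots> = real (card H) * (2 * min \<delta> \<Delta>)" by simp
  also have "\<dots> \<le> ((if m = n then real (totient m) else 0) + 2 * (\<Sum>c\<in>Cs. B * w c)) * (2 * min \<delta> \<Delta>)"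
  proof (rule mult_right_mono)
    have sub: "H \<subseteq> S 0 \<union> (\<Union>c\<in>Cs. S (int c) \<union> S (- int c))"
    proof
      fix z assume "z \<in> H"
      then obtain a b where z: "z = (a, b)" "a \<in> coprime_residues m" "b \<in> coprime_residues n"
        and ab: "\<bar>real a / real m - real b / real n\<bar> < \<delta> + \<Delta>" by (auto simp: H_def)
      define c where "c = int a * int v - int b * int u"
      have zS: "z \<in> S c" using z by (auto simp: S_def c_def coprime_residues_def)
      show "z \<in> S 0 \<union> (\<Union>c\<in>Cs. S (int c) \<union> S (- int c))"
      proof (cases "c = 0")
        case False
        have "real_of_int c = (real a / real m - real b / real n) * (real g * real u * real v)"
          using pos by (simp add: c_def u v field_simps)
        then have "\<bar>real_of_int c\<bar> = \<bar>real a / real m - real b / real n\<bar> * (real g * real u * real v)"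
          by (simp add: abs_mult)
        also have "\<dots> \<le> (\<delta> + \<Delta>) * (real g * real u * real v)" using ab by (intro mult_right_mono) auto
        also have "\<dots> \<le> (2 * max \<delta> \<Delta>) * (real g * real u * real v)" by (intro mult_right_mono) auto
        also have "\<dots> = 2 * D" by (simp add: D)
        finally have "real (nat \<bar>c\<bar>) \<le> 2 * D" by simp
        then have "nat \<bar>c\<bar> \<le> K" by (simp add: K_def le_nat_iff le_floor_iff)
        moreover have "coprime (nat \<bar>c\<bar>) (u * v)"
          using z cop by (intro coprime_difference[of a m b n u v c]) (auto simp: c_def coprime_residues_def u v)
        ultimately have "nat \<bar>c\<bar> \<in> Cs" using False by (auto simp: Cs_def)
        moreover have "c = int (nat \<bar>c\<bar>) \<or> c = - int (nat \<bar>c\<bar>)" by auto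
        ultimately show ?thesis using zS by (metis (no_types, lifting) UN_I UnI1 UnI2)
      qed (use zS in auto)
    qed
    have finC: "finite Cs" by (simp add: Cs_def)
    have "card H \<le> card (S 0 \<union> (\<Union>c\<in>Cs. S (int c) \<union> S (- int c)))"
      using sub finS finC by (intro card_mono) auto
    also have "\<dots> \<le> card (S 0) + card (\<Union>c\<in>Cs. S (int c) \<union> S (- int c))" by (rule card_Un_le)
    also have "card (\<Union>c\<in>Cs. S (int c) \<union> S (- int c)) \<le> (\<Sum>c\<in>Cs. card (S (int c) \<union> S (- int c)))"
      using finC by (rule card_UN_le)
    also have "\<dots> \<le> (\<Sum>c\<in>Cs. card (S (int c)) + card (S (- int c)))" by (intro sum_mono card_Un_le)
    finally have "real (card H) \<le> real (card (S 0)) + (\<Sum>c\<in>Cs. real (card (S (int c))) + real (card (S (- int c))))"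
      by (simp flip: of_nat_add of_nat_sum)
    also have "(\<Sum>c\<in>Cs. real (card (S (int c))) + real (card (S (- int c)))) \<le> (\<Sum>c\<in>Cs. B * w c + B * w c)"
    proof (intro sum_mono add_mono)
      fix c assume c: "c \<in> Cs"
      have le: "real (card (S d)) \<le> B * w (nat \<bar>d\<bar>)" if "d \<noteq> 0" for d
        unfolding S_def B_def w_def
        using card_coprime_pairs_le_totient[OF assms(1,2) g_def u v that] by simp
      show "real (card (S (int c))) \<le> B * w c" using le[of "int c"] c by (auto simp: Cs_def)
      show "real (card (S (- int c))) \<le> B * w c" using le[of "- int c"] c by (auto simp: Cs_def)
    qed
    also have "(\<Sum>c\<in>Cs. B * w c + B * w c) = 2 * (\<Sum>c\<in>Cs. B * w c)" by (simp add: sum_distrib_left)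
    also have "real (card (S 0)) \<le> (if m = n then real (totient m) else 0)"
    proof -
      have one: "m = n \<and> a = b" if "(a, b) \<in> S 0" for a b
      proof -
        have ab: "coprime a m" "coprime b n" "int a * int v = int b * int u" using that by (auto simp: S_def)
        have eq: "a * v = b * u" using ab(3) by (metis of_nat_eq_iff of_nat_mult)
        have "u dvd a * v" by (simp add: eq)
        then have "u dvd a" using cop by (simp add: coprime_dvd_mult_left_iff)
        then have "u = 1" using ab(1) u by (metis coprime_common_divisor_nat dvd_triv_right)
        moreover have "v dvd b * u" by (simp flip: eq)
        then have "v dvd b" using cop by (simp add: coprime_dvd_mult_left_iff coprime_commute)
        then have "v = 1" using ab(2) v by (metis coprime_common_divisor_nat dvd_triv_right)
        ultimately show ?thesis using u v eq by simp
      qed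
      show ?thesis
      proof (cases "m = n")
        case True
        have "S 0 \<subseteq> (\<lambda>a. (a, a)) ` coprime_residues m"
        proof
          fix z assume "z \<in> S 0"
          then obtain a b where z: "z = (a, b)" "(a, b) \<in> S 0" by (cases z) simp
          moreover have "a \<in> coprime_residues m" using z(2) by (simp add: S_def coprime_residues_def)
          ultimately show "z \<in> (\<lambda>a. (a, a)) ` coprime_residues m" using one[OF z(2)] by simp
        qed
        then have "card (S 0) \<le> card (coprime_residues m)"
          by (rule surj_card_le[rotated]) simp
        then show ?thesis using True by (simp add: card_coprime_residues)
      next
        case False
        then have "S 0 = {}" using one by auto
        then show ?thesis by simp
      qed
    qed
    finally show "real (card H) \<le> (if m = n then real (totient m) else 0) + 2 * (\<Sum>c\<in>Cs. B * w c)" by simp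
  qed (use \<delta> in auto)
  also have "\<dots> = (if m = n then real (totient m) else 0) * (2 * min \<delta> \<Delta>) + 4 * B * min \<delta> \<Delta> * (\<Sum>c\<in>Cs. w c)"
    unfolding sum_distrib_left[symmetric] by (simp add: algebra_simps)
  also have "(if m = n then real (totient m) else 0) * (2 * min \<delta> \<Delta>) \<le> (if m = n then mass \<psi> m else 0)"
    by (simp add: mass_def \<delta>_def \<Delta>_def mult_ac)
  also have "4 * B * min \<delta> \<Delta> * (\<Sum>c\<in>Cs. w c)
      \<le> mass \<psi> m * mass \<psi> n * coprime_mean (reduced_mult m n) (spacing \<psi> m n)"
  proof (cases "D = 0")
    case True
    then have "max \<delta> \<Delta> = 0" using D pos by simp
    then have "min \<delta> \<Delta> = 0" using \<delta> by (auto simp: max_def min_def split: if_splits)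
    then show ?thesis using True by (simp add: D_def[symmetric] coprime_mean_def)
  next
    case False
    have "D \<ge> 0" unfolding D using \<delta> by simp
    then have D0: "D > 0" using False by linarith
    \<comment> \<open>This identity trades the smaller half-length for the product of both divided
      by \<open>D\<close>, which produces the product of the masses and the mean.\<close>
    have "min \<delta> \<Delta> * max \<delta> \<Delta> = \<delta> * \<Delta>" by (auto simp: min_def max_def)
    then have "min \<delta> \<Delta> * D = real g * real u * real v * (\<delta> * \<Delta>)" by (simp add: D)
    also have "\<dots> = \<psi> m * \<psi> n / real g" using pos by (simp add: \<delta>_def \<Delta>_def u v)
    finally have mn: "min \<delta> \<Delta> = \<psi> m * \<psi> n / real g / D"
      using D0 by (metis less_irrefl nonzero_eq_divide_eq)
    have "4 * B * min \<delta> \<Delta> * (\<Sum>c\<in>Cs. w c)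
      = mass \<psi> m * mass \<psi> n * (w (u * v) * ((\<Sum>c\<in>Cs. w c) / D))"
      unfolding mn B_def mass_def using pos D0 by (simp add: field_simps)
    also have "w (u * v) * ((\<Sum>c\<in>Cs. w c) / D) = coprime_mean (reduced_mult m n) (spacing \<psi> m n)"
      by (simp add: coprime_mean_def w_def Cs_def K_def D_def reduced_mult_def u_def v_def g_def)
    finally show ?thesis by simp
  qed
  finally show ?thesis by simp
qed

section \<open>Prime tails and bounds for \<open>coprime_mean\<close>\<close>

definition prime_tail :: "nat \<Rightarrow> real \<Rightarrow> real" where
  "prime_tail t z = (\<Sum>p | p \<in> prime_factors t \<and> real p > z. 1 / real p)"

lemma prime_tail_antimono: "z \<le> z' \<Longrightarrow> prime_tail t z' \<le> prime_tail t z"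
  unfolding prime_tail_def by (intro sum_mono2) auto

lemma prod_prime_factors_tail_le:
  "(\<Prod>p | p \<in> prime_factors t \<and> real p > z. 1 / (1 - 1 / real p)) \<le> exp (2 * prime_tail t z)"
proof -
  have "(\<Prod>p | p \<in> prime_factors t \<and> real p > z. 1 / (1 - 1 / real p))
      \<le> (\<Prod>p | p \<in> prime_factors t \<and> real p > z. exp (2 * (1 / real p)))"
  proof (intro prod_mono conjI)
    fix p assume "p \<in> {p. p \<in> prime_factors t \<and> real p > z}"
    then have p: "prime p" by auto
    have p2: "real p \<ge> 2" using prime_ge_2_nat[OF p] by simp
    show "0 \<le> 1 / (1 - 1 / real p)" using one_minus_inverse_prime[OF p] by simp
    have "1 / (1 - 1 / real p) \<le> 1 + 2 * (1 / real p)" using p2 by (simp add: field_simps)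
    also have "\<dots> \<le> exp (2 * (1 / real p))" by (rule exp_ge_add_one_self)
    finally show "1 / (1 - 1 / real p) \<le> exp (2 * (1 / real p))" .
  qed
  also have "\<dots> = exp (2 * prime_tail t z)"
    by (subst exp_sum[symmetric]) (auto simp: prime_tail_def sum_distrib_left)
  finally show ?thesis .
qed

text \<open>An integer \<open>t\<close> has at most \<open>ln t / ln 2\<close> prime factors, and
  those beyond \<open>z\<close> contribute at most \<open>1 / z\<close> each.\<close>

lemma prime_tail_le:
  assumes "t > 0" "z > 0"
  shows "prime_tail t z \<le> ln (real t) / (z * ln 2)"
proof -
  have "2 ^ card (prime_factors t) = (\<Prod>p\<in>prime_factors t. 2)" by simp
  also have "\<dots> \<le> (\<Prod>p\<in>prime_factors t. p)" by (intro prod_mono) (auto simp: in_prime_factors_iff prime_ge_2_nat)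
  also have "\<dots> \<le> t" using assms by (intro dvd_imp_le prod_prime_factors_dvd) auto
  finally have "real (2 ^ card (prime_factors t)) \<le> real t" by (simp only: of_nat_le_iff)
  then have "ln (real (2 ^ card (prime_factors t))) \<le> ln (real t)" using assms by (subst ln_le_cancel_iff) auto
  then have card: "real (card (prime_factors t)) * ln 2 \<le> ln (real t)" by (simp add: ln_realpow)
  have "prime_tail t z \<le> (\<Sum>p | p \<in> prime_factors t \<and> real p > z. 1 / z)"
    unfolding prime_tail_def using assms by (intro sum_mono divide_left_mono) auto
  also have "\<dots> = real (card {p\<in>prime_factors t. real p > z}) / z" by simp
  also have "\<dots> \<le> real (card (prime_factors t)) / z"
    using assms by (intro divide_right_mono) (auto intro: card_mono)
  also have "\<dots> \<le> ln (real t) / (z * ln 2)" using card assms by (simp add: field_simps)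
  finally show ?thesis .
qed

text \<open>All primes up to \<open>exp x\<close> are allowed as factors of \<open>t\<close>. The
  bound is of size \<open>ln t\<close>, far above the true \<open>ln (ln t)\<close>, but it is
  applied only where powers of \<open>log n\<close> may be lost.\<close>

lemma div_totient_le:
  "\<exists>C\<ge>1. \<forall>t x. 0 < t \<longrightarrow> real t \<le> exp x \<longrightarrow> 1 \<le> x \<longrightarrow> real t / real (totient t) \<le> C * x"
proof -
  obtain M where M: "M \<ge> 1" "\<And>n. n \<ge> 2 \<Longrightarrow> (\<Prod>p | prime p \<and> p \<le> n. 1 / (1 - 1 / real p)) \<le> M * ln (real n)"
    using mertens_upper by blast
  have "real t / real (totient t) \<le> M * x" if t: "t > 0" "real t \<le> exp x" "1 \<le> x" for t x
  proof -
    define N where "N = nat \<lfloor>exp x\<rfloor>"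
    have "exp x \<ge> 2" using exp_ge_add_one_self[of x] t by linarith
    then have N: "N \<ge> 2" "t \<le> N" "real N \<le> exp x" using t by (auto simp: N_def le_nat_iff le_floor_iff)
    have fin: "finite {p. prime p \<and> p \<le> N}" by (rule finite_subset[of _ "{..N}"]) auto
    have "real t / real (totient t) = (\<Prod>p\<in>prime_factors t. 1 / (1 - 1 / real p))"
      using t by (simp add: of_nat_div_totient_eq)
    also have "\<dots> \<le> (\<Prod>p | prime p \<and> p \<le> N. 1 / (1 - 1 / real p))"
    proof (intro prod_mono2 fin)
      show "prime_factors t \<subseteq> {p. prime p \<and> p \<le> N}"
        using t N by (auto simp: in_prime_factors_iff intro: order.trans[OF dvd_imp_le])
    qed (auto simp: one_minus_inverse_prime in_prime_factors_iff)
    also have "\<dots> \<le> M * ln (real N)" by (rule M) fact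
    also have "ln (real N) \<le> ln (exp x)" using N by (subst ln_le_cancel_iff) auto
    finally show ?thesis using M by simp
  qed
  then show ?thesis using M by blast
qed

lemma le_nat_floor_iff:
  fixes r :: real
  assumes "r \<ge> 0"
  shows "c \<le> nat \<lfloor>r\<rfloor> \<longleftrightarrow> real c \<le> r"
  using assms by linarith

lemma coprime_mean_eq_0: "2 * D < 1 \<Longrightarrow> coprime_mean t D = 0"
proof -
  assume "2 * D < 1"
  then have "nat \<lfloor>2 * D\<rfloor> = 0" by linarith
  then show ?thesis by (simp add: coprime_mean_def)
qed

text \<open>The primes of \<open>t\<close> up to \<open>X\<close> cancel between
  \<open>t / totient t\<close> and the bound for the mean; the others exceed \<open>D\<close> and
  form the tail. With \<open>D \<ge> 1\<close>, the range of \<open>c\<close> reaches 2.\<close>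

lemma coprime_mean_le_tail:
  "\<exists>C\<ge>1. \<forall>t D. 0 < t \<longrightarrow> 1 \<le> D \<longrightarrow> coprime_mean t D \<le> C * exp (2 * prime_tail t D)"
proof -
  obtain C where C: "C \<ge> 1" "\<And>t X. X \<ge> 2 \<Longrightarrow> (\<Sum>c | c \<in> {1..X} \<and> coprime c t. real c / real (totient c))
      \<le> C * real X * (\<Prod>p | prime p \<and> p \<le> X \<and> p dvd t. 1 - 1 / real p)"
    using sum_coprime_div_totient_le by blast
  have "coprime_mean t D \<le> (2 * C) * exp (2 * prime_tail t D)" if t: "t > 0" "D \<ge> 1" for t D
  proof -
    define X where "X = nat \<lfloor>2 * D\<rfloor>"
    have X: "X \<ge> 2" "real X \<le> 2 * D" "D \<le> real X" using t by (auto simp: X_def le_nat_iff le_floor_iff) linarith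
    define Q where "Q = {p. prime p \<and> p \<le> X \<and> p dvd t}"
    have finQ: "finite Q" unfolding Q_def by (rule finite_subset[of _ "{..X}"]) auto
    define q where "q = (\<Prod>p\<in>Q. 1 - 1 / real p)"
    have q: "q > 0" unfolding q_def by (intro prod_pos) (auto simp: Q_def one_minus_inverse_prime)
    have "real t / real (totient t) = (\<Prod>p\<in>prime_factors t. 1 / (1 - 1 / real p))"
      using t by (simp add: of_nat_div_totient_eq)
    also have "prime_factors t = Q \<union> {p. p \<in> prime_factors t \<and> real p > real X}"
      using t by (auto simp: Q_def in_prime_factors_iff)
    also have "(\<Prod>p\<in>\<dots>. 1 / (1 - 1 / real p)) = 1 / q * (\<Prod>p | p \<in> prime_factors t \<and> real p > real X. 1 / (1 - 1 / real p))"
      using finQ by (subst prod.union_disjoint) (auto simp: Q_def q_def prod_dividef)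
    also have "\<dots> \<le> 1 / q * exp (2 * prime_tail t (real X))"
      using q by (intro mult_left_mono prod_prime_factors_tail_le) auto
    also have "\<dots> \<le> 1 / q * exp (2 * prime_tail t D)"
      using q prime_tail_antimono[OF X(3), of t] by (intro mult_left_mono) auto
    finally have 1: "real t / real (totient t) \<le> 1 / q * exp (2 * prime_tail t D)" .
    have "(\<Sum>c | c \<in> {1..X} \<and> coprime c t. real c / real (totient c)) \<le> C * real X * q"
      using C(2)[OF X(1)] by (simp add: q_def Q_def)
    also have "\<dots> \<le> C * (2 * D) * q" using X C q by (intro mult_right_mono mult_left_mono) auto
    finally have 2: "(\<Sum>c | c \<in> {1..X} \<and> coprime c t. real c / real (totient c)) / D \<le> 2 * C * q"
      using t by (simp add: field_simps)
    have "coprime_mean t D \<le> (1 / q * exp (2 * prime_tail t D)) * (2 * C * q)"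
      unfolding coprime_mean_def X_def[symmetric] using t q
      by (intro mult_mono 1 2 divide_nonneg_nonneg sum_nonneg mult_nonneg_nonneg) auto
    then show ?thesis using q by (simp add: mult.commute)
  qed
  moreover have "2 * C \<ge> 1" using C by simp
  ultimately show ?thesis by blast
qed

text \<open>The bound without cancellation, good down to \<open>D = 0\<close>: the mean vanishes for
  \<open>2 * D < 1\<close>, and the range \<open>{1}\<close> is treated by hand.\<close>

lemma coprime_mean_le_div_totient:
  "\<exists>C\<ge>1. \<forall>t D. 0 < t \<longrightarrow> 0 \<le> D \<longrightarrow> coprime_mean t D \<le> C * (real t / real (totient t))"
proof -
  obtain C where C: "C \<ge> 1" "\<And>t X. X \<ge> 2 \<Longrightarrow> (\<Sum>c | c \<in> {1..X} \<and> coprime c t. real c / real (totient c))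
      \<le> C * real X * (\<Prod>p | prime p \<and> p \<le> X \<and> p dvd t. 1 - 1 / real p)"
    using sum_coprime_div_totient_le by blast
  have "coprime_mean t D \<le> 2 * C * (real t / real (totient t))" if t: "t > 0" "D \<ge> 0" for t D
  proof (cases "2 * D < 1")
    case True
    then show ?thesis using C by (simp add: coprime_mean_eq_0)
  next
    case False
    define X where "X = nat \<lfloor>2 * D\<rfloor>"
    have X: "X \<ge> 1" "real X \<le> 2 * D" using False by (auto simp: X_def le_nat_iff le_floor_iff)
    have "(\<Sum>c | c \<in> {1..X} \<and> coprime c t. real c / real (totient c)) \<le> C * real X"
    proof (cases "X = 1")
      case True
      have "(\<Sum>c | c \<in> {1..X} \<and> coprime c t. real c / real (totient c)) = (\<Sum>c\<in>{1::nat}. real c / real (totient c))"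
        using True by (intro sum.cong) auto
      then show ?thesis using C True by simp
    next
      case False
      then have "(\<Sum>c | c \<in> {1..X} \<and> coprime c t. real c / real (totient c))
        \<le> C * real X * (\<Prod>p | prime p \<and> p \<le> X \<and> p dvd t. 1 - 1 / real p)" using X by (intro C) auto
      also have "\<dots> \<le> C * real X * 1"
        using C by (intro mult_left_mono prod_le_1) (auto simp: one_minus_inverse_prime)
      finally show ?thesis by simp
    qed
    also have "\<dots> \<le> C * (2 * D)" using X C by (intro mult_left_mono) auto
    finally have "(\<Sum>c | c \<in> {1..X} \<and> coprime c t. real c / real (totient c)) / D \<le> 2 * C"
      using False by (simp add: field_simps)
    then have "coprime_mean t D \<le> real t / real (totient t) * (2 * C)"
      unfolding coprime_mean_def X_def[symmetric] by (intro mult_left_mono) auto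
    then show ?thesis by (simp add: mult.commute)
  qed
  moreover have "2 * C \<ge> 1" using C by simp
  ultimately show ?thesis by blast
qed

lemma sum_powers_of_two_upto_le:
  fixes y :: real
  assumes "y \<ge> 0"
  shows "(\<Sum>k=1..K. if 2 ^ k \<le> y then 2 ^ k else 0) \<le> 2 * y"
proof -
  have le: "(\<Sum>k=1..K. if 2 ^ k \<le> y then 2 ^ k else 0) \<le> (2::real) ^ Suc K" for K
  proof (induction K)
    case (Suc K)
    then show ?case using order.trans[OF Suc, of "2 ^ Suc (Suc K)"] by auto
  qed auto
  show ?thesis
  proof (induction K)
    case (Suc K)
    show ?case
    proof (cases "2 ^ Suc K \<le> y")
      case True
      then show ?thesis using le[of "Suc K"] by simp
    qed (use Suc in simp)
  qed (use assms in simp)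
qed

text \<open>Exchanging the sums, a given \<open>c\<close> occurs at the scales with
  \<open>2 ^ k \<le> 2 * D / c\<close>, and there its weights \<open>2 ^ k / D\<close> add up to at
  most \<open>4 / c\<close>. Thus any number of scales costs a single sum of
  \<open>1 / totient c\<close>, whatever \<open>K\<close> is.\<close>

lemma sum_coprime_mean_dyadic_le:
  "\<exists>C\<ge>1. \<forall>t D K Z. 0 < t \<longrightarrow> 0 \<le> D \<longrightarrow> 2 \<le> Z \<longrightarrow> 2 * D \<le> real Z \<longrightarrow>
      (\<Sum>k=1..K. coprime_mean t (D / 2 ^ k)) \<le> C * ln (real Z) * exp (2 * prime_tail t (real Z))"
proof -
  obtain M where M: "M \<ge> 1" "\<And>n. n \<ge> 2 \<Longrightarrow> (\<Prod>p | prime p \<and> p \<le> n. 1 / (1 - 1 / real p)) \<le> M * ln (real n)"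
    using mertens_upper by blast
  have "(\<Sum>k=1..K. coprime_mean t (D / 2 ^ k)) \<le> (4 * exp 2 * M) * ln (real Z) * exp (2 * prime_tail t (real Z))"
    if t: "t > 0" "D \<ge> 0" "Z \<ge> 2" "2 * D \<le> real Z" for t D K Z
  proof (cases "D = 0")
    case True
    then show ?thesis using M t by (simp add: coprime_mean_def)
  next
    case False
    with t have D: "D > 0" by simp
    define X where "X = nat \<lfloor>2 * D\<rfloor>"
    have XZ: "X \<le> Z" using t unfolding X_def by linarith
    define V where "V = {c. c \<in> {1..X} \<and> coprime c t}"
    have finV: "finite V" by (simp add: V_def)
    define w where "w c = real c / real (totient c)" for c
    define Y where "Y = w t"
    have Y0: "Y \<ge> 0" by (simp add: Y_def w_def)
    have "(\<Sum>c | c \<in> {1..nat \<lfloor>2 * (D / 2 ^ k)\<rfloor>} \<and> coprime c t. w c) / (D / 2 ^ k)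
       = (\<Sum>c\<in>V. w c / D * (if 2 ^ k \<le> 2 * D / real c then 2 ^ k else 0))" for k
    proof -
      have "{c. c \<in> {1..nat \<lfloor>2 * (D / 2 ^ k)\<rfloor>} \<and> coprime c t} = {c\<in>V. 2 ^ k \<le> 2 * D / real c}"
      proof -
        have "c \<le> nat \<lfloor>2 * (D / 2 ^ k)\<rfloor> \<longleftrightarrow> c \<le> X \<and> 2 ^ k \<le> 2 * D / real c" if "c \<ge> 1" for c
        proof -
          have 1: "c \<le> nat \<lfloor>2 * (D / 2 ^ k)\<rfloor> \<longleftrightarrow> real c \<le> 2 * (D / 2 ^ k)" and 2: "c \<le> X \<longleftrightarrow> real c \<le> 2 * D"
            unfolding X_def using D by (intro le_nat_floor_iff; simp)+
          have "2 * (D / 2 ^ k) \<le> 2 * D" using D by (simp add: field_simps)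
          moreover have "real c \<le> 2 * (D / 2 ^ k) \<longleftrightarrow> 2 ^ k \<le> 2 * D / real c" using that by (simp add: field_simps)
          ultimately show ?thesis unfolding 1 2 by linarith
        qed
        then show ?thesis unfolding V_def by auto
      qed
      then have "(\<Sum>c | c \<in> {1..nat \<lfloor>2 * (D / 2 ^ k)\<rfloor>} \<and> coprime c t. w c) = (\<Sum>c\<in>V. if 2 ^ k \<le> 2 * D / real c then w c else 0)"
        using finV by (simp add: sum.inter_filter)
      moreover have "(if 2 ^ k \<le> 2 * D / real c then w c else 0) / (D / 2 ^ k)
          = w c / D * (if 2 ^ k \<le> 2 * D / real c then 2 ^ k else 0)" for c by simp
      ultimately show ?thesis by (simp only: sum_divide_distrib)
    qed
    then have "(\<Sum>k=1..K. coprime_mean t (D / 2 ^ k))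
        = Y * (\<Sum>k=1..K. \<Sum>c\<in>V. w c / D * (if 2 ^ k \<le> 2 * D / real c then 2 ^ k else 0))"
      unfolding coprime_mean_def w_def[symmetric] Y_def[symmetric] by (simp only: sum_distrib_left)
    also have "\<dots> = Y * (\<Sum>c\<in>V. w c / D * (\<Sum>k=1..K. if 2 ^ k \<le> 2 * D / real c then 2 ^ k else 0))"
      by (subst sum.swap) (simp only: sum_distrib_left)
    also have "\<dots> \<le> Y * (\<Sum>c\<in>V. w c / D * (2 * (2 * D / real c)))"
    proof (intro mult_left_mono sum_mono Y0)
      fix c
      show "(\<Sum>k=1..K. if 2 ^ k \<le> 2 * D / real c then 2 ^ k else 0) \<le> 2 * (2 * D / real c)"
        using D by (intro sum_powers_of_two_upto_le) simp
      show "0 \<le> w c / D" using D by (simp add: w_def)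
    qed
    also have "\<dots> = 4 * Y * (\<Sum>c\<in>V. 1 / real (totient c))"
    proof -
      have "w c / D * (2 * (2 * D / real c)) = 4 * (1 / real (totient c))" if "c \<in> V" for c
        using that D by (simp add: w_def V_def)
      then have "(\<Sum>c\<in>V. w c / D * (2 * (2 * D / real c))) = 4 * (\<Sum>c\<in>V. 1 / real (totient c))"
        by (simp add: sum_distrib_left)
      then show ?thesis by simp
    qed
    also have "\<dots> \<le> 4 * Y * (exp 2 * (\<Prod>p | prime p \<and> p \<le> X \<and> \<not> p dvd t. 1 / (1 - 1 / real p)))"
      using sum_inverse_totient_coprime_le[of X t] Y0 by (intro mult_left_mono) (auto simp: V_def)
    \<comment> \<open>The product is extended to \<open>Z\<close>, so that together with the primes
      of \<open>t\<close> up to \<open>Z\<close> it forms a complete Mertens product.\<close>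
    also have "\<dots> \<le> 4 * Y * (exp 2 * (\<Prod>p | prime p \<and> p \<le> Z \<and> \<not> p dvd t. 1 / (1 - 1 / real p)))"
      using Y0 XZ by (intro mult_left_mono prod_mono2) (auto simp: one_minus_inverse_prime)
    also have "\<dots> = 4 * exp 2 * (Y * (\<Prod>p | prime p \<and> p \<le> Z \<and> \<not> p dvd t. 1 / (1 - 1 / real p)))" by simp
    also have "Y = (\<Prod>p | prime p \<and> p \<le> Z \<and> p dvd t. 1 / (1 - 1 / real p))
        * (\<Prod>p | p \<in> prime_factors t \<and> real p > real Z. 1 / (1 - 1 / real p))"
    proof -
      have "Y = (\<Prod>p\<in>prime_factors t. 1 / (1 - 1 / real p))"
        using t by (simp add: of_nat_div_totient_eq Y_def w_def)
      also have "prime_factors t = {p. prime p \<and> p \<le> Z \<and> p dvd t} \<union> {p. p \<in> prime_factors t \<and> real p > real Z}"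
        using t by (auto simp: in_prime_factors_iff)
      finally show ?thesis by (subst (asm) prod.union_disjoint) auto
    qed
    also have "\<dots> * (\<Prod>p | prime p \<and> p \<le> Z \<and> \<not> p dvd t. 1 / (1 - 1 / real p))
        = (\<Prod>p | prime p \<and> p \<le> Z. 1 / (1 - 1 / real p))
          * (\<Prod>p | p \<in> prime_factors t \<and> real p > real Z. 1 / (1 - 1 / real p))"
    proof -
      have "{p. prime p \<and> p \<le> Z} = {p. prime p \<and> p \<le> Z \<and> p dvd t} \<union> {p. prime p \<and> p \<le> Z \<and> \<not> p dvd t}" by auto
      then have "(\<Prod>p | prime p \<and> p \<le> Z. 1 / (1 - 1 / real p))
        = (\<Prod>p | prime p \<and> p \<le> Z \<and> p dvd t. 1 / (1 - 1 / real p)) * (\<Prod>p | prime p \<and> p \<le> Z \<and> \<not> p dvd t. 1 / (1 - 1 / real p))"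
        by (simp, subst prod.union_disjoint) auto
      then show ?thesis by simp
    qed
    also have "4 * exp 2 * \<dots> \<le> 4 * exp 2 * ((M * ln (real Z)) * exp (2 * prime_tail t (real Z)))"
      using M t by (intro mult_left_mono mult_mono prod_prime_factors_tail_le prod_nonneg)
        (auto simp: one_minus_inverse_prime in_prime_factors_iff)
    finally show ?thesis by (simp add: mult_ac)
  qed
  moreover have "4 * exp 2 * M \<ge> 1"
  proof -
    have "exp 2 \<ge> (1::real)" by simp
    then have "4 * exp 2 * M \<ge> 1 * 1 * (1::real)" using M(1) by (intro mult_mono) auto
    then show ?thesis by simp
  qed
  ultimately show ?thesis by blast
qed

section \<open>Pairs with heavy prime tails\<close>

lemma multiplicity_reduced_mult:
  assumes "m > 0" "n > 0" "prime p"
  shows "multiplicity p (reduced_mult m n)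
    = (multiplicity p m - multiplicity p n) + (multiplicity p n - multiplicity p m)"
proof -
  define g u v where "g = gcd m n" and "u = m div g" and "v = n div g"
  have u: "m = g * u" and v: "n = g * v" by (auto simp: u_def v_def g_def)
  have "g * u > 0" "g * v > 0" using assms(1,2) unfolding u[symmetric] v[symmetric] .
  then have pos: "g > 0" "u > 0" "v > 0" by auto
  have cop: "coprime u v" using assms(1,2) unfolding u_def v_def g_def by (intro div_gcd_coprime) auto
  have "multiplicity p m = multiplicity p g + multiplicity p u"
    unfolding u using pos assms(3) by (intro prime_elem_multiplicity_mult_distrib) auto
  moreover have "multiplicity p n = multiplicity p g + multiplicity p v"
    unfolding v using pos assms(3) by (intro prime_elem_multiplicity_mult_distrib) auto
  moreover have "multiplicity p (u * v) = multiplicity p u + multiplicity p v"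
    using pos assms(3) by (intro prime_elem_multiplicity_mult_distrib) auto
  moreover have "multiplicity p u = 0 \<or> multiplicity p v = 0"
  proof -
    have "\<not> p dvd u \<or> \<not> p dvd v" using cop assms(3) coprime_common_divisor not_prime_unit by blast
    then show ?thesis by (auto simp: not_dvd_imp_multiplicity_0)
  qed
  moreover have "reduced_mult m n = u * v" by (simp add: reduced_mult_def u_def v_def g_def)
  ultimately show ?thesis by auto
qed

lemma reduced_mult_pos: "m > 0 \<Longrightarrow> n > 0 \<Longrightarrow> reduced_mult m n > 0"
  unfolding reduced_mult_def by (simp add: div_greater_zero_iff)

lemma reduced_mult_le: "reduced_mult m n \<le> m * n"
  unfolding reduced_mult_def by (intro mult_le_mono div_le_dividend)

text \<open>With \<open>u\<close> and \<open>v\<close> the cofactors of the gcd, small spacing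
  bounds both \<open>v * \<psi> m\<close> and \<open>u * \<psi> n\<close>. Multiplied together,
  these bounds turn into decay of \<open>\<psi> m * \<psi> n\<close> in the reduced product.\<close>

lemma mult_le_of_spacing_le:
  assumes "m > 0" "n > 0" "\<psi> m \<ge> 0" "\<psi> n \<ge> 0" "spacing \<psi> m n \<le> B"
  shows "\<psi> m * \<psi> n * real (reduced_mult m n) \<le> B\<^sup>2"
proof -
  define g u v where "g = gcd m n" and "u = m div g" and "v = n div g"
  have u: "m = g * u" and v: "n = g * v" by (auto simp: u_def v_def g_def)
  have "g * u > 0" using assms(1) unfolding u[symmetric] .
  then have g: "g > 0" by auto
  have "max (real n * \<psi> m) (real m * \<psi> n) / real g \<le> B" using assms(5) by (simp add: spacing_def g_def)
  then have "real n * \<psi> m / real g \<le> B" "real m * \<psi> n / real g \<le> B"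
    using g by (auto simp: pos_divide_le_eq)
  then have "real v * \<psi> m \<le> B" "real u * \<psi> n \<le> B" using g by (auto simp: u v)
  moreover have "0 \<le> real v * \<psi> m" "0 \<le> real u * \<psi> n" using assms(3,4) by auto
  ultimately have "(real v * \<psi> m) * (real u * \<psi> n) \<le> B * B" by (intro mult_mono) auto
  moreover have "reduced_mult m n = u * v" by (simp add: reduced_mult_def u_def v_def g_def)
  ultimately show ?thesis by (simp add: power2_eq_square mult_ac)
qed

text \<open>The factor \<open>exp (y / p)\<close> implements an exponential moment of the prime
  tail. It is used only for \<open>p > y\<close>, where it stays below 3; hence the 3 in the
  hypothesis \<open>off\<close> of the kernel inequality.\<close>

definition tail_kernel :: "real \<Rightarrow> nat \<Rightarrow> nat \<Rightarrow> nat \<Rightarrow> real" where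
  "tail_kernel y p i j = (if i = j then 1 else
     (if real p > y then exp (y / real p) else 1) * (real p powr (- 1/4)) ^ ((i - j) + (j - i)))"

lemma powr_reduced_mult_tail_eq:
  assumes "m > 0" "n > 0" "m \<le> N" "n \<le> N"
  shows "real (reduced_mult m n) powr (- 1/4) * exp (y * prime_tail (reduced_mult m n) y)
    = (\<Prod>p | prime p \<and> p \<le> N. tail_kernel y p (multiplicity p m) (multiplicity p n))"
proof -
  define t where "t = reduced_mult m n"
  define P where "P = {p. prime p \<and> p \<le> N}"
  have fin: "finite P" unfolding P_def by (rule finite_subset[of _ "{..N}"]) auto
  have t: "t > 0" using assms by (simp add: t_def reduced_mult_pos)
  have mult: "multiplicity p t = (multiplicity p m - multiplicity p n) + (multiplicity p n - multiplicity p m)"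
    if "p \<in> P" for p using that assms multiplicity_reduced_mult[of m n p] by (simp add: P_def t_def)
  have sub: "prime_factors t \<subseteq> P"
  proof
    fix p assume "p \<in> prime_factors t"
    then have p: "prime p" "p dvd t" by auto
    then have "p dvd m div gcd m n \<or> p dvd n div gcd m n" by (simp add: t_def reduced_mult_def prime_dvd_mult_iff)
    moreover have "m div gcd m n dvd m" "n div gcd m n dvd n" by (simp_all add: div_dvd_iff_mult assms(1,2))
    ultimately have "p dvd m \<or> p dvd n" by (meson dvd_trans)
    then have "p \<le> N" using assms by (meson dvd_imp_le order.trans)
    then show "p \<in> P" using p by (simp add: P_def)
  qed
  have "real t = real (\<Prod>p\<in>prime_factors t. p ^ multiplicity p t)" using t by (simp add: prod_prime_factors)
  also have "\<dots> = (\<Prod>p\<in>prime_factors t. real p ^ multiplicity p t)" by simp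
  also have "\<dots> = (\<Prod>p\<in>P. real p ^ multiplicity p t)"
    using fin sub t by (intro prod.mono_neutral_left) (auto simp: P_def prime_factors_multiplicity)
  finally have "real t powr (- 1/4) = (\<Prod>p\<in>P. (real p ^ multiplicity p t) powr (- 1/4))"
    by (simp add: prod_powr_distrib)
  also have "\<dots> = (\<Prod>p\<in>P. (real p powr (- 1/4)) ^ multiplicity p t)"
    by (intro prod.cong refl) (auto simp: P_def powr_powr prime_gt_0_nat mult.commute simp flip: powr_realpow)
  finally have 1: "real t powr (- 1/4) = (\<Prod>p\<in>P. (real p powr (- 1/4)) ^ multiplicity p t)" .
  have "exp (y * prime_tail t y) = (\<Prod>p\<in>{p. p \<in> prime_factors t \<and> real p > y}. exp (y / real p))"
    by (simp add: prime_tail_def sum_distrib_left exp_sum)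
  also have "{p. p \<in> prime_factors t \<and> real p > y} = {p\<in>P. multiplicity p t \<noteq> 0 \<and> real p > y}"
    using sub by (auto simp: P_def prime_factors_multiplicity)
  also have "(\<Prod>p\<in>\<dots>. exp (y / real p)) = (\<Prod>p\<in>P. if multiplicity p t \<noteq> 0 \<and> real p > y then exp (y / real p) else 1)"
    using fin by (subst prod.inter_filter) auto
  finally have "real t powr (- 1/4) * exp (y * prime_tail t y)
      = (\<Prod>p\<in>P. (real p powr (- 1/4)) ^ multiplicity p t * (if multiplicity p t \<noteq> 0 \<and> real p > y then exp (y / real p) else 1))"
    by (simp only: 1 prod.distrib)
  also have "\<dots> = (\<Prod>p\<in>P. tail_kernel y p (multiplicity p m) (multiplicity p n))"
    by (intro prod.cong refl) (auto simp: tail_kernel_def mult)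
  finally show ?thesis by (simp add: t_def P_def)
qed

text \<open>For a counted pair, \<open>x = \<psi> m * \<psi> n\<close> is split as
  \<open>x^(3/4) * x^(1/4)\<close>. Small spacing turns the last factor into
  \<open>sqrt B * t^(-1/4)\<close>, and the heavy tail gives
  \<open>1 \<le> exp (- y) * exp (y * prime_tail t y)\<close>. The resulting kernel is a product
  over primes, to which the tensorized inequality applies.\<close>

lemma sum_tail_pairs_le:
  assumes "finite S" and S: "\<And>n. n \<in> S \<Longrightarrow> 0 < n \<and> n \<le> N" and \<psi>: "\<And>n. \<psi> n \<ge> 0" and "y > 0" "B \<ge> 0"
  shows "(\<Sum>m\<in>S. \<Sum>n\<in>S. if prime_tail (reduced_mult m n) y > 1 \<and> spacing \<psi> m n \<le> B then \<psi> m * \<psi> n else 0)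
     \<le> exp (- y) * sqrt B * (\<Prod>p | prime p \<and> p \<le> N. 1 / (1 - 1 / real p)) ^ kernel_const * (\<Sum>n\<in>S. \<psi> n) powr (3/2)"
proof -
  define P where "P = {p. prime p \<and> p \<le> N}"
  have fin: "finite P" unfolding P_def by (rule finite_subset[of _ "{..N}"]) auto
  define K where "K m n = (\<Prod>p\<in>P. tail_kernel y p (multiplicity p m) (multiplicity p n))" for m n
  have K0: "K m n \<ge> 0" for m n unfolding K_def by (intro prod_nonneg) (auto simp: tail_kernel_def)
  have pair: "(if prime_tail (reduced_mult m n) y > 1 \<and> spacing \<psi> m n \<le> B then \<psi> m * \<psi> n else 0)
      \<le> exp (- y) * sqrt B * ((\<psi> m * \<psi> n) powr (3/4) * K m n)" if mn: "m \<in> S" "n \<in> S" for m n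
  proof (cases "prime_tail (reduced_mult m n) y > 1 \<and> spacing \<psi> m n \<le> B")
    case True
    define t where "t = reduced_mult m n"
    define x where "x = \<psi> m * \<psi> n"
    have x0: "x \<ge> 0" using \<psi> by (simp add: x_def)
    have t0: "t > 0" using S[OF mn(1)] S[OF mn(2)] by (simp add: t_def reduced_mult_pos)
    have "x * real t \<le> B\<^sup>2"
      unfolding x_def t_def using True S[OF mn(1)] S[OF mn(2)] \<psi> by (intro mult_le_of_spacing_le) auto
    then have "x \<le> B\<^sup>2 / real t" using t0 by (simp add: field_simps)
    then have "x powr (1/4) \<le> (B\<^sup>2 / real t) powr (1/4)" using x0 by (intro powr_mono2) auto
    also have "\<dots> = (B\<^sup>2) powr (1/4) / real t powr (1/4)" using assms by (simp add: powr_divide)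
    also have "(B\<^sup>2) powr (1/4) = sqrt B"
    proof (cases "B = 0")
      case False
      then have "B\<^sup>2 = B powr 2" using assms by simp
      then show ?thesis using assms by (simp add: powr_powr powr_half_sqrt del: powr_numeral)
    qed simp
    also have "sqrt B / real t powr (1/4) = sqrt B * real t powr (- 1/4)" by (simp add: powr_minus_divide)
    finally have 1: "x powr (1/4) \<le> sqrt B * real t powr (- 1/4)" .
    have "1 \<le> exp (- y) * exp (y * prime_tail t y)"
      using True assms by (simp add: t_def flip: exp_add)
    then have 2: "x \<le> x * (exp (- y) * exp (y * prime_tail t y))" using x0 by (simp add: mult_le_cancel_left1)
    have 3: "x powr (3/4) * x powr (1/4) = x" using x0 by (simp flip: powr_add)
    have "x powr (3/4) * x powr (1/4) * (exp (- y) * exp (y * prime_tail t y))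
        \<le> x powr (3/4) * (sqrt B * real t powr (- 1/4)) * (exp (- y) * exp (y * prime_tail t y))"
      using 1 by (intro mult_right_mono mult_left_mono) auto
    also have "\<dots> = exp (- y) * sqrt B * (x powr (3/4) * (real t powr (- 1/4) * exp (y * prime_tail t y)))"
      by (simp add: mult_ac)
    also have "real t powr (- 1/4) * exp (y * prime_tail t y) = K m n"
      unfolding K_def P_def t_def using S[OF mn(1)] S[OF mn(2)] by (intro powr_reduced_mult_tail_eq) auto
    finally have "x \<le> exp (- y) * sqrt B * (x powr (3/4) * K m n)" using 2 unfolding 3 by linarith
    then show ?thesis using True by (simp add: x_def)
  next
    case False
    show ?thesis unfolding if_not_P[OF False] using assms K0 by (intro mult_nonneg_nonneg) auto
  qed
  have inj: "m = n" if "m \<in> S" "n \<in> S" "\<forall>p\<in>P. multiplicity p m = multiplicity p n" for m n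
  proof (rule multiplicity_eq_nat)
    show "m > 0" "n > 0" using S that by auto
    fix p :: nat assume p: "prime p"
    show "multiplicity p m = multiplicity p n"
    proof (cases "p \<le> N")
      case False
      then have "\<not> p dvd m" "\<not> p dvd n" using S[OF that(1)] S[OF that(2)] by (auto dest: dvd_imp_le)
      then show ?thesis by (simp add: not_dvd_imp_multiplicity_0)
    qed (use that p in \<open>auto simp: P_def\<close>)
  qed
  have "(\<Sum>m\<in>S. \<Sum>n\<in>S. if prime_tail (reduced_mult m n) y > 1 \<and> spacing \<psi> m n \<le> B then \<psi> m * \<psi> n else 0)
      \<le> exp (- y) * sqrt B * (\<Sum>m\<in>S. \<Sum>n\<in>S. (\<psi> m * \<psi> n) powr (3/4) * K m n)"
    unfolding sum_distrib_left by (intro sum_mono pair)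
  also have "\<dots> \<le> exp (- y) * sqrt B * ((\<Prod>p\<in>P. 1 + real kernel_const / real p) * ((\<Sum>n\<in>S. \<psi> n) * (\<Sum>n\<in>S. \<psi> n)) powr (3/4))"
    unfolding K_def
  proof (intro mult_left_mono bilinear_geometric_kernel_prod fin inj)
    fix p i j :: nat assume "i \<noteq> j"
    have "exp (y / real p) \<le> 3" if "real p > y"
    proof -
      have "exp (y / real p) \<le> exp 1" using that assms by simp
      also have "\<dots> \<le> 3" by (rule exp_le)
      finally show ?thesis .
    qed
    then show "tail_kernel y p i j \<le> 3 * (real p powr (- 1/4)) ^ ((i - j) + (j - i))"
      using \<open>i \<noteq> j\<close> by (auto simp: tail_kernel_def intro!: mult_right_mono)
  qed (use assms in \<open>auto simp: P_def tail_kernel_def prime_ge_2_nat\<close>)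
  also have "((\<Sum>n\<in>S. \<psi> n) * (\<Sum>n\<in>S. \<psi> n)) powr (3/4) = (\<Sum>n\<in>S. \<psi> n) powr (3/2)"
    using \<psi> by (simp add: powr_mult sum_nonneg flip: powr_add)
  finally have 1: "(\<Sum>m\<in>S. \<Sum>n\<in>S. if prime_tail (reduced_mult m n) y > 1 \<and> spacing \<psi> m n \<le> B then \<psi> m * \<psi> n else 0)
      \<le> exp (- y) * sqrt B * ((\<Prod>p\<in>P. 1 + real kernel_const / real p) * (\<Sum>n\<in>S. \<psi> n) powr (3/2))" .
  \<comment> \<open>Bernoulli's inequality converts the norm into a power of the Mertens product,
    thus into a power of \<open>log n\<close> later on.\<close>
  have "(\<Prod>p\<in>P. 1 + real kernel_const / real p) \<le> (\<Prod>p\<in>P. (1 / (1 - 1 / real p)) ^ kernel_const)"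
  proof (intro prod_mono conjI)
    fix p assume p: "p \<in> P"
    then have pr: "prime p" by (simp add: P_def)
    have "1 + real kernel_const / real p = 1 + real kernel_const * (1 / real p)" by simp
    also have "\<dots> \<le> (1 + 1 / real p) ^ kernel_const" by (rule Bernoulli_inequality) (simp add: order.trans[of _ 0])
    also have "\<dots> \<le> (1 / (1 - 1 / real p)) ^ kernel_const"
      using prime_ge_2_nat[OF pr] by (intro power_mono) (auto simp: field_simps)
    finally show "1 + real kernel_const / real p \<le> (1 / (1 - 1 / real p)) ^ kernel_const" .
  qed auto
  also have "(\<Prod>p\<in>P. (1 / (1 - 1 / real p)) ^ kernel_const) = (\<Prod>p\<in>P. 1 / (1 - 1 / real p)) ^ kernel_const"
    by (rule prod_power_distrib[symmetric])
  finally have 2: "(\<Prod>p\<in>P. 1 + real kernel_const / real p) \<le> (\<Prod>p\<in>P. 1 / (1 - 1 / real p)) ^ kernel_const" .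
  have "exp (- y) * sqrt B * ((\<Prod>p\<in>P. 1 + real kernel_const / real p) * (\<Sum>n\<in>S. \<psi> n) powr (3/2))
      \<le> exp (- y) * sqrt B * ((\<Prod>p\<in>P. 1 / (1 - 1 / real p)) ^ kernel_const * (\<Sum>n\<in>S. \<psi> n) powr (3/2))"
    using 2 assms(5) by (intro mult_left_mono mult_right_mono) auto
  with 1 show ?thesis unfolding P_def mult.assoc by (rule order.trans)
qed

section \<open>Blocks of comparable iterated logarithm\<close>

text \<open>Since \<open>4 ^ h\<close> is the square of \<open>2 ^ h\<close>, it outgrows every
  linear function of it.\<close>

lemma mult_exp_le_exp_four_power:
  "\<exists>h0. \<forall>h\<ge>h0. A * exp (b * 2 ^ h) \<le> exp ((4::real) ^ h)"
proof -
  define h0 where "h0 = nat \<lceil>\<bar>A\<bar> + \<bar>b\<bar>\<rceil>"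
  have "A * exp (b * 2 ^ h) \<le> exp (4 ^ h)" if "h \<ge> h0" for h
  proof -
    define L :: real where "L = 2 ^ h"
    have L1: "L \<ge> 1" by (simp add: L_def)
    have "\<bar>A\<bar> + \<bar>b\<bar> \<le> real h" using that unfolding h0_def by linarith
    also have "real h \<le> L" unfolding L_def using less_exp[of h] by (metis less_imp_le of_nat_le_iff of_nat_numeral of_nat_power)
    finally have L: "\<bar>A\<bar> + \<bar>b\<bar> \<le> L" .
    have "A * exp (b * L) \<le> exp \<bar>A\<bar> * exp (\<bar>b\<bar> * L)"
    proof (intro mult_mono)
      show "A \<le> exp \<bar>A\<bar>" using exp_ge_add_one_self[of "\<bar>A\<bar>"] by linarith
      show "exp (b * L) \<le> exp (\<bar>b\<bar> * L)" using L1 by (simp add: mult_right_mono)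
    qed auto
    also have "\<dots> = exp (\<bar>A\<bar> + \<bar>b\<bar> * L)" by (simp add: exp_add)
    also have "\<bar>A\<bar> + \<bar>b\<bar> * L \<le> (\<bar>A\<bar> + \<bar>b\<bar>) * L" using L1 by (simp add: distrib_right mult_le_cancel_left1)
    also have "\<dots> \<le> L * L" using L L1 by (intro mult_right_mono) auto
    also have "L * L = 4 ^ h" by (simp add: L_def flip: power_mult_distrib)
    finally show ?thesis by (simp add: L_def)
  qed
  then show ?thesis by blast
qed

section \<open>Averaging over dilations within a block\<close>

lemma mass_scale: "mass (\<lambda>n. \<psi> n / c) n = mass \<psi> n / c"
  by (simp add: mass_def)

lemma spacing_scale:
  assumes "c > 0"
  shows "spacing (\<lambda>n. \<psi> n / c) m n = spacing \<psi> m n / c"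
proof -
  have "max (real n * (\<psi> m / c)) (real m * (\<psi> n / c)) = max (real n * \<psi> m) (real m * \<psi> n) / c"
    using assms by (auto simp: max_def divide_le_cancel)
  then show ?thesis by (simp add: spacing_def)
qed

lemma mass_nonneg: "\<psi> n \<ge> 0 \<Longrightarrow> mass \<psi> n \<ge> 0"
  by (simp add: mass_def)

lemma mass_le: "\<psi> n \<ge> 0 \<Longrightarrow> mass \<psi> n \<le> 2 * \<psi> n"
  unfolding mass_def using totient_le[of n]
  by (cases "n = 0") (auto simp: pos_divide_le_eq intro!: mult_left_mono)

lemma spacing_nonneg: "\<psi> m \<ge> 0 \<Longrightarrow> \<psi> n \<ge> 0 \<Longrightarrow> spacing \<psi> m n \<ge> 0"
  by (auto simp: spacing_def intro!: divide_nonneg_nonneg simp: le_max_iff_disj)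

text \<open>
  The average over the dilation exponents \<open>k\<close> is bounded except for pairs with a heavy tail of large
  prime factors and small spacing; for those the crude bound loses only a power of \<open>log n\<close>.
\<close>
lemma sum_coprime_mean_block_le:
  assumes "0 < \<eta>" "\<eta> \<le> 1"
  shows "\<exists>C\<ge>1. \<forall>h t D. real h * \<eta> \<ge> 2 \<longrightarrow> 0 < t \<longrightarrow> real t \<le> exp (2 * exp (2 * 2 ^ h)) \<longrightarrow> 0 \<le> D \<longrightarrow>
    (\<Sum>k=1..nat \<lfloor>\<eta> * real h\<rfloor>. coprime_mean t (D / 2 ^ k))
      \<le> real (nat \<lfloor>\<eta> * real h\<rfloor>) * (C + (if prime_tail t (4 ^ h) > 1 \<and> D \<le> exp (3 * 2 ^ h) then C * exp (2 * 2 ^ h) else 0))"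
proof -
  obtain C4 where C4: "C4 \<ge> 1" "\<And>t D K Z. 0 < t \<Longrightarrow> 0 \<le> D \<Longrightarrow> 2 \<le> Z \<Longrightarrow> 2 * D \<le> real Z \<Longrightarrow>
      (\<Sum>k=1..K. coprime_mean t (D / 2 ^ k)) \<le> C4 * ln (real Z) * exp (2 * prime_tail t (real Z))"
    using sum_coprime_mean_dyadic_le by blast
  obtain C5 where C5: "C5 \<ge> 1" "\<And>t D. 0 < t \<Longrightarrow> 1 \<le> D \<Longrightarrow> coprime_mean t D \<le> C5 * exp (2 * prime_tail t D)"
    using coprime_mean_le_tail by blast
  obtain C6 where C6: "C6 \<ge> 1" "\<And>t D. 0 < t \<Longrightarrow> 0 \<le> D \<Longrightarrow> coprime_mean t D \<le> C6 * (real t / real (totient t))"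
    using coprime_mean_le_div_totient by blast
  obtain C3 where C3: "C3 \<ge> 1" "\<And>t x. 0 < t \<Longrightarrow> real t \<le> exp x \<Longrightarrow> 1 \<le> x \<Longrightarrow> real t / real (totient t) \<le> C3 * x"
    using div_totient_le by blast
  define C where "C = C4 * (8 / \<eta>) * exp 2 + C5 * exp 8 + C6 * C3 * 2"
  have nn: "C4 * (8 / \<eta>) * exp 2 \<ge> 0" "C5 * exp 8 \<ge> 0" "C6 * C3 * 2 \<ge> 0"
    using C3 C4 C5 C6 assms by auto
  have "C6 * C3 \<ge> 1 * 1" using C6 C3 by (intro mult_mono) auto
  then have C1: "C \<ge> 1" using nn unfolding C_def by linarith
  have "C5 * exp 2 \<le> C5 * exp 8" using C5 by simp
  then have C_ge: "C4 * (8 / \<eta>) * exp 2 \<le> C" "C5 * exp 2 \<le> C" "C5 * exp 8 \<le> C" "C6 * C3 * 2 \<le> C"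
    using nn unfolding C_def by linarith+
  have "(\<Sum>k=1..K. coprime_mean t (D / 2 ^ k))
      \<le> real K * (C + (if prime_tail t (4 ^ h) > 1 \<and> D \<le> exp (3 * 2 ^ h) then C * exp (2 * 2 ^ h) else 0))"
    if h: "real h * \<eta> \<ge> 2" and t: "0 < t" "real t \<le> exp (2 * exp (2 * 2 ^ h))" and D: "0 \<le> D"
      and K: "K = nat \<lfloor>\<eta> * real h\<rfloor>" for h t D K
  proof -
    have hpos: "h > 0" using h assms by (cases h) auto
    have "\<eta> * real h \<le> 1 * real h" using assms by (intro mult_right_mono) auto
    then have Kh: "K \<le> h" unfolding K by linarith
    have Kge: "real K \<ge> \<eta> * real h / 2" using h unfolding K by (simp add: mult.commute) linarith
    have unif: "(\<Sum>k=1..K. coprime_mean t (D / 2 ^ k)) \<le> real K * c"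
      if "\<And>k. k \<in> {1..K} \<Longrightarrow> coprime_mean t (D / 2 ^ k) \<le> c" for c
      using sum_bounded_above[of "{1..K}" "\<lambda>k. coprime_mean t (D / 2 ^ k)" c] that by simp
    have ext: "real K * c \<le> real K * (C + (if prime_tail t (4 ^ h) > 1 \<and> D \<le> exp (3 * 2 ^ h) then C * exp (2 * 2 ^ h) else 0))"
      if "c \<le> C" for c using that C1 by (intro mult_left_mono) (auto intro: add_increasing2)
    \<comment> \<open>If the tail beyond \<open>4 ^ h\<close> is light, either all of
      \<open>D / 2 ^ k\<close> stay above \<open>4 ^ h\<close> and cancellation works at each scale,
      or \<open>D\<close> is small enough for the dyadic sum to cost \<open>O(h)\<close>. If the
      tail is heavy but \<open>D\<close> is huge, the number of prime factors of \<open>t\<close>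
      alone limits the tail at \<open>D / 2 ^ k\<close>. Only the last case resorts to the crude
      bound.\<close>
    consider (small) "prime_tail t (4 ^ h) \<le> 1" "D \<le> 4 ^ h * 2 ^ K"
      | (large) "prime_tail t (4 ^ h) \<le> 1" "D > 4 ^ h * 2 ^ K"
      | (huge) "prime_tail t (4 ^ h) > 1" "D > exp (3 * 2 ^ h)"
      | (bad) "prime_tail t (4 ^ h) > 1" "D \<le> exp (3 * 2 ^ h)" by linarith
    then show ?thesis
    proof cases
      case small
      \<comment> \<open>The choice satisfies \<open>2 * D \<le> Z\<close>, and
        \<open>ln Z \<le> 1 + 2 * h + K \<le> 4 * h\<close> is at most \<open>8 / \<eta>\<close>
        times the number \<open>K\<close> of scales.\<close>
      define Z :: nat where "Z = 2 ^ (1 + 2 * h + K)"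
      have Zr: "real Z = 2 * (4 ^ h * 2 ^ K)"
        by (simp add: Z_def power_add power_mult)
      have "Z \<ge> 2 ^ 1" unfolding Z_def by (intro power_increasing) auto
      have "(4::real) ^ h * 1 \<le> 4 ^ h * 2 ^ K" by (intro mult_left_mono) auto
      moreover have "(0::real) \<le> 4 ^ h * 2 ^ K" by simp
      ultimately have "(4::real) ^ h \<le> real Z" unfolding Zr by linarith
      then have "prime_tail t (real Z) \<le> prime_tail t (4 ^ h)" by (rule prime_tail_antimono)
      then have tail: "prime_tail t (real Z) \<le> 1" using small by simp
      have "ln (real Z) = real (1 + 2 * h + K) * ln 2" unfolding Z_def by (simp add: ln_realpow del: power_Suc)
      also have "\<dots> \<le> real (1 + 2 * h + K) * 1" using ln_2_less_1 by (intro mult_left_mono) auto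
      also have "\<dots> \<le> 4 * real h" using Kh hpos by simp
      also have "\<dots> \<le> real K * (8 / \<eta>)" using Kge assms by (simp add: field_simps)
      finally have lnZ: "ln (real Z) \<le> real K * (8 / \<eta>)" .
      have "(\<Sum>k=1..K. coprime_mean t (D / 2 ^ k)) \<le> C4 * ln (real Z) * exp (2 * prime_tail t (real Z))"
        using small t D \<open>Z \<ge> 2 ^ 1\<close> by (intro C4) (auto simp: Zr)
      also have "\<dots> \<le> C4 * (real K * (8 / \<eta>)) * exp 2"
      proof (intro mult_mono)
        show "0 \<le> ln (real Z)" using \<open>Z \<ge> 2 ^ 1\<close> by (intro ln_ge_zero) auto
      qed (use C4(1) lnZ tail assms in auto)
      also have "\<dots> = real K * (C4 * (8 / \<eta>) * exp 2)" by simp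
      also have "\<dots> \<le> real K * (C + (if prime_tail t (4 ^ h) > 1 \<and> D \<le> exp (3 * 2 ^ h) then C * exp (2 * 2 ^ h) else 0))"
        by (intro ext C_ge)
      finally show ?thesis .
    next
      case large
      have "coprime_mean t (D / 2 ^ k) \<le> C5 * exp 2" if k: "k \<in> {1..K}" for k
      proof -
        have "(4::real) ^ h * 2 ^ k \<le> 4 ^ h * 2 ^ K" using k by (intro mult_left_mono power_increasing) auto
        then have "4 ^ h * 2 ^ k \<le> D" using large by linarith
        then have ge: "4 ^ h \<le> D / 2 ^ k" by (simp add: pos_le_divide_eq)
        have "(1::real) \<le> 4 ^ h" by simp
        then have "coprime_mean t (D / 2 ^ k) \<le> C5 * exp (2 * prime_tail t (D / 2 ^ k))"
          by (rule C5(2)[OF t(1) order.trans[OF _ ge]])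
        also have "\<dots> \<le> C5 * exp 2"
          using prime_tail_antimono[OF ge, of t] large C5 by (intro mult_left_mono) auto
        finally show ?thesis .
      qed
      then show ?thesis by (rule order.trans[OF unif ext[OF C_ge(2)]])
    next
      case huge
      define E :: real where "E = exp (2 * 2 ^ h)"
      have E1: "E \<ge> 1" by (simp add: E_def)
      have "coprime_mean t (D / 2 ^ k) \<le> C5 * exp 8" if k: "k \<in> {1..K}" for k
      proof -
        \<comment> \<open>Dilation costs at most \<open>2 ^ h \<le> exp (2 ^ h)\<close>, so the
          exponent 3 leaves 2, and \<open>E = exp (2 * 2 ^ h)\<close> matches the size
          \<open>2 * E\<close> of \<open>ln t\<close>.\<close>
        have "E * 2 ^ k \<le> E * 2 ^ h" using k Kh E1 by (intro mult_left_mono power_increasing) auto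
        also have "2 ^ h \<le> exp ((2::real) ^ h)" using exp_ge_add_one_self[of "(2::real) ^ h"] by linarith
        also have "E * exp ((2::real) ^ h) = exp (3 * 2 ^ h)" by (simp add: E_def flip: exp_add)
        finally have "E * 2 ^ k \<le> D" using huge E1 by simp
        then have ge: "E \<le> D / 2 ^ k" by (simp add: pos_le_divide_eq)
        have "prime_tail t E \<le> ln (real t) / (E * ln 2)" using t E1 by (intro prime_tail_le) auto
        also have "\<dots> \<le> (2 * E) / (E * ln 2)"
        proof (intro divide_right_mono)
          have "ln (real t) \<le> ln (exp (2 * E))" using t unfolding E_def by (subst ln_le_cancel_iff) auto
          then show "ln (real t) \<le> 2 * E" by simp
        qed (use E1 in auto)
        also have "\<dots> = 2 / ln 2" using E1 by simp
        also have "\<dots> \<le> 4" using ln2_ge_two_thirds by (simp add: field_simps)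
        finally have tail: "prime_tail t E \<le> 4" .
        have "coprime_mean t (D / 2 ^ k) \<le> C5 * exp (2 * prime_tail t (D / 2 ^ k))"
          by (rule C5(2)[OF t(1) order.trans[OF E1 ge]])
        also have "\<dots> \<le> C5 * exp 8"
          using prime_tail_antimono[OF ge, of t] tail C5 by (intro mult_left_mono) auto
        finally show ?thesis .
      qed
      then show ?thesis by (rule order.trans[OF unif ext[OF C_ge(3)]])
    next
      case bad
      have "coprime_mean t (D / 2 ^ k) \<le> C + C * exp (2 * 2 ^ h)" for k
      proof -
        have "coprime_mean t (D / 2 ^ k) \<le> C6 * (real t / real (totient t))"
          using t D by (intro C6) auto
        also have "\<dots> \<le> C6 * (C3 * (2 * exp (2 * 2 ^ h)))"
        proof (intro mult_left_mono C3)
          have "(1::real) \<le> exp (2 * 2 ^ h)" by simp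
          then show "(1::real) \<le> 2 * exp (2 * 2 ^ h)" by linarith
        qed (use t C6 in auto)
        also have "\<dots> = (C6 * C3 * 2) * exp (2 * 2 ^ h)" by simp
        also have "\<dots> \<le> C * exp (2 * 2 ^ h)" using C_ge(4) by (intro mult_right_mono) auto
        finally show ?thesis using C1 by linarith
      qed
      then have "(\<Sum>k=1..K. coprime_mean t (D / 2 ^ k)) \<le> real K * (C + C * exp (2 * 2 ^ h))" by (rule unif)
      then show ?thesis using bad by simp
    qed
  qed
  then show ?thesis using C1 by blast
qed

text \<open>The bounded average over \<open>k\<close> yields one good \<open>k\<close>. Since the
  mass is at least \<open>2 ^ K\<close>, it stays at least 1 after division by \<open>2 ^ k\<close>,
  so the diagonal terms are absorbed by its square.\<close>

lemma sum_overlap_block_le: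
  assumes "0 < \<eta>" "\<eta> \<le> 1"
  shows "\<exists>C\<ge>1. \<exists>h0. \<forall>h\<ge>h0. \<forall>S \<psi>. finite S \<longrightarrow> (\<forall>n\<in>S. 0 < n \<and> real n \<le> exp (exp (2 * 2 ^ h)))
    \<longrightarrow> (\<forall>n. 0 \<le> \<psi> n) \<longrightarrow> 2 ^ nat \<lfloor>\<eta> * real h\<rfloor> \<le> (\<Sum>n\<in>S. mass \<psi> n)
    \<longrightarrow> (\<exists>k\<in>{1..nat \<lfloor>\<eta> * real h\<rfloor>}. (\<Sum>m\<in>S. \<Sum>n\<in>S. overlap (\<lambda>n. \<psi> n / 2 ^ k) m n) \<le> C * (\<Sum>n\<in>S. mass \<psi> n / 2 ^ k)\<^sup>2)"
proof -
  obtain C where C: "C \<ge> 1" "\<And>h t D. real h * \<eta> \<ge> 2 \<Longrightarrow> 0 < t \<Longrightarrow> real t \<le> exp (2 * exp (2 * 2 ^ h)) \<Longrightarrow> 0 \<le> D \<Longrightarrow>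
    (\<Sum>k=1..nat \<lfloor>\<eta> * real h\<rfloor>. coprime_mean t (D / 2 ^ k))
      \<le> real (nat \<lfloor>\<eta> * real h\<rfloor>) * (C + (if prime_tail t (4 ^ h) > 1 \<and> D \<le> exp (3 * 2 ^ h) then C * exp (2 * 2 ^ h) else 0))"
    using sum_coprime_mean_block_le[OF assms] by blast
  obtain C3 where C3: "C3 \<ge> 1" "\<And>t x. 0 < t \<Longrightarrow> real t \<le> exp x \<Longrightarrow> 1 \<le> x \<Longrightarrow> real t / real (totient t) \<le> C3 * x"
    using div_totient_le by blast
  obtain M where M: "M \<ge> 1" "\<And>n. n \<ge> 2 \<Longrightarrow> (\<Prod>p | prime p \<and> p \<le> n. 1 / (1 - 1 / real p)) \<le> M * ln (real n)"
    using mertens_upper by blast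
  define A where "A = 4 * C * M ^ kernel_const * C3\<^sup>2"
  \<comment> \<open>The powers of \<open>E\<close> are one from the crude bound on the mean,
    \<open>kernel_const\<close> from the Mertens product and two from the square of the bound on the
    sum of \<psi>; \<open>sqrt B\<close> adds \<open>3/2\<close>.\<close>
  define b where "b = 2 * (real kernel_const + 3) + 3 / 2"
  obtain h1 where h1: "\<And>h. h \<ge> h1 \<Longrightarrow> A * exp (b * 2 ^ h) \<le> exp (4 ^ h)"
    using mult_exp_le_exp_four_power by blast
  define h0 where "h0 = max h1 (nat \<lceil>2 / \<eta>\<rceil>)"
  have main: "\<exists>k\<in>{1..K}. (\<Sum>m\<in>S. \<Sum>n\<in>S. overlap (\<lambda>n. \<psi> n / 2 ^ k) m n) \<le> (C + 2) * (\<Sum>n\<in>S. mass \<psi> n / 2 ^ k)\<^sup>2"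
    if h: "h \<ge> h0" and "finite S" and S: "\<forall>n\<in>S. 0 < n \<and> real n \<le> exp (exp (2 * 2 ^ h))"
      and \<psi>: "\<forall>n. 0 \<le> \<psi> n" and K: "K = nat \<lfloor>\<eta> * real h\<rfloor>" and big: "2 ^ K \<le> (\<Sum>n\<in>S. mass \<psi> n)"
    for h S \<psi> K
  proof -
    define E :: real where "E = exp (2 * 2 ^ h)"
    define y :: real where "y = 4 ^ h"
    define B :: real where "B = exp (3 * 2 ^ h)"
    define T where "T = (\<Sum>n\<in>S. mass \<psi> n)"
    define bad where "bad m n \<longleftrightarrow> prime_tail (reduced_mult m n) y > 1 \<and> spacing \<psi> m n \<le> B" for m n
    have E1: "E \<ge> 1" by (simp add: E_def)
    have hh: "h \<ge> h1" "real h \<ge> 2 / \<eta>" using h unfolding h0_def by auto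
    then have h\<eta>: "real h * \<eta> \<ge> 2" using assms by (simp add: pos_divide_le_eq)
    then have K1: "K \<ge> 1" unfolding K by (simp add: le_nat_iff le_floor_iff mult.commute)
    have "(1::real) \<le> 2 ^ K" by simp
    then have T1: "T \<ge> 1" using big unfolding T_def by linarith
    have m0: "mass \<psi> n \<ge> 0" for n using \<psi> by (simp add: mass_nonneg)
    define N where "N = nat \<lfloor>exp E\<rfloor>"
    have "exp E \<ge> 2" using exp_ge_add_one_self[of E] E1 by linarith
    then have N: "N \<ge> 2" "real N \<le> exp E" by (auto simp: N_def le_nat_iff le_floor_iff)
    have SN: "0 < n \<and> n \<le> N" if "n \<in> S" for n using S that by (simp add: N_def E_def le_nat_floor)
    have sum_\<psi>: "(\<Sum>n\<in>S. \<psi> n) \<le> C3 * E * T"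
    proof -
      have half: "x / 2 \<le> x" if "0 \<le> x" for x :: real using that by simp
      have "\<psi> n \<le> C3 * E * mass \<psi> n" if n: "n \<in> S" for n
      proof -
        have "\<psi> n = mass \<psi> n * (real n / real (totient n)) / 2" using SN[OF n] by (simp add: mass_def)
        also have "\<dots> \<le> mass \<psi> n * (real n / real (totient n))"
        proof -
          have "0 \<le> mass \<psi> n * (real n / real (totient n))" using m0[of n] by (intro mult_nonneg_nonneg) auto
          then show ?thesis by (rule half)
        qed
        also have "\<dots> \<le> mass \<psi> n * (C3 * E)"
          using S n E1 by (intro mult_left_mono C3 m0) (auto simp: E_def)
        finally show ?thesis by (simp add: mult_ac)
      qed
      then show ?thesis unfolding T_def sum_distrib_left by (intro sum_mono)
    qed
    have badsum: "(\<Sum>m\<in>S. \<Sum>n\<in>S. if bad m n then mass \<psi> m * mass \<psi> n * (C * E) else 0) \<le> T\<^sup>2"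
    proof -
      have "(\<Sum>m\<in>S. \<Sum>n\<in>S. if bad m n then mass \<psi> m * mass \<psi> n * (C * E) else 0)
          \<le> (\<Sum>m\<in>S. \<Sum>n\<in>S. (4 * C * E) * (if bad m n then \<psi> m * \<psi> n else 0))"
      proof (intro sum_mono)
        fix m n
        have "mass \<psi> m * mass \<psi> n \<le> (2 * \<psi> m) * (2 * \<psi> n)"
          using \<psi> m0 by (intro mult_mono mass_le) auto
        then have "mass \<psi> m * mass \<psi> n * (C * E) \<le> (2 * \<psi> m) * (2 * \<psi> n) * (C * E)"
          using C E1 by (intro mult_right_mono) auto
        then show "(if bad m n then mass \<psi> m * mass \<psi> n * (C * E) else 0) \<le> (4 * C * E) * (if bad m n then \<psi> m * \<psi> n else 0)"
          by (simp add: mult_ac)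
      qed
      also have "\<dots> = (4 * C * E) * (\<Sum>m\<in>S. \<Sum>n\<in>S. if bad m n then \<psi> m * \<psi> n else 0)"
        by (simp only: sum_distrib_left)
      also have "\<dots> \<le> (4 * C * E) * (exp (- y) * sqrt B * (\<Prod>p | prime p \<and> p \<le> N. 1 / (1 - 1 / real p)) ^ kernel_const * (\<Sum>n\<in>S. \<psi> n) powr (3/2))"
        unfolding bad_def using \<open>finite S\<close> SN \<psi> C E1
        by (intro mult_left_mono sum_tail_pairs_le) (auto simp: y_def B_def)
      also have "\<dots> \<le> (4 * C * E) * (exp (- y) * sqrt B * (M * E) ^ kernel_const * (C3 * E * T)\<^sup>2)"
      proof (intro mult_left_mono mult_mono power_mono)
        have "(\<Prod>p | prime p \<and> p \<le> N. 1 / (1 - 1 / real p)) \<le> M * ln (real N)" using N by (intro M) auto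
        also have "ln (real N) \<le> ln (exp E)" using N by (subst ln_le_cancel_iff) auto
        finally show "(\<Prod>p | prime p \<and> p \<le> N. 1 / (1 - 1 / real p)) \<le> M * E" using M by simp
        show "0 \<le> (\<Prod>p | prime p \<and> p \<le> N. 1 / (1 - 1 / real p))"
          by (intro prod_nonneg) (auto simp: one_minus_inverse_prime)
        have "C3 * E \<ge> 1 * 1" using C3 E1 by (intro mult_mono) auto
        then have "C3 * E * T \<ge> 1 * 1" using T1 by (intro mult_mono) auto
        then have ge: "C3 * E * T \<ge> 1" by simp
        have "(\<Sum>n\<in>S. \<psi> n) powr (3/2) \<le> (C3 * E * T) powr (3/2)"
          using sum_\<psi> \<psi> by (intro powr_mono2 sum_nonneg) auto
        \<comment> \<open>The exponent is raised to 2, so that the bad pairs compare with the square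
          of the mass; the base is at least 1.\<close>
        also have "\<dots> \<le> (C3 * E * T) powr 2" using ge by (intro powr_mono) auto
        also have "\<dots> = (C3 * E * T)\<^sup>2" using ge by simp
        finally show "(\<Sum>n\<in>S. \<psi> n) powr (3/2) \<le> (C3 * E * T)\<^sup>2" .
      qed (use C E1 M in \<open>auto simp: B_def\<close>)
      also have "\<dots> = (A * (E ^ (kernel_const + 3) * sqrt B)) * exp (- y) * T\<^sup>2"
        by (simp add: A_def power_mult_distrib power_add power2_eq_square power3_eq_cube)
      also have "E ^ (kernel_const + 3) * sqrt B = exp (b * 2 ^ h)"
      proof -
        have "sqrt B = exp (3 / 2 * 2 ^ h)"
          by (intro real_sqrt_unique) (auto simp: B_def power2_eq_square simp flip: exp_add)
        moreover have "E ^ (kernel_const + 3) = exp (real (kernel_const + 3) * (2 * 2 ^ h))"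
          unfolding E_def by (simp only: exp_of_nat_mult)
        ultimately show ?thesis by (simp add: b_def algebra_simps flip: exp_add)
      qed
      also have "A * exp (b * 2 ^ h) * exp (- y) * T\<^sup>2 \<le> exp y * exp (- y) * T\<^sup>2"
        using h1[OF hh(1)] unfolding y_def by (intro mult_right_mono) auto
      also have "\<dots> = T\<^sup>2" by (simp flip: exp_add)
      finally show ?thesis .
    qed
    define Q where "Q k = (\<Sum>m\<in>S. \<Sum>n\<in>S. mass \<psi> m * mass \<psi> n * coprime_mean (reduced_mult m n) (spacing \<psi> m n / 2 ^ k))" for k :: nat
    have "(\<Sum>k=1..K. Q k) = (\<Sum>m\<in>S. \<Sum>n\<in>S. mass \<psi> m * mass \<psi> n * (\<Sum>k=1..K. coprime_mean (reduced_mult m n) (spacing \<psi> m n / 2 ^ k)))"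
      unfolding Q_def sum_distrib_left by (subst sum.swap, rule sum.cong[OF refl], rule sum.swap)
    also have "\<dots> \<le> (\<Sum>m\<in>S. \<Sum>n\<in>S. mass \<psi> m * mass \<psi> n * (real K * (C + (if bad m n then C * E else 0))))"
    proof (intro sum_mono mult_left_mono mult_nonneg_nonneg m0)
      fix m n assume mn: "m \<in> S" "n \<in> S"
      have "real (reduced_mult m n) \<le> real (m * n)" by (simp only: of_nat_le_iff reduced_mult_le)
      also have "\<dots> \<le> exp E * exp E" using S mn unfolding of_nat_mult E_def by (intro mult_mono) auto
      also have "\<dots> = exp (2 * E)" by (simp flip: exp_add)
      finally show "(\<Sum>k=1..K. coprime_mean (reduced_mult m n) (spacing \<psi> m n / 2 ^ k)) \<le> real K * (C + (if bad m n then C * E else 0))"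
        unfolding K bad_def E_def y_def B_def using SN[OF mn(1)] SN[OF mn(2)] h\<eta> \<psi>
        by (intro C) (auto simp: reduced_mult_pos spacing_nonneg)
    qed
    also have "\<dots> = real K * (C * T\<^sup>2 + (\<Sum>m\<in>S. \<Sum>n\<in>S. if bad m n then mass \<psi> m * mass \<psi> n * (C * E) else 0))"
    proof -
      have "mass \<psi> m * mass \<psi> n * (real K * (C + (if bad m n then C * E else 0)))
          = real K * (C * (mass \<psi> m * mass \<psi> n) + (if bad m n then mass \<psi> m * mass \<psi> n * (C * E) else 0))" for m n
        by (simp add: algebra_simps)
      then show ?thesis
        unfolding T_def power2_eq_square sum_product
        by (simp only: sum_distrib_left[symmetric] sum.distrib)
    qed
    also have "\<dots> \<le> real K * (C * T\<^sup>2 + T\<^sup>2)" using badsum by (intro mult_left_mono add_left_mono) auto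
    finally have Qsum: "(\<Sum>k=1..K. Q k) \<le> real K * ((C + 1) * T\<^sup>2)" by (simp add: algebra_simps)
    have "\<exists>k\<in>{1..K}. Q k \<le> (C + 1) * T\<^sup>2"
    proof (rule ccontr)
      assume "\<not> ?thesis"
      then have "(C + 1) * T\<^sup>2 < Q k" if "k \<in> {1..K}" for k using that by (meson not_le)
      then have "(\<Sum>k=1..K. (C + 1) * T\<^sup>2) < (\<Sum>k=1..K. Q k)" using K1 by (intro sum_strict_mono) auto
      then show False using Qsum by simp
    qed
    then obtain k where k: "k \<in> {1..K}" "Q k \<le> (C + 1) * T\<^sup>2" by blast
    have "(\<Sum>m\<in>S. \<Sum>n\<in>S. overlap (\<lambda>n. \<psi> n / 2 ^ k) m n)
        \<le> (\<Sum>m\<in>S. \<Sum>n\<in>S. (if m = n then mass \<psi> m / 2 ^ k else 0)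
            + mass \<psi> m * mass \<psi> n * coprime_mean (reduced_mult m n) (spacing \<psi> m n / 2 ^ k) / 2 ^ k / 2 ^ k)"
    proof (intro sum_mono)
      fix m n assume mn: "m \<in> S" "n \<in> S"
      show "overlap (\<lambda>n. \<psi> n / 2 ^ k) m n \<le> (if m = n then mass \<psi> m / 2 ^ k else 0)
            + mass \<psi> m * mass \<psi> n * coprime_mean (reduced_mult m n) (spacing \<psi> m n / 2 ^ k) / 2 ^ k / 2 ^ k"
        using overlap_le[of m n "\<lambda>n. \<psi> n / 2 ^ k"] SN[OF mn(1)] SN[OF mn(2)] \<psi>
        by (simp add: mass_scale spacing_scale split: if_splits)
    qed
    also have "\<dots> = T / 2 ^ k + Q k / 2 ^ k / 2 ^ k"
      using \<open>finite S\<close> by (simp add: sum.distrib sum.delta T_def Q_def sum_divide_distrib)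
    also have "\<dots> \<le> (T / 2 ^ k)\<^sup>2 + (C + 1) * (T / 2 ^ k)\<^sup>2"
    proof (rule add_mono)
      have "(2::real) ^ k \<le> 2 ^ K" using k by (intro power_increasing) auto
      then have "2 ^ k \<le> T" using big unfolding T_def by (rule order.trans)
      then have "T / 2 ^ k \<ge> 1" by simp
      then show "T / 2 ^ k \<le> (T / 2 ^ k)\<^sup>2" by (rule self_le_power) simp
      have "Q k / 2 ^ k / 2 ^ k \<le> (C + 1) * T\<^sup>2 / 2 ^ k / 2 ^ k" using k by (intro divide_right_mono) auto
      then show "Q k / 2 ^ k / 2 ^ k \<le> (C + 1) * (T / 2 ^ k)\<^sup>2" by (simp add: power2_eq_square)
    qed
    also have "\<dots> = (C + 2) * (\<Sum>n\<in>S. mass \<psi> n / 2 ^ k)\<^sup>2"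
      by (simp add: T_def sum_divide_distrib algebra_simps)
    finally show ?thesis using k by blast
  qed
  show ?thesis
  proof (intro exI[of _ "C + 2"] exI[of _ h0] conjI allI impI)
    show "C + 2 \<ge> 1" using C by simp
    fix h S \<psi>
    assume "h0 \<le> h" "finite S" "\<forall>n\<in>S. 0 < n \<and> real n \<le> exp (exp (2 * 2 ^ h))" "\<forall>n. 0 \<le> \<psi> n"
      "2 ^ nat \<lfloor>\<eta> * real h\<rfloor> \<le> (\<Sum>n\<in>S. mass \<psi> n)"
    then show "\<exists>k\<in>{1..nat \<lfloor>\<eta> * real h\<rfloor>}. (\<Sum>m\<in>S. \<Sum>n\<in>S. overlap (\<lambda>n. \<psi> n / 2 ^ k) m n)
        \<le> (C + 2) * (\<Sum>n\<in>S. mass \<psi> n / 2 ^ k)\<^sup>2"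
      by (rule main[OF _ _ _ _ refl])
  qed
qed

section \<open>Positive measure\<close>

text \<open>Integrate \<open>(F - C T)\<^sup>2\<close> over the union, where \<open>F\<close> counts the sets containing a point and \<open>T\<close> is its integral.\<close>
lemma measure_UN_ge_of_second_moment:
  assumes "finite Z" and A: "\<And>z. z \<in> Z \<Longrightarrow> A z \<in> fmeasurable M"
    and pos: "(\<Sum>z\<in>Z. measure M (A z)) > 0" and C: "C > 0"
    and le: "(\<Sum>z\<in>Z. \<Sum>z'\<in>Z. measure M (A z \<inter> A z')) \<le> C * (\<Sum>z\<in>Z. measure M (A z))\<^sup>2"
  shows "measure M (\<Union>z\<in>Z. A z) \<ge> 1 / C"
proof -
  define T where "T = (\<Sum>z\<in>Z. measure M (A z))"
  define U where "U = (\<Union>z\<in>Z. A z)"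
  define F :: "_ \<Rightarrow> real" where "F x = (\<Sum>z\<in>Z. indicator (A z) x)" for x
  have U: "U \<in> fmeasurable M" unfolding U_def using assms by (intro fmeasurable.finite_UN) auto
  have ind: "integrable M (indicator B :: _ \<Rightarrow> real)" "(\<integral>x. indicator B x \<partial>M) = measure M B"
    if "B \<in> fmeasurable M" for B
    using that by (auto simp: fmeasurable_def integrable_indicator_iff)
  have Int: "A z \<inter> A z' \<in> fmeasurable M" if "z \<in> Z" "z' \<in> Z" for z z'
    using A that by (intro fmeasurable.Int) auto
  have intF: "integrable M F" "(\<integral>x. F x \<partial>M) = T"
    unfolding F_def T_def using ind A by (auto simp: Bochner_Integration.integral_sum)
  have F2: "(F x)\<^sup>2 = (\<Sum>z\<in>Z. \<Sum>z'\<in>Z. indicator (A z \<inter> A z') x)" for x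
    by (simp add: F_def power2_eq_square sum_product indicator_inter_arith)
  have intF2: "integrable M (\<lambda>x. (F x)\<^sup>2)" "(\<integral>x. (F x)\<^sup>2 \<partial>M) = (\<Sum>z\<in>Z. \<Sum>z'\<in>Z. measure M (A z \<inter> A z'))"
    unfolding F2 using ind Int by (auto simp: Bochner_Integration.integral_sum)
  define c where "c = C * T"
  have "0 \<le> (\<integral>x. (F x - c)\<^sup>2 * indicator U x \<partial>M)" by (intro Bochner_Integration.integral_nonneg) auto
  also have "(\<lambda>x. (F x - c)\<^sup>2 * indicator U x) = (\<lambda>x. (F x)\<^sup>2 - 2 * c * F x + c\<^sup>2 * indicator U x)"
  proof
    fix x
    have "x \<notin> U \<Longrightarrow> F x = 0" by (auto simp: F_def U_def intro!: sum.neutral)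
    then show "(F x - c)\<^sup>2 * indicator U x = (F x)\<^sup>2 - 2 * c * F x + c\<^sup>2 * indicator U x"
      by (cases "x \<in> U") (auto simp: power2_eq_square algebra_simps)
  qed
  also have "(\<integral>x. (F x)\<^sup>2 - 2 * c * F x + c\<^sup>2 * indicator U x \<partial>M)
      = (\<Sum>z\<in>Z. \<Sum>z'\<in>Z. measure M (A z \<inter> A z')) - 2 * c * T + c\<^sup>2 * measure M U"
    using intF intF2 ind[OF U] by simp
  also have "\<dots> \<le> C * T\<^sup>2 - 2 * c * T + c\<^sup>2 * measure M U" using le by (simp add: T_def)
  also have "\<dots> = C * T\<^sup>2 * (C * measure M U - 1)" by (simp add: c_def power2_eq_square algebra_simps)
  finally have "0 \<le> C * T\<^sup>2 * (C * measure M U - 1)" .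
  moreover have "C * T\<^sup>2 > 0" using C pos by (simp add: T_def)
  ultimately have "C * measure M U \<ge> 1" by (simp add: zero_le_mult_iff)
  then show ?thesis using C by (simp add: U_def field_simps)
qed

lemma approx_set_eq: "approx_set \<psi> n = (\<Union>a\<in>coprime_residues n. approx_interval \<psi> n a)"
proof -
  have "coprime_residues n = {a. 1 \<le> a \<and> a \<le> n \<and> gcd a n = 1}"
    unfolding coprime_residues_def by (simp only: coprime_iff_gcd_eq_1 atLeastAtMost_iff conj_assoc)
  then show ?thesis unfolding approx_set_def approx_interval_def by simp
qed

lemma approx_set_measurable [measurable]: "approx_set \<psi> n \<in> sets borel"
  unfolding approx_set_eq approx_interval_def by auto

lemma approx_set_mono:
  assumes "\<psi> n \<le> \<psi>' n"
  shows "approx_set \<psi> n \<subseteq> approx_set \<psi>' n"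
proof -
  have "approx_interval \<psi> n a \<subseteq> approx_interval \<psi>' n a" for a
  proof
    fix x assume "x \<in> approx_interval \<psi> n a"
    moreover have "(real a - \<psi>' n) / real n \<le> (real a - \<psi> n) / real n" "(real a + \<psi> n) / real n \<le> (real a + \<psi>' n) / real n"
      using assms by (auto intro: divide_right_mono)
    ultimately show "x \<in> approx_interval \<psi>' n a" by (auto simp: approx_interval_def)
  qed
  then show ?thesis unfolding approx_set_eq by blast
qed

lemma approx_set_subset:
  assumes "\<psi> n \<le> real n" "n > 0"
  shows "approx_set \<psi> n \<subseteq> {-1..2}"
proof
  fix x assume "x \<in> approx_set \<psi> n"
  then obtain a where a: "1 \<le> a" "a \<le> n" "(real a - \<psi> n) / real n < x" "x < (real a + \<psi> n) / real n"
    by (auto simp: approx_set_def)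
  have "-1 \<le> (real a - \<psi> n) / real n" "(real a + \<psi> n) / real n \<le> 2"
    using a assms by (simp_all add: field_simps)
  then show "x \<in> {-1..2}" using a by simp
qed

lemma measure_approx_interval:
  assumes "\<psi> n \<ge> 0"
  shows "measure lborel (approx_interval \<psi> n a) = 2 * \<psi> n / real n"
proof -
  have "(real a - \<psi> n) / real n \<le> (real a + \<psi> n) / real n" using assms by (intro divide_right_mono) auto
  then show ?thesis by (simp add: approx_interval_def measure_lborel_Ioo diff_divide_distrib add_divide_distrib)
qed

lemma approx_interval_fmeasurable: "approx_interval \<psi> n a \<in> fmeasurable lborel"
proof -
  have "bounded (approx_interval \<psi> n a)"
    by (rule bounded_subset[OF bounded_closed_interval[of "(real a - \<psi> n) / real n" "(real a + \<psi> n) / real n"]])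
       (auto simp: approx_interval_def)
  then have "emeasure lborel (approx_interval \<psi> n a) < \<infinity>" by (rule emeasure_bounded_finite)
  then show ?thesis by (auto simp: fmeasurable_def approx_interval_def)
qed

text \<open>The second moment method is applied to the single intervals, indexed by denominator and
  numerator, as \<open>mass\<close> and \<open>overlap\<close> count with multiplicity.\<close>

lemma measure_UN_approx_set_ge:
  assumes "finite S" "\<And>n. \<psi> n \<ge> 0" "(\<Sum>n\<in>S. mass \<psi> n) > 0" "C > 0"
    and "(\<Sum>m\<in>S. \<Sum>n\<in>S. overlap \<psi> m n) \<le> C * (\<Sum>n\<in>S. mass \<psi> n)\<^sup>2"
  shows "measure lborel (\<Union>n\<in>S. approx_set \<psi> n) \<ge> 1 / C"
proof -
  define Z where "Z = (SIGMA n:S. coprime_residues n)"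
  define A where "A = (\<lambda>(n, a). approx_interval \<psi> n a)"
  have finZ: "finite Z" using assms(1) by (simp add: Z_def)
  have sumZ: "(\<Sum>z\<in>Z. f z) = (\<Sum>n\<in>S. \<Sum>a\<in>coprime_residues n. f (n, a))" for f :: "_ \<Rightarrow> real"
    unfolding Z_def using assms(1) by (simp add: sum.Sigma)
  have mass: "(\<Sum>z\<in>Z. measure lborel (A z)) = (\<Sum>n\<in>S. mass \<psi> n)"
    unfolding sumZ A_def using assms(2)
    by (simp add: measure_approx_interval card_coprime_residues mass_def mult_ac)
  have "(\<Sum>z\<in>Z. \<Sum>z'\<in>Z. measure lborel (A z \<inter> A z')) = (\<Sum>m\<in>S. \<Sum>n\<in>S. overlap \<psi> m n)"
    unfolding sumZ A_def overlap_def by (simp, intro sum.cong refl sum.swap)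
  then have "measure lborel (\<Union>z\<in>Z. A z) \<ge> 1 / C"
    using assms mass finZ
    by (intro measure_UN_ge_of_second_moment) (auto simp: A_def approx_interval_fmeasurable)
  also have "(\<Union>z\<in>Z. A z) = (\<Union>n\<in>S. approx_set \<psi> n)"
    by (auto simp: Z_def A_def approx_set_eq)
  finally show ?thesis .
qed

section \<open>Dyadic blocks and the limsup set\<close>

definition dyadic_block :: "nat \<Rightarrow> nat set" where
  "dyadic_block h = {n. 1 \<le> n \<and> 2 ^ h \<le> plog (plog (real n)) \<and> plog (plog (real n)) < 2 ^ Suc h}"

lemma plog_le: "x \<ge> 1 \<Longrightarrow> plog x \<le> x"
  unfolding plog_def using ln_le_minus_one[of x] by auto

lemma le_exp_of_ln_le: "0 < x \<Longrightarrow> ln x \<le> y \<Longrightarrow> x \<le> exp (y::real)"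
  by (metis exp_le_cancel_iff exp_ln)

text \<open>The bound \<open>h < n\<close> comes from
  \<open>2 ^ h \<le> plog (plog n) \<le> n\<close>; it pushes late blocks beyond any given index and
  lets the blocks below \<open>N\<close> cover all positive integers below \<open>N\<close>.\<close>

lemma dyadic_block_bounds:
  assumes "n \<in> dyadic_block h"
  shows "real n \<le> exp (exp (2 * 2 ^ h))" "h < n" "0 < n"
proof -
  have n: "1 \<le> n" "2 ^ h \<le> plog (plog (real n))" "plog (plog (real n)) < 2 ^ Suc h"
    using assms by (auto simp: dyadic_block_def)
  have p1: "plog x \<ge> 1" "ln x \<le> plog x" for x by (auto simp: plog_def)
  have "ln (plog (real n)) \<le> 2 * 2 ^ h" using p1(2)[of "plog (real n)"] n by simp
  then have "plog (real n) \<le> exp (2 * 2 ^ h)" using p1(1)[of "real n"] by (intro le_exp_of_ln_le) auto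
  then have "ln (real n) \<le> exp (2 * 2 ^ h)" using p1(2)[of "real n"] by linarith
  then show "real n \<le> exp (exp (2 * 2 ^ h))" using n le_exp_of_ln_le[of "real n" "exp (2 * 2 ^ h)"] by simp
  have "plog (plog (real n)) \<le> plog (real n)" by (intro plog_le p1)
  also have "\<dots> \<le> real n" using n by (intro plog_le) auto
  finally have "2 ^ h \<le> real n" using n by linarith
  then have "2 ^ h \<le> n" by (metis of_nat_le_iff of_nat_numeral of_nat_power)
  then show "h < n" using less_exp[of h] by linarith
  show "0 < n" using n by simp
qed

lemma finite_dyadic_block: "finite (dyadic_block h)"
proof (rule finite_subset)
  show "dyadic_block h \<subseteq> {..nat \<lfloor>exp (exp (2 * 2 ^ h)) :: real\<rfloor>}"
    using dyadic_block_bounds(1) by (auto intro: le_nat_floor)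
qed simp

lemma dyadic_block_disjoint: "h \<noteq> h' \<Longrightarrow> dyadic_block h \<inter> dyadic_block h' = {}"
proof (induction h h' rule: linorder_wlog)
  case (le a b)
  then have "(2::real) ^ Suc a \<le> 2 ^ b" by (intro power_increasing) auto
  then show ?case by (force simp: dyadic_block_def)
qed (simp add: Int_commute)

lemma ex_dyadic_block: "1 \<le> n \<Longrightarrow> \<exists>h. n \<in> dyadic_block h"
proof -
  assume "1 \<le> n"
  define x where "x = plog (plog (real n))"
  have "x \<ge> 1" by (simp add: x_def plog_def)
  obtain H where H: "x < 2 ^ H" using real_arch_pow[of 2 x] by auto
  define h where "h = (LEAST h. x < 2 ^ Suc h)"
  have ex: "x < 2 ^ Suc H" using H \<open>x \<ge> 1\<close> by simp
  have 1: "x < 2 ^ Suc h" unfolding h_def using ex by (rule LeastI)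
  have "2 ^ h \<le> x"
  proof (cases h)
    case 0 then show ?thesis using \<open>x \<ge> 1\<close> by simp
  next
    case (Suc k)
    then have "k < (LEAST h. x < 2 ^ Suc h)" by (simp add: h_def)
    then have "\<not> x < 2 ^ Suc k" by (rule not_less_Least)
    then show ?thesis using Suc by simp
  qed
  then show ?thesis using 1 \<open>1 \<le> n\<close> by (auto simp: dyadic_block_def x_def)
qed

abbreviation (input) weighted_term :: "(nat \<Rightarrow> real) \<Rightarrow> real \<Rightarrow> nat \<Rightarrow> real" where
  "weighted_term \<psi> \<epsilon> n \<equiv> \<psi> n * real (totient n) / (real n * (plog (plog (real n))) powr \<epsilon>)"

text \<open>Otherwise all late blocks have mass below \<open>2 ^ (\<epsilon> h / 2)\<close>, while
  the weight divides by at least \<open>2 ^ (\<epsilon> h)\<close>: the block sums are then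
  dominated by a convergent geometric series.\<close>

lemma infinitely_many_heavy_blocks:
  assumes \<psi>: "\<And>n. \<psi> n \<ge> 0" and "\<epsilon> > 0" "\<eta> \<le> \<epsilon> / 2" "\<eta> \<ge> 0"
    and div: "\<not> summable (\<lambda>n. weighted_term \<psi> \<epsilon> n)"
  shows "\<exists>h\<ge>h0. 2 ^ nat \<lfloor>\<eta> * real h\<rfloor> \<le> (\<Sum>n\<in>dyadic_block h. mass \<psi> n)"
proof (rule ccontr)
  assume neg: "\<not> ?thesis"
  define a where "a n = weighted_term \<psi> \<epsilon> n" for n
  define b where "b h = (\<Sum>n\<in>dyadic_block h. a n)" for h
  have a0: "a n \<ge> 0" for n using \<psi> by (simp add: a_def)
  have b0: "b h \<ge> 0" for h unfolding b_def by (intro sum_nonneg a0)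
  have ab: "a n \<le> mass \<psi> n / (2 powr \<epsilon>) ^ h" if n: "n \<in> dyadic_block h" for n h
  proof -
    have x: "2 ^ h \<le> plog (plog (real n))" using n by (simp add: dyadic_block_def)
    have "(2 powr \<epsilon>) ^ h = (2 ^ h) powr \<epsilon>" by (simp add: powr_powr mult.commute flip: powr_realpow)
    also have "\<dots> \<le> (plog (plog (real n))) powr \<epsilon>" using x assms by (intro powr_mono2) auto
    finally have le: "(2 powr \<epsilon>) ^ h \<le> (plog (plog (real n))) powr \<epsilon>" .
    have "a n = (mass \<psi> n / 2) / (plog (plog (real n))) powr \<epsilon>" by (simp add: a_def mass_def)
    also have "\<dots> \<le> (mass \<psi> n / 2) / (2 powr \<epsilon>) ^ h"
    proof (intro divide_left_mono mult_pos_pos le)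
      have "0 < (2 powr \<epsilon>) ^ h" by simp
      then show "0 < (2 powr \<epsilon>) ^ h" "0 < (plog (plog (real n))) powr \<epsilon>" using le by linarith+
    qed (use \<psi> mass_nonneg[of \<psi> n] in auto)
    also have "\<dots> \<le> mass \<psi> n / (2 powr \<epsilon>) ^ h"
      using \<psi> mass_nonneg[of \<psi> n] by (intro divide_right_mono) auto
    finally show ?thesis .
  qed
  have b_le: "b h \<le> (2 powr (- \<epsilon> / 2)) ^ h" if h: "h \<ge> h0" for h
  proof -
    have "b h \<le> (\<Sum>n\<in>dyadic_block h. mass \<psi> n / (2 powr \<epsilon>) ^ h)"
      unfolding b_def by (intro sum_mono ab)
    also have "\<dots> = (\<Sum>n\<in>dyadic_block h. mass \<psi> n) / (2 powr \<epsilon>) ^ h" by (simp add: sum_divide_distrib)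
    also have "\<dots> \<le> (2 powr (\<epsilon> / 2)) ^ h / (2 powr \<epsilon>) ^ h"
    proof (rule divide_right_mono)
      have "(\<Sum>n\<in>dyadic_block h. mass \<psi> n) \<le> 2 ^ nat \<lfloor>\<eta> * real h\<rfloor>" using neg h by force
      also have "\<dots> = 2 powr real (nat \<lfloor>\<eta> * real h\<rfloor>)" by (simp add: powr_realpow)
      also have "\<dots> \<le> 2 powr (\<epsilon> / 2 * real h)"
      proof (rule powr_mono)
        have "real (nat \<lfloor>\<eta> * real h\<rfloor>) \<le> \<eta> * real h" using assms by simp
        also have "\<dots> \<le> \<epsilon> / 2 * real h" using assms by (intro mult_right_mono) auto
        finally show "real (nat \<lfloor>\<eta> * real h\<rfloor>) \<le> \<epsilon> / 2 * real h" .
      qed simp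
      also have "\<dots> = (2 powr (\<epsilon> / 2)) ^ h" by (simp add: powr_powr flip: powr_realpow)
      finally show "(\<Sum>n\<in>dyadic_block h. mass \<psi> n) \<le> (2 powr (\<epsilon> / 2)) ^ h" .
    qed simp
    also have "\<dots> = (2 powr (- \<epsilon> / 2)) ^ h"
    proof -
      have "2 powr (\<epsilon> / 2) / 2 powr \<epsilon> = 2 powr (- \<epsilon> / 2)" by (simp flip: powr_diff)
      then show ?thesis by (simp flip: power_divide)
    qed
    finally show ?thesis .
  qed
  have "2 powr (- \<epsilon> / 2) < 1" using assms by (simp add: powr_less_one)
  then have "summable (\<lambda>h. (2 powr (- \<epsilon> / 2)) ^ h)" by (intro summable_geometric) auto
  then have sb: "summable b"
  proof (rule summable_comparison_test')
    fix h assume "h0 \<le> h"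
    then show "norm (b h) \<le> (2 powr (- \<epsilon> / 2)) ^ h" using b_le[of h] b0[of h] by (simp only: real_norm_def abs_of_nonneg)
  qed
  have "summable a"
  proof (rule summableI_nonneg_bounded[OF a0])
    fix N
    have sub: "{n. n < N \<and> 1 \<le> n} \<subseteq> (\<Union>h\<in>{..<N}. dyadic_block h)"
    proof safe
      fix n assume n: "n < N" "1 \<le> n"
      then obtain h where h: "n \<in> dyadic_block h" using ex_dyadic_block by blast
      then show "n \<in> (\<Union>h\<in>{..<N}. dyadic_block h)" using dyadic_block_bounds(2)[OF h] n by auto
    qed
    have "(\<Sum>n<N. a n) = (\<Sum>n | n < N \<and> 1 \<le> n. a n)"
      by (intro sum.mono_neutral_right) (auto simp: a_def)
    also have "\<dots> \<le> (\<Sum>n\<in>(\<Union>h\<in>{..<N}. dyadic_block h). a n)"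
      using sub a0 finite_dyadic_block by (intro sum_mono2) auto
    also have "\<dots> = (\<Sum>h<N. b h)"
      unfolding b_def using dyadic_block_disjoint finite_dyadic_block by (intro sum.UNION_disjoint) auto
    also have "\<dots> \<le> suminf b" using sb b0 by (intro sum_le_suminf) auto
    finally show "(\<Sum>n<N. a n) \<le> suminf b" .
  qed
  then show False using div unfolding a_def[abs_def] by contradiction
qed

text \<open>Every tail union contains the shrunken sets of some later heavy block, whose measure is
  at least \<open>1 / C\<close> with \<open>C\<close> independent of the block. Continuity from
  above passes this to the limsup set; \<open>bound\<close> confines all sets to
  \<open>{-1..2}\<close>, so the measures are finite.\<close>

lemma emeasure_limsup_approx_set_pos:
  assumes \<psi>: "\<And>n. \<psi> n \<ge> 0" and bound: "\<And>n. \<psi> n \<le> real n" and "\<epsilon> > 0"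
    and div: "\<not> summable (\<lambda>n. weighted_term \<psi> \<epsilon> n)"
  shows "emeasure lborel {x. infinite {n. 1 \<le> n \<and> x \<in> approx_set \<psi> n}} > 0"
proof -
  define \<eta> where "\<eta> = min 1 (\<epsilon> / 2)"
  have \<eta>: "0 < \<eta>" "\<eta> \<le> 1" "\<eta> \<le> \<epsilon> / 2" using assms(3) by (auto simp: \<eta>_def)
  obtain C h0 where C: "C \<ge> 1" and block: "\<forall>h\<ge>h0. \<forall>S \<psi>. finite S \<longrightarrow> (\<forall>n\<in>S. 0 < n \<and> real n \<le> exp (exp (2 * 2 ^ h)))
    \<longrightarrow> (\<forall>n. 0 \<le> \<psi> n) \<longrightarrow> 2 ^ nat \<lfloor>\<eta> * real h\<rfloor> \<le> (\<Sum>n\<in>S. mass \<psi> n)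
    \<longrightarrow> (\<exists>k\<in>{1..nat \<lfloor>\<eta> * real h\<rfloor>}. (\<Sum>m\<in>S. \<Sum>n\<in>S. overlap (\<lambda>n. \<psi> n / 2 ^ k) m n) \<le> C * (\<Sum>n\<in>S. mass \<psi> n / 2 ^ k)\<^sup>2)"
    using sum_overlap_block_le[OF \<eta>(1,2)] by (elim exE conjE) (rule that)
  define V where "V m = (\<Union>n\<in>{Suc m..}. approx_set \<psi> n)" for m
  have V: "V m \<in> sets borel" for m unfolding V_def by measurable
  have fin: "emeasure lborel (V m) < \<infinity>" for m
  proof -
    have "V m \<subseteq> {-1..2}"
      unfolding V_def using bound by (intro UN_least approx_set_subset) auto
    then have "emeasure lborel (V m) \<le> emeasure lborel {-1..2::real}" by (rule emeasure_mono) simp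
    also have "\<dots> < \<infinity>" by simp
    finally show ?thesis .
  qed
  have V_ge: "1 / C \<le> measure lborel (V m)" for m
  proof -
    obtain h where h: "h \<ge> max h0 m" "2 ^ nat \<lfloor>\<eta> * real h\<rfloor> \<le> (\<Sum>n\<in>dyadic_block h. mass \<psi> n)"
      using infinitely_many_heavy_blocks[OF \<psi> assms(3) \<eta>(3) less_imp_le[OF \<eta>(1)] div] by blast
    obtain k where k: "(\<Sum>m\<in>dyadic_block h. \<Sum>n\<in>dyadic_block h. overlap (\<lambda>n. \<psi> n / 2 ^ k) m n)
        \<le> C * (\<Sum>n\<in>dyadic_block h. mass \<psi> n / 2 ^ k)\<^sup>2"
      using block[rule_format, of h "dyadic_block h" \<psi>] h \<psi> finite_dyadic_block dyadic_block_bounds by auto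
    have "(0::real) < 2 ^ nat \<lfloor>\<eta> * real h\<rfloor>" by simp
    then have pos: "(\<Sum>n\<in>dyadic_block h. mass \<psi> n) > 0" using h(2) by linarith
    have "1 / C \<le> measure lborel (\<Union>n\<in>dyadic_block h. approx_set (\<lambda>n. \<psi> n / 2 ^ k) n)"
      using C \<psi> k pos finite_dyadic_block
      by (intro measure_UN_approx_set_ge) (auto simp: mass_scale simp flip: sum_divide_distrib)
    also have "\<dots> \<le> measure lborel (V m)"
    proof (rule measure_mono_fmeasurable)
      show "(\<Union>n\<in>dyadic_block h. approx_set (\<lambda>n. \<psi> n / 2 ^ k) n) \<subseteq> V m"
      proof (rule UN_least)
        fix n assume n: "n \<in> dyadic_block h"
        have "\<psi> n / 2 ^ k \<le> \<psi> n / 1" using \<psi> by (intro divide_left_mono) auto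
        then have "approx_set (\<lambda>n. \<psi> n / 2 ^ k) n \<subseteq> approx_set \<psi> n" by (intro approx_set_mono) simp
        moreover have "n \<in> {Suc m..}" using dyadic_block_bounds(2)[OF n] h(1) by simp
        ultimately show "approx_set (\<lambda>n. \<psi> n / 2 ^ k) n \<subseteq> V m" unfolding V_def by blast
      qed
      show "(\<Union>n\<in>dyadic_block h. approx_set (\<lambda>n. \<psi> n / 2 ^ k) n) \<in> sets lborel"
        using finite_dyadic_block[of h] by (intro sets.finite_UN) auto
      show "V m \<in> fmeasurable lborel" using V fin[of m] by (simp add: fmeasurable_def)
    qed
    finally show ?thesis .
  qed
  have V_eq: "emeasure lborel (V m) = ennreal (measure lborel (V m))" for m
    using fin[of m] by (intro emeasure_eq_ennreal_measure) auto
  have "(\<Inter>m. V m) = {x. infinite {n. 1 \<le> n \<and> x \<in> approx_set \<psi> n}}"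
  proof (intro equalityI subsetI)
    fix x assume x: "x \<in> (\<Inter>m. V m)"
    have "\<exists>n\<ge>m. n \<in> {n. 1 \<le> n \<and> x \<in> approx_set \<psi> n}" for m
      using x unfolding V_def by (auto dest!: spec[of _ m] intro: Suc_leD)
    then show "x \<in> {x. infinite {n. 1 \<le> n \<and> x \<in> approx_set \<psi> n}}"
      unfolding mem_Collect_eq[of x] infinite_nat_iff_unbounded_le by auto
  next
    fix x assume "x \<in> {x. infinite {n. 1 \<le> n \<and> x \<in> approx_set \<psi> n}}"
    then have "infinite {n. 1 \<le> n \<and> x \<in> approx_set \<psi> n}" by (rule CollectD)
    then have inf: "\<forall>m. \<exists>n>m. n \<in> {n. 1 \<le> n \<and> x \<in> approx_set \<psi> n}"
      by (rule infinite_nat_iff_unbounded[THEN iffD1])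
    show "x \<in> (\<Inter>m. V m)"
    proof
      fix m
      obtain n where "n > m" "x \<in> approx_set \<psi> n" using inf by blast
      then show "x \<in> V m" unfolding V_def by (intro UN_I[of n]) auto
    qed
  qed
  moreover have "emeasure lborel (\<Inter>m. V m) = (INF m. emeasure lborel (V m))"
  proof (rule INF_emeasure_decseq[symmetric])
    show "decseq V" unfolding decseq_def V_def by (intro allI impI UN_mono) auto
    show "emeasure lborel (V m) \<noteq> \<infinity>" for m using fin[of m] by simp
  qed (use V in auto)
  moreover have "\<dots> \<ge> ennreal (1 / C)"
    unfolding V_eq by (intro INF_greatest ennreal_leI V_ge)
  moreover have "ennreal (1 / C) > 0" using C by simp
  ultimately show ?thesis by (metis less_le_trans)
qed

section \<open>From positive to full measure\<close>

abbreviation (input) grid_cell :: "nat \<Rightarrow> int \<Rightarrow> real set" where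
  "grid_cell q i \<equiv> {of_int i / real q..<(of_int i + 1) / real q}"

lemma measure_real_affine_image:
  fixes c :: real
  assumes "c > 0"
  shows "measure lebesgue ((\<lambda>x. c * x + d) ` S) = c * measure lebesgue S"
  using measure_lebesgue_affine[of c d S] assms by simp

text \<open>
  Take a compact \<open>K \<subseteq> Z\<close> and an open \<open>U \<supseteq> K\<close> of almost the same measure. The cells of a fine grid that
  meet \<open>K\<close> lie in \<open>U\<close>, so they cannot all have small density.
\<close>
lemma exists_dense_cell:
  fixes Z :: "real set"
  assumes Z: "Z \<in> sets lebesgue" and pos: "emeasure lebesgue Z > 0" and \<eta>: "0 < \<eta>" "\<eta> < 1"
  shows "\<exists>q0>0. \<forall>q\<ge>q0. \<exists>i::int. measure lebesgue (Z \<inter> grid_cell q i) \<ge> (1 - \<eta>) / real q"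
proof -
  have "\<exists>N::nat. emeasure lebesgue (Z \<inter> {- real N..real N}) > 0"
  proof (rule ccontr)
    assume "\<not> ?thesis"
    then have "Z \<inter> {- real N..real N} \<in> null_sets lebesgue" for N using Z by (auto simp: null_sets_def not_less)
    then have "(\<Union>N. Z \<inter> {- real N..real N}) \<in> null_sets lebesgue" by (intro null_sets_UN) auto
    moreover have "(\<Union>N. Z \<inter> {- real N..real N}) = Z"
    proof (intro equalityI subsetI)
      fix x assume "x \<in> Z"
      obtain N :: nat where "\<bar>x\<bar> \<le> real N" using real_arch_simple by blast
      then have "x \<in> {- real N..real N}" by auto
      with \<open>x \<in> Z\<close> show "x \<in> (\<Union>N. Z \<inter> {- real N..real N})" by blast
    qed auto
    ultimately show False using pos by (simp add: null_sets_def)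
  qed
  then obtain N :: nat where N: "emeasure lebesgue (Z \<inter> {- real N..real N}) > 0" by blast
  define Y where "Y = Z \<inter> {- real N..real N}"
  have Y: "Y \<in> lmeasurable" unfolding Y_def using Z by (intro bounded_set_imp_lmeasurable) auto
  have "0 < emeasure lebesgue Y" using N by (simp only: Y_def)
  then have mY: "measure lebesgue Y > 0" by (simp only: emeasure_eq_measure2[OF Y] ennreal_less_zero_iff)
  obtain K where K: "closed K" "K \<subseteq> Y" "Y - K \<in> lmeasurable" "emeasure lebesgue (Y - K) < ennreal (measure lebesgue Y)"
    using sets_lebesgue_inner_closed[of Y "measure lebesgue Y"] Y mY by auto
  have "bounded K" by (rule bounded_subset[of "{- real N..real N}"]) (use K in \<open>auto simp: Y_def\<close>)
  then have cK: "compact K" using K by (simp add: compact_eq_bounded_closed)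
  then have mK: "K \<in> lmeasurable" by (rule lmeasurable_compact)
  have "measure lebesgue (Y - K) < measure lebesgue Y"
    using K(3,4) mY by (simp add: emeasure_eq_measure2 ennreal_less_iff)
  moreover have "measure lebesgue (Y - K) = measure lebesgue Y - measure lebesgue K"
    using K Y mK by (intro measurable_measure_Diff) auto
  ultimately have posK: "measure lebesgue K > 0" by simp
  \<comment> \<open>If all cells meeting \<open>K\<close> had density below
    \<open>1 - \<eta>\<close>, this choice would give \<open>K\<close> measure less than
    \<open>(1 - \<eta>) * (1 + \<eta>)\<close> times its own.\<close>
  define e where "e = measure lebesgue K * \<eta>"
  have e: "e > 0" using posK \<eta> by (simp add: e_def)
  obtain U where U: "open U" "K \<subseteq> U" "U - K \<in> lmeasurable" "emeasure lebesgue (U - K) < ennreal e"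
    using sets_lebesgue_outer_open[of K e] mK e by auto
  have U_eq: "U = K \<union> (U - K)" using U by auto
  then have mU: "U \<in> lmeasurable" using mK U by (metis fmeasurable.Un)
  have "measure lebesgue U = measure lebesgue K + measure lebesgue (U - K)"
    using U mK mU measurable_measure_Diff[of U lebesgue K] by (auto simp: fmeasurableD)
  moreover have "measure lebesgue (U - K) < e" using U(3,4) e by (simp add: emeasure_eq_measure2 ennreal_less_iff)
  ultimately have U_less: "measure lebesgue U < measure lebesgue K + e" by simp
  obtain \<delta> where \<delta>: "\<delta> > 0" "(\<Union>x\<in>K. ball x \<delta>) \<subseteq> U"
    using compact_subset_open_imp_ball_epsilon_subset[OF cK U(1,2)] by blast
  obtain q0 :: nat where q0: "1 / \<delta> < real q0" using reals_Archimedean2 by blast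
  have "\<exists>i::int. measure lebesgue (Z \<inter> grid_cell q i) \<ge> (1 - \<eta>) / real q"
    if q: "q \<ge> Suc q0" for q
  proof (rule ccontr)
    assume neg: "\<not> ?thesis"
    have qpos: "real q > 0" using q by simp
    have "1 / \<delta> < real q" using q q0 by linarith
    then have q\<delta>: "1 / real q < \<delta>" using \<delta>(1) qpos by (simp add: field_simps)
    define cell where "cell i = grid_cell q i" for i :: int
    define I where "I = {i. cell i \<inter> K \<noteq> {}}"
    have in_cell: "x \<in> cell \<lfloor>x * real q\<rfloor>" for x
    proof -
      have "of_int \<lfloor>x * real q\<rfloor> \<le> x * real q" "x * real q < of_int \<lfloor>x * real q\<rfloor> + 1" by linarith+
      then show ?thesis using qpos by (simp add: cell_def pos_divide_le_eq pos_less_divide_eq)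
    qed
    have cell_unique: "i = \<lfloor>x * real q\<rfloor>" if "x \<in> cell i" for x i
    proof -
      have "of_int i \<le> x * real q" "x * real q < of_int i + 1"
        using that qpos by (simp_all add: cell_def pos_divide_le_eq pos_less_divide_eq)
      then show ?thesis by linarith
    qed
    have mcell: "cell i \<in> lmeasurable" "measure lebesgue (cell i) = 1 / real q" for i
    proof -
      show "cell i \<in> lmeasurable" unfolding cell_def by (intro bounded_set_imp_lmeasurable) auto
      have "of_int i / real q \<le> (of_int i + 1) / real q" using qpos by (intro divide_right_mono) auto
      then have "measure lebesgue (cell i) = (of_int i + 1) / real q - of_int i / real q"
        by (simp add: cell_def measure_completion)
      then show "measure lebesgue (cell i) = 1 / real q" by (simp add: add_divide_distrib)
    qed
    have "I \<subseteq> {- int (N * q) - 1..int (N * q) + 1}"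
    proof
      fix i assume "i \<in> I"
      then obtain x where x: "x \<in> cell i" "x \<in> K" by (auto simp: I_def)
      have "x \<in> {- real N..real N}" using K(2) x(2) by (auto simp: Y_def)
      then have "\<bar>x\<bar> \<le> real N" by auto
      then have "\<bar>x * real q\<bar> \<le> real N * real q" using qpos by (simp add: abs_mult mult_right_mono)
      then have "- (real N * real q) \<le> x * real q" "x * real q \<le> real N * real q" by auto
      then have "- real (N * q) \<le> x * real q" "x * real q \<le> real (N * q)" by auto
      then show "i \<in> {- int (N * q) - 1..int (N * q) + 1}"
        unfolding cell_unique[OF x(1)] by (simp only: atLeastAtMost_iff) linarith
    qed
    then have finI: "finite I" by (rule finite_subset) simp
    have "K \<noteq> {}" using posK by auto
    then have "I \<noteq> {}" using in_cell by (auto simp: I_def)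
    have disj: "disjoint_family_on cell I"
      unfolding disjoint_family_on_def using cell_unique by blast
    have "(\<Union>i\<in>I. cell i) \<subseteq> U"
    proof
      fix y assume "y \<in> (\<Union>i\<in>I. cell i)"
      then obtain i x where ix: "y \<in> cell i" "x \<in> cell i" "x \<in> K" by (auto simp: I_def)
      then have "\<bar>x - y\<bar> < (of_int i + 1) / real q - of_int i / real q" unfolding cell_def by auto
      also have "\<dots> = 1 / real q" by (simp add: add_divide_distrib)
      finally have "y \<in> ball x \<delta>" using q\<delta> by (simp add: dist_real_def)
      then show "y \<in> U" using \<delta>(2) ix(3) by blast
    qed
    then have "measure lebesgue (\<Union>i\<in>I. cell i) \<le> measure lebesgue U"
      using mU mcell finI by (intro measure_mono_fmeasurable) (auto intro!: sets.finite_UN simp: fmeasurableD)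
    also have "measure lebesgue (\<Union>i\<in>I. cell i) = (\<Sum>i\<in>I. measure lebesgue (cell i))"
      using finI disj mcell(1) by (intro measure_finite_Union) (auto simp: fmeasurableD fmeasurableD2 simp del: emeasure_completion)
    finally have card: "real (card I) / real q \<le> measure lebesgue U" by (simp add: mcell)
    have "K \<subseteq> (\<Union>i\<in>I. K \<inter> cell i)" using in_cell by (auto simp: I_def)
    then have "measure lebesgue K \<le> measure lebesgue (\<Union>i\<in>I. K \<inter> cell i)"
      using mK mcell finI by (intro measure_mono_fmeasurable fmeasurable.finite_UN) (auto intro: fmeasurable.Int simp: fmeasurableD)
    also have "\<dots> \<le> (\<Sum>i\<in>I. measure lebesgue (K \<inter> cell i))"
      using mK mcell finI by (intro measure_UNION_le) (auto simp: fmeasurableD)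
    also have "\<dots> < (\<Sum>i\<in>I. (1 - \<eta>) / real q)"
    proof (intro sum_strict_mono finI \<open>I \<noteq> {}\<close>)
      fix i
      have "measure lebesgue (K \<inter> cell i) \<le> measure lebesgue (Z \<inter> cell i)"
      proof (rule measure_mono_fmeasurable)
        show "Z \<inter> cell i \<in> lmeasurable" using fmeasurable_Int_fmeasurable[OF mcell(1)] Z by (metis Int_commute)
        show "K \<inter> cell i \<subseteq> Z \<inter> cell i" using K by (auto simp: Y_def)
        show "K \<inter> cell i \<in> sets lebesgue" using mK mcell by (auto simp: fmeasurableD)
      qed
      also have "\<dots> < (1 - \<eta>) / real q" using neg by (auto simp: cell_def not_le)
      finally show "measure lebesgue (K \<inter> cell i) < (1 - \<eta>) / real q" .
    qed
    also have "\<dots> = (1 - \<eta>) * (real (card I) / real q)" by simp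
    also have "\<dots> \<le> (1 - \<eta>) * (measure lebesgue K + e)"
      using card U_less \<eta> by (intro mult_left_mono) auto
    also have "\<dots> = measure lebesgue K * (1 - \<eta>\<^sup>2)" by (simp add: e_def power2_eq_square algebra_simps)
    also have "\<dots> \<le> measure lebesgue K * 1" using posK by (intro mult_left_mono) auto
    finally show False by simp
  qed
  then show ?thesis by blast
qed

text \<open>Every fine grid has a cell of density at least \<open>1 - \<eta>\<close>; the hypothesis
  transfers this density to the unit interval, and \<eta> is arbitrary.\<close>

lemma full_measure_of_cells:
  fixes Z :: "real set"
  assumes Z: "Z \<in> sets lebesgue" and pos: "emeasure lebesgue Z > 0"
    and cells: "\<And>q0. \<exists>q\<ge>q0. q > 0 \<and> (\<forall>i::int. real q * measure lebesgue (Z \<inter> grid_cell q i) \<le> measure lebesgue (Z \<inter> {0..<1}))"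
  shows "measure lebesgue (Z \<inter> {0..<1}) = 1"
proof (rule antisym)
  have m01: "{0..<1::real} \<in> lmeasurable" by (intro bounded_set_imp_lmeasurable) auto
  have "measure lebesgue (Z \<inter> {0..<1}) \<le> measure lebesgue {0..<1::real}"
    using Z m01 by (intro measure_mono_fmeasurable) auto
  then show "measure lebesgue (Z \<inter> {0..<1}) \<le> 1" by (simp add: measure_completion)
  show "1 \<le> measure lebesgue (Z \<inter> {0..<1})"
  proof (rule field_le_epsilon)
    fix e :: real assume "e > 0"
    define \<eta> where "\<eta> = min e (1/2)"
    have \<eta>: "0 < \<eta>" "\<eta> < 1" "\<eta> \<le> e" using \<open>e > 0\<close> by (auto simp: \<eta>_def)
    obtain q0 where q0: "\<And>q. q \<ge> q0 \<Longrightarrow> \<exists>i::int. measure lebesgue (Z \<inter> grid_cell q i) \<ge> (1 - \<eta>) / real q"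
      using exists_dense_cell[OF Z pos \<eta>(1,2)] by blast
    obtain q where q: "q \<ge> q0" "q > 0" "\<And>i::int. real q * measure lebesgue (Z \<inter> grid_cell q i) \<le> measure lebesgue (Z \<inter> {0..<1})"
      using cells[of q0] by blast
    obtain i :: int where i: "measure lebesgue (Z \<inter> grid_cell q i) \<ge> (1 - \<eta>) / real q"
      using q0[OF q(1)] by blast
    have "1 - \<eta> = real q * ((1 - \<eta>) / real q)" using q by simp
    also have "\<dots> \<le> real q * measure lebesgue (Z \<inter> grid_cell q i)"
      using i by (intro mult_left_mono) auto
    also have "\<dots> \<le> measure lebesgue (Z \<inter> {0..<1})" by (rule q)
    finally show "1 \<le> measure lebesgue (Z \<inter> {0..<1}) + e" using \<eta> by linarith
  qed
qed

lemma periodic_of_int: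
  fixes Z :: "real set"
  assumes "\<And>x. x + 1 \<in> Z \<longleftrightarrow> x \<in> Z"
  shows "x + of_int k \<in> Z \<longleftrightarrow> x \<in> Z"
proof (induction k arbitrary: x rule: int_induct[of _ 0])
  case (step1 i)
  then show ?case using assms[of "x + of_int i"] by (simp add: add.assoc)
next
  case (step2 i)
  then show ?case using assms[of "x + of_int (i - 1)"] by (simp add: add.assoc)
qed simp

lemma measure_periodic_translate:
  fixes Z :: "real set"
  assumes Z: "Z \<in> sets lebesgue" and per: "\<And>x. x + 1 \<in> Z \<longleftrightarrow> x \<in> Z"
  shows "measure lebesgue (Z \<inter> {c..<c + 1}) = measure lebesgue (Z \<inter> {0..<1})"
proof -
  define j where "j = \<lfloor>c\<rfloor>"
  have j: "of_int j \<le> c" "c < of_int j + 1" by (auto simp: j_def)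
  have lm: "Z \<inter> {a..<b} \<in> lmeasurable" for a b :: real
    using Z by (intro bounded_set_imp_lmeasurable) auto
  have split: "measure lebesgue (Z \<inter> {a..<d}) = measure lebesgue (Z \<inter> {a..<b}) + measure lebesgue (Z \<inter> {b..<d})"
    if "a \<le> b" "b \<le> d" for a b d
  proof -
    have "Z \<inter> {a..<d} = (Z \<inter> {a..<b}) \<union> (Z \<inter> {b..<d})" using that by auto
    moreover have "measure lebesgue ((Z \<inter> {a..<b}) \<union> (Z \<inter> {b..<d})) = measure lebesgue (Z \<inter> {a..<b}) + measure lebesgue (Z \<inter> {b..<d})"
      using lm[of a b] lm[of b d] by (intro measure_Union) (auto simp: fmeasurableD fmeasurableD2 simp del: emeasure_completion)
    ultimately show ?thesis by simp
  qed
  have shift: "measure lebesgue (Z \<inter> {a..<b}) = measure lebesgue (Z \<inter> {a + of_int k..<b + of_int k})" for a b k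
  proof -
    have "Z \<inter> {a + of_int k..<b + of_int k} = (\<lambda>x. 1 * x + of_int k) ` (Z \<inter> {a..<b})"
    proof (intro equalityI subsetI)
      fix x assume x: "x \<in> Z \<inter> {a + of_int k..<b + of_int k}"
      then have "x - of_int k \<in> Z" using periodic_of_int[OF per, of "x - of_int k" k] by simp
      then show "x \<in> (\<lambda>x. 1 * x + of_int k) ` (Z \<inter> {a..<b})" using x by (intro image_eqI[of _ _ "x - of_int k"]) auto
    next
      fix x assume "x \<in> (\<lambda>x. 1 * x + of_int k) ` (Z \<inter> {a..<b})"
      then show "x \<in> Z \<inter> {a + of_int k..<b + of_int k}" using periodic_of_int[OF per] by auto
    qed
    then show ?thesis using measure_real_affine_image[of 1 "of_int k" "Z \<inter> {a..<b}"] by simp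
  qed
  have "measure lebesgue (Z \<inter> {c..<c + 1})
      = measure lebesgue (Z \<inter> {c..<of_int j + 1}) + measure lebesgue (Z \<inter> {of_int j + 1..<c + 1})"
    using j by (intro split) auto
  also have "measure lebesgue (Z \<inter> {of_int j + 1..<c + 1}) = measure lebesgue (Z \<inter> {of_int j..<c})"
    using shift[of "of_int j" c 1] by simp
  also have "measure lebesgue (Z \<inter> {c..<of_int j + 1}) + \<dots> = measure lebesgue (Z \<inter> {of_int j..<of_int j + 1})"
    using j split[of "of_int j" c "of_int j + 1"] by simp
  also have "\<dots> = measure lebesgue (Z \<inter> {0..<1})"
    using shift[of 0 1 j] by (simp add: add.commute)
  finally show ?thesis .
qed

text \<open>The iterate of order \<open>q0\<close> has the form \<open>q * x + r\<close> with
  \<open>q = p ^ q0\<close>. It blows a cell of length \<open>1/q\<close> up to an interval of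
  length 1 and keeps \<open>Z\<close> inside \<open>Z\<close>; by periodicity every unit interval
  carries the same measure.\<close>

lemma full_measure_of_expanding:
  fixes Z :: "real set"
  assumes bZ: "Z \<in> sets borel" and pos: "emeasure lebesgue Z > 0" and per: "\<And>x. x + 1 \<in> Z \<longleftrightarrow> x \<in> Z"
    and p: "p \<ge> 2" and inv: "\<And>x. x \<in> Z \<Longrightarrow> real p * x + s \<in> Z"
  shows "measure lebesgue (Z \<inter> {0..<1}) = 1"
proof (rule full_measure_of_cells[OF _ pos])
  show Z: "Z \<in> sets lebesgue" using bZ by (simp add: sets_completionI_sets)
  fix q0
  define q where "q = p ^ q0"
  have "q0 \<le> 2 ^ q0" using less_exp[of q0] by simp
  also have "\<dots> \<le> q" unfolding q_def using p by (intro power_mono) auto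
  finally have "q \<ge> q0" .
  have q: "q > 0" using p by (simp add: q_def)
  have "\<exists>r. \<forall>x\<in>Z. real (p ^ k) * x + r \<in> Z" for k
  proof (induction k)
    case 0
    show ?case by (intro exI[of _ 0]) simp
  next
    case (Suc k)
    then obtain r where "\<forall>x\<in>Z. real (p ^ k) * x + r \<in> Z" by blast
    then have "real p * (real (p ^ k) * x + r) + s \<in> Z" if "x \<in> Z" for x using inv that by blast
    then show ?case by (intro exI[of _ "real p * r + s"]) (simp add: algebra_simps)
  qed
  then obtain r where r: "\<And>x. x \<in> Z \<Longrightarrow> real q * x + r \<in> Z" unfolding q_def by blast
  have "real q * measure lebesgue (Z \<inter> grid_cell q i) \<le> measure lebesgue (Z \<inter> {0..<1})" for i :: int
  proof -
    have "real q * measure lebesgue (Z \<inter> grid_cell q i)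
        = measure lebesgue ((\<lambda>x. real q * x + r) ` (Z \<inter> grid_cell q i))"
      using q by (simp add: measure_real_affine_image)
    also have "\<dots> \<le> measure lebesgue (Z \<inter> {of_int i + r..<of_int i + r + 1})"
    proof (rule measure_mono_fmeasurable)
      show "(\<lambda>x. real q * x + r) ` (Z \<inter> grid_cell q i) \<subseteq> Z \<inter> {of_int i + r..<of_int i + r + 1}"
        using r q by (auto simp: field_simps)
      show "Z \<inter> {of_int i + r..<of_int i + r + 1} \<in> lmeasurable"
        using Z by (intro bounded_set_imp_lmeasurable) auto
      have "(\<lambda>x. real q * x + r) ` (Z \<inter> grid_cell q i)
          = (\<lambda>y. (y - r) / real q) -` (Z \<inter> grid_cell q i)"
        using q by (auto simp: image_iff intro!: bexI[of _ "(_ - r) / real q"])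
      also have "\<dots> \<in> sets borel"
        using measurable_sets[of "\<lambda>y. (y - r) / real q" borel borel "Z \<inter> grid_cell q i"] bZ by simp
      finally show "(\<lambda>x. real q * x + r) ` (Z \<inter> grid_cell q i) \<in> sets lebesgue"
        by (simp add: sets_completionI_sets)
    qed
    also have "\<dots> = measure lebesgue (Z \<inter> {0..<1})" using Z per by (rule measure_periodic_translate)
    finally show ?thesis .
  qed
  with \<open>q \<ge> q0\<close> q show "\<exists>q\<ge>q0. q > 0 \<and> (\<forall>i::int. real q * measure lebesgue (Z \<inter> grid_cell q i) \<le> measure lebesgue (Z \<inter> {0..<1}))"
    by blast
qed

text \<open>For a large prime \<open>q\<close>, the invariance under \<open>1/q\<close> gives all
  cells of the grid equal measure. The inverse translation is available as well:
  \<open>q - 1\<close> further steps complete a period.\<close>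

lemma full_measure_of_prime_translations:
  fixes Z :: "real set"
  assumes Z: "Z \<in> sets lebesgue" and pos: "emeasure lebesgue Z > 0" and per: "\<And>x. x + 1 \<in> Z \<longleftrightarrow> x \<in> Z"
    and inv: "\<And>x (p::nat). prime p \<Longrightarrow> x \<in> Z \<Longrightarrow> x + 1 / real p \<in> Z"
  shows "measure lebesgue (Z \<inter> {0..<1}) = 1"
proof (rule full_measure_of_cells[OF Z pos])
  fix q0 :: nat
  obtain q :: nat where q: "prime q" "q > q0" using bigger_prime[of q0] by blast
  have q0: "real q > 0" using q by (simp add: prime_gt_0_nat)
  have lm: "Z \<inter> {a..<b} \<in> lmeasurable" for a b :: real
    using Z by (intro bounded_set_imp_lmeasurable) auto
  have fwd: "x + real k / real q \<in> Z" if "x \<in> Z" for x k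
  proof (induction k)
    case (Suc k)
    then show ?case using inv[OF q(1) Suc] by (simp add: add_divide_distrib algebra_simps)
  qed (use that in simp)
  have iff: "x + 1 / real q \<in> Z \<longleftrightarrow> x \<in> Z" for x
  proof
    assume "x + 1 / real q \<in> Z"
    then have "x + 1 / real q + real (q - 1) / real q \<in> Z" by (rule fwd)
    also have "x + 1 / real q + real (q - 1) / real q = x + 1" using q0 by (simp add: field_simps of_nat_diff)
    finally show "x \<in> Z" by (simp add: per)
  qed (rule inv[OF q(1)])
  define c where "c i = measure lebesgue (Z \<inter> grid_cell q i)" for i :: int
  have step: "c (i + 1) = c i" for i
  proof -
    have "Z \<inter> {of_int (i + 1) / real q..<(of_int (i + 1) + 1) / real q}
        = (\<lambda>x. 1 * x + 1 / real q) ` (Z \<inter> grid_cell q i)"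
    proof (intro equalityI subsetI)
      fix x assume x: "x \<in> Z \<inter> {of_int (i + 1) / real q..<(of_int (i + 1) + 1) / real q}"
      then have "x - 1 / real q \<in> Z" using iff[of "x - 1 / real q"] by simp
      then show "x \<in> (\<lambda>x. 1 * x + 1 / real q) ` (Z \<inter> grid_cell q i)"
        using x by (intro image_eqI[of _ _ "x - 1 / real q"]) (auto simp: add_divide_distrib)
    next
      fix x assume "x \<in> (\<lambda>x. 1 * x + 1 / real q) ` (Z \<inter> grid_cell q i)"
      then show "x \<in> Z \<inter> {of_int (i + 1) / real q..<(of_int (i + 1) + 1) / real q}"
        using iff by (auto simp: add_divide_distrib)
    qed
    then show ?thesis
      unfolding c_def using measure_real_affine_image[of 1 "1 / real q" "Z \<inter> grid_cell q i"] by simp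
  qed
  have same: "c (i + int k) = c i" for i k
  proof (induction k)
    case (Suc k)
    then show ?case using step[of "i + int k"] by (simp add: add.assoc add.commute[of 1])
  qed simp
  have sum: "measure lebesgue (Z \<inter> {of_int i / real q..<(of_int i + real k) / real q}) = real k * c i" for i :: int and k :: nat
  proof (induction k)
    case (Suc k)
    have le: "of_int i / real q \<le> (of_int i + real k) / real q" "(of_int i + real k) / real q \<le> (of_int i + real (Suc k)) / real q"
      using q0 by (auto intro: divide_right_mono)
    have "Z \<inter> {of_int i / real q..<(of_int i + real (Suc k)) / real q}
        = (Z \<inter> {of_int i / real q..<(of_int i + real k) / real q}) \<union> (Z \<inter> {(of_int i + real k) / real q..<(of_int i + real (Suc k)) / real q})"
      using le by auto
    then have "measure lebesgue (Z \<inter> {of_int i / real q..<(of_int i + real (Suc k)) / real q})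
       = measure lebesgue (Z \<inter> {of_int i / real q..<(of_int i + real k) / real q}) + measure lebesgue (Z \<inter> {(of_int i + real k) / real q..<(of_int i + real (Suc k)) / real q})"
      using lm[of "of_int i / real q" "(of_int i + real k) / real q"] lm[of "(of_int i + real k) / real q" "(of_int i + real (Suc k)) / real q"]
      by (simp only:) (intro measure_Union, auto simp: fmeasurableD fmeasurableD2 simp del: emeasure_completion)
    also have "measure lebesgue (Z \<inter> {(of_int i + real k) / real q..<(of_int i + real (Suc k)) / real q}) = c (i + int k)"
      by (simp add: c_def add_ac)
    finally show ?case using Suc same by (simp add: algebra_simps)
  qed simp
  have "real q * c i = measure lebesgue (Z \<inter> {0..<1})" for i
  proof -
    have "real q * c i = measure lebesgue (Z \<inter> {of_int i / real q..<of_int i / real q + 1})"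
      using sum[of i q] q0 by (simp add: add_divide_distrib)
    also have "\<dots> = measure lebesgue (Z \<inter> {0..<1})" using Z per by (rule measure_periodic_translate)
    finally show ?thesis .
  qed
  then show "\<exists>q\<ge>q0. q > 0 \<and> (\<forall>i::int. real q * measure lebesgue (Z \<inter> grid_cell q i) \<le> measure lebesgue (Z \<inter> {0..<1}))"
    using q unfolding c_def by (intro exI[of _ q]) (auto simp: prime_gt_0_nat)
qed

section \<open>Limsup sets on the line and their invariance\<close>

text \<open>The periodic lift of the set of approximable points to the whole line: numerators run
  over all integers, so affine maps can act on them.\<close>

definition reduced_nbhd :: "(nat \<Rightarrow> real) \<Rightarrow> nat \<Rightarrow> real set" where
  "reduced_nbhd \<psi> n = {x. \<exists>a::int. coprime a (int n) \<and> \<bar>x - of_int a / real n\<bar> < \<psi> n / real n}"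

definition limsup_nbhd :: "(nat \<Rightarrow> real) \<Rightarrow> nat set \<Rightarrow> real set" where
  "limsup_nbhd \<psi> A = {x. infinite {n\<in>A. x \<in> reduced_nbhd \<psi> n}}"

text \<open>An expanding map multiplies the radius by \<open>p\<close>; the union over all
  \<open>2 ^ j\<close> absorbs this and becomes invariant.\<close>

definition dilated_limsup :: "(nat \<Rightarrow> real) \<Rightarrow> nat set \<Rightarrow> real set" where
  "dilated_limsup \<psi> A = (\<Union>j::nat. limsup_nbhd (\<lambda>n. 2 ^ j * \<psi> n) A)"

lemma coprime_add_mult_iff: "coprime (a + k * n) n \<longleftrightarrow> coprime a (n::int)"
  by (metis coprime_iff_gcd_eq_1 gcd.commute gcd_add_mult add.commute)

lemma mem_reduced_nbhd_iff:
  assumes "n \<ge> 1"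
  shows "(\<exists>k::int. x + of_int k \<in> approx_set \<psi> n) \<longleftrightarrow> x \<in> reduced_nbhd \<psi> n"
proof
  assume "\<exists>k::int. x + of_int k \<in> approx_set \<psi> n"
  then obtain k :: int and a where a: "gcd a n = 1"
    "(real a - \<psi> n) / real n < x + of_int k" "x + of_int k < (real a + \<psi> n) / real n"
    unfolding approx_set_def by auto
  have "coprime a n" using a(1) by (simp only: coprime_iff_gcd_eq_1)
  then have "coprime (int a) (int n)" by simp
  then have "coprime (int a + (- k) * int n) (int n)" by (simp only: coprime_add_mult_iff)
  then have "coprime (int a - k * int n) (int n)" by simp
  moreover have "\<bar>x - of_int (int a - k * int n) / real n\<bar> < \<psi> n / real n"
    using a(2,3) assms by (simp add: diff_divide_distrib add_divide_distrib abs_less_iff)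
  ultimately show "x \<in> reduced_nbhd \<psi> n" unfolding reduced_nbhd_def by blast
next
  assume "x \<in> reduced_nbhd \<psi> n"
  then obtain a :: int where a: "coprime a (int n)" "\<bar>x - of_int a / real n\<bar> < \<psi> n / real n"
    unfolding reduced_nbhd_def by blast
  \<comment> \<open>The shift by one before and after the reduction selects the representative in
    \<open>1..n\<close> instead of \<open>0..n-1\<close>.\<close>
  define r k where "r = (a - 1) mod int n + 1" and "k = - ((a - 1) div int n)"
  have ra: "r = a + k * int n" unfolding r_def k_def using div_mult_mod_eq[of "a - 1" "int n"] by (simp add: algebra_simps)
  have "int n > 0" using assms by simp
  then have r: "1 \<le> r" "r \<le> int n"
    using pos_mod_sign[of "int n" "a - 1"] pos_mod_bound[of "int n" "a - 1"] unfolding r_def by linarith+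
  have "coprime r (int n)" using a(1) unfolding ra by (simp only: coprime_add_mult_iff)
  then have "coprime (int (nat r)) (int n)" using r by simp
  then have "coprime (nat r) n" by (simp only: coprime_int_iff)
  then have "gcd (nat r) n = 1" by (simp only: coprime_iff_gcd_eq_1)
  moreover have "(real (nat r) - \<psi> n) / real n < x + of_int k \<and> x + of_int k < (real (nat r) + \<psi> n) / real n"
  proof -
    have "real (nat r) / real n = of_int a / real n + of_int k"
      using r assms by (simp add: ra add_divide_distrib)
    then show ?thesis using a(2) by (simp add: diff_divide_distrib add_divide_distrib abs_less_iff)
  qed
  moreover have "1 \<le> nat r" "nat r \<le> n" using r by auto
  ultimately have "x + of_int k \<in> approx_set \<psi> n" unfolding approx_set_def by fastforce
  then show "\<exists>k::int. x + of_int k \<in> approx_set \<psi> n" ..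
qed

lemma W_eq: "W \<psi> = limsup_nbhd \<psi> {1..} \<inter> {0..1}"
proof -
  have "{n. 1 \<le> n \<and> (\<exists>k::int. x + of_int k \<in> approx_set \<psi> n)} = {n\<in>{1..}. x \<in> reduced_nbhd \<psi> n}" for x
    using mem_reduced_nbhd_iff by auto
  then show ?thesis by (auto simp: W_def limsup_nbhd_def)
qed

lemma reduced_nbhd_mono:
  assumes "\<psi> n \<le> \<psi>' n"
  shows "reduced_nbhd \<psi> n \<subseteq> reduced_nbhd \<psi>' n"
  using divide_right_mono[OF assms, of "real n"] unfolding reduced_nbhd_def by force

lemma open_reduced_nbhd: "open (reduced_nbhd \<psi> n)"
proof -
  have "reduced_nbhd \<psi> n = (\<Union>a\<in>{a. coprime a (int n)}. ball (of_int a / real n) (\<psi> n / real n))"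
    unfolding reduced_nbhd_def by (auto simp: dist_real_def abs_minus_commute)
  then show ?thesis by auto
qed

lemma limsup_nbhd_eq: "limsup_nbhd \<psi> A = (\<Inter>m. \<Union>n\<in>A \<inter> {m..}. reduced_nbhd \<psi> n)"
proof (intro equalityI subsetI)
  fix x assume "x \<in> limsup_nbhd \<psi> A"
  then have "\<forall>m. \<exists>n\<ge>m. n \<in> {n\<in>A. x \<in> reduced_nbhd \<psi> n}"
    unfolding limsup_nbhd_def by (intro infinite_nat_iff_unbounded_le[THEN iffD1]) (rule CollectD)
  then show "x \<in> (\<Inter>m. \<Union>n\<in>A \<inter> {m..}. reduced_nbhd \<psi> n)" by force
next
  fix x assume "x \<in> (\<Inter>m. \<Union>n\<in>A \<inter> {m..}. reduced_nbhd \<psi> n)"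
  then have "\<forall>m. \<exists>n\<ge>m. n \<in> {n\<in>A. x \<in> reduced_nbhd \<psi> n}" by force
  then show "x \<in> limsup_nbhd \<psi> A"
    unfolding limsup_nbhd_def by (intro CollectI infinite_nat_iff_unbounded_le[THEN iffD2])
qed

lemma borel_limsup_nbhd: "limsup_nbhd \<psi> A \<in> sets borel"
  unfolding limsup_nbhd_eq by (intro sets.countable_INT') (auto intro!: borel_open open_UN open_reduced_nbhd)

lemma borel_dilated_limsup: "dilated_limsup \<psi> A \<in> sets borel"
  unfolding dilated_limsup_def by (intro sets.countable_UN) (auto intro: borel_limsup_nbhd)

lemma limsup_nbhd_mapI:
  assumes "x \<in> limsup_nbhd \<psi> A"
    and "finite {n\<in>A. \<not> Q n}"
    and "\<And>n. n \<in> A \<Longrightarrow> Q n \<Longrightarrow> x \<in> reduced_nbhd \<psi> n \<Longrightarrow> n \<in> B \<and> y \<in> reduced_nbhd \<psi>' n"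
  shows "y \<in> limsup_nbhd \<psi>' B"
proof -
  have "infinite ({n\<in>A. x \<in> reduced_nbhd \<psi> n} - {n\<in>A. \<not> Q n})"
    using assms(1,2) unfolding limsup_nbhd_def by (intro Diff_infinite_finite) auto
  moreover have "{n\<in>A. x \<in> reduced_nbhd \<psi> n} - {n\<in>A. \<not> Q n} \<subseteq> {n\<in>B. y \<in> reduced_nbhd \<psi>' n}"
    using assms(3) by blast
  ultimately show ?thesis unfolding limsup_nbhd_def using infinite_super by blast
qed

text \<open>The map carries the centre \<open>a / n\<close> to \<open>(p * a + b) / n\<close> and
  multiplies distances by \<open>p\<close>; only coprimality of the new numerator has to be
  assumed.\<close>

lemma reduced_nbhd_shift:
  assumes "n \<ge> 1" "x \<in> reduced_nbhd \<psi> n" "\<And>a::int. coprime a (int n) \<Longrightarrow> coprime (int p * a + b) (int n)"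
  shows "real p * x + of_int b / real n \<in> reduced_nbhd (\<lambda>n. real p * \<psi> n) n \<or> p = 0"
proof (cases "p = 0")
  case False
  obtain a :: int where a: "coprime a (int n)" "\<bar>x - of_int a / real n\<bar> < \<psi> n / real n"
    using assms(2) unfolding reduced_nbhd_def by blast
  have "real p * x + of_int b / real n - of_int (int p * a + b) / real n = real p * (x - of_int a / real n)"
    by (simp add: add_divide_distrib algebra_simps)
  then have "\<bar>real p * x + of_int b / real n - of_int (int p * a + b) / real n\<bar> = real p * \<bar>x - of_int a / real n\<bar>"
    by (simp add: abs_mult)
  also have "\<dots> < real p * (\<psi> n / real n)" using a(2) False by (intro mult_strict_left_mono) auto
  finally have "\<bar>real p * x + of_int b / real n - of_int (int p * a + b) / real n\<bar> < real p * \<psi> n / real n" by simp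
  with assms(3)[OF a(1)] show ?thesis unfolding reduced_nbhd_def by blast
qed simp

lemma coprimeI_prime_int:
  fixes a b :: int
  assumes "\<And>r. prime r \<Longrightarrow> r dvd a \<Longrightarrow> r dvd b \<Longrightarrow> False" "b \<noteq> 0"
  shows "coprime a b"
proof (rule ccontr)
  assume "\<not> coprime a b"
  then have "gcd a b \<noteq> 1" by (simp only: coprime_iff_gcd_eq_1 simp_thms)
  then have "\<not> is_unit (gcd a b)" by simp
  moreover have "gcd a b \<noteq> 0" using assms(2) by simp
  ultimately obtain r where "r dvd gcd a b" "prime r" using prime_divisorE by blast
  then show False using assms(1) dvd_trans[OF _ gcd_dvd1] dvd_trans[OF _ gcd_dvd2] by blast
qed

lemma coprime_shift_not_dvd:
  fixes a :: int and n p :: nat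
  assumes "prime p" "\<not> p dvd n" "coprime a (int n)"
  shows "coprime (int p * a + 0) (int n)"
proof -
  have "coprime p n" using assms by (simp add: prime_imp_coprime)
  then have "coprime (int p) (int n)" by simp
  then show ?thesis using assms(3) by simp
qed

text \<open>Here \<open>p * a\<close> alone shares the factor \<open>p\<close> with
  \<open>n\<close>; adding \<open>m = n / p\<close> repairs this, as \<open>p\<close> does not
  divide \<open>m\<close>, and shifts the point by \<open>1 / p\<close>. The other primes of
  \<open>n\<close> divide \<open>m\<close> and therefore see only \<open>p * a\<close>.\<close>

lemma coprime_shift_exactly:
  fixes a :: int and n p m :: nat
  assumes "prime p" "n = p * m" "\<not> p dvd m" "n > 0" "coprime a (int n)"
  shows "coprime (int p * a + int m) (int n)"
proof (rule coprimeI_prime_int)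
  fix r :: int assume r: "prime r" "r dvd int p * a + int m" "r dvd int n"
  have pp: "prime (int p)" using assms(1) by simp
  have "r dvd int p \<or> r dvd int m" using r(1,3) assms(2) by (simp add: prime_dvd_mult_iff)
  then show False
  proof
    assume "r dvd int p"
    then have "r = int p" using r(1) pp by (simp add: primes_dvd_imp_eq)
    then have "int p dvd int p * a + int m - int p * a" using r(2) by (intro dvd_diff) auto
    then show False using assms(3) by simp
  next
    assume rm: "r dvd int m"
    then have "r dvd int p * a" using r(2) by (metis dvd_add_left_iff)
    then have "r dvd int p \<or> r dvd a" using r(1) by (simp add: prime_dvd_mult_iff)
    then show False
    proof
      assume "r dvd int p"
      then have "r = int p" using r(1) pp by (simp add: primes_dvd_imp_eq)
      then show False using rm assms(3) by simp
    next
      assume "r dvd a"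
      then show False using r(1,3) assms(5) coprime_common_divisor not_prime_unit by blast
    qed
  qed
qed (use assms in auto)

text \<open>Every prime factor of \<open>n\<close> also divides \<open>m\<close>, so adding
  \<open>m\<close> leaves the numerator unchanged modulo each of them.\<close>

lemma coprime_shift_square:
  fixes a :: int and n q m :: nat
  assumes "prime q" "n = q * m" "q dvd m" "n > 0" "coprime a (int n)"
  shows "coprime (int 1 * a + int m) (int n)"
proof (rule coprimeI_prime_int)
  fix r :: int assume r: "prime r" "r dvd int 1 * a + int m" "r dvd int n"
  have "r dvd int q \<or> r dvd int m" using r(1,3) assms(2) by (simp add: prime_dvd_mult_iff)
  moreover have "int q dvd int m" using assms(3) by simp
  ultimately have "r dvd int m" using dvd_trans by blast
  then have "r dvd a" using r(2) by (simp add: dvd_add_left_iff)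
  then show False using r(1,3) assms(5) coprime_common_divisor not_prime_unit by blast
qed (use assms in auto)

lemma dilated_limsup_periodic:
  assumes "A \<subseteq> {1..}"
  shows "x + 1 \<in> dilated_limsup \<psi> A \<longleftrightarrow> x \<in> dilated_limsup \<psi> A"
proof -
  have "x + 1 \<in> reduced_nbhd \<phi> n \<longleftrightarrow> x \<in> reduced_nbhd \<phi> n" if "n \<ge> 1" for \<phi> n x
  proof -
    have "x + 1 \<in> reduced_nbhd \<phi> n \<longleftrightarrow> (\<exists>k::int. (x + 1) + of_int k \<in> approx_set \<phi> n)"
      using mem_reduced_nbhd_iff[OF that] by simp
    also have "\<dots> \<longleftrightarrow> (\<exists>k::int. x + of_int k \<in> approx_set \<phi> n)"
    proof
      assume "\<exists>k::int. (x + 1) + of_int k \<in> approx_set \<phi> n"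
      then obtain k :: int where "(x + 1) + of_int k \<in> approx_set \<phi> n" ..
      then show "\<exists>k::int. x + of_int k \<in> approx_set \<phi> n" by (intro exI[of _ "k + 1"]) (simp add: add_ac)
    next
      assume "\<exists>k::int. x + of_int k \<in> approx_set \<phi> n"
      then obtain k :: int where "x + of_int k \<in> approx_set \<phi> n" ..
      then show "\<exists>k::int. (x + 1) + of_int k \<in> approx_set \<phi> n" by (intro exI[of _ "k - 1"]) simp
    qed
    also have "\<dots> \<longleftrightarrow> x \<in> reduced_nbhd \<phi> n" using mem_reduced_nbhd_iff[OF that] by simp
    finally show ?thesis .
  qed
  then have "{n\<in>A. x + 1 \<in> reduced_nbhd \<phi> n} = {n\<in>A. x \<in> reduced_nbhd \<phi> n}" for \<phi> using assms by auto
  then show ?thesis unfolding dilated_limsup_def limsup_nbhd_def by simp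
qed

lemma dilated_limsup_expanding:
  assumes "A \<subseteq> {1..}" "p > 0" "\<And>n. \<psi> n \<ge> 0" "x \<in> dilated_limsup \<psi> A"
    and "\<And>n. n \<in> A \<Longrightarrow> of_int (b n) / real n = s"
    and "\<And>n (a::int). n \<in> A \<Longrightarrow> coprime a (int n) \<Longrightarrow> coprime (int p * a + b n) (int n)"
  shows "real p * x + s \<in> dilated_limsup \<psi> A"
proof -
  obtain j :: nat where j: "x \<in> limsup_nbhd (\<lambda>n. 2 ^ j * \<psi> n) A" using assms(4) by (auto simp: dilated_limsup_def)
  have "real p * x + s \<in> limsup_nbhd (\<lambda>n. 2 ^ (j + p) * \<psi> n) A"
  proof (rule limsup_nbhd_mapI[OF j, where Q = "\<lambda>_. True"])
    fix n assume n: "n \<in> A" "x \<in> reduced_nbhd (\<lambda>n. 2 ^ j * \<psi> n) n"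
    have "real p * x + of_int (b n) / real n \<in> reduced_nbhd (\<lambda>n. real p * (2 ^ j * \<psi> n)) n"
      using reduced_nbhd_shift[of n x "\<lambda>n. 2 ^ j * \<psi> n" p "b n"] n assms by auto
    also have "\<dots> \<subseteq> reduced_nbhd (\<lambda>n. 2 ^ (j + p) * \<psi> n) n"
    proof (rule reduced_nbhd_mono)
      \<comment> \<open>The factor \<open>p\<close> in the radius is absorbed by raising
        \<open>j\<close> to \<open>j + p\<close>.\<close>
      have "real p \<le> 2 ^ p" using less_exp[of p] by (metis less_imp_le of_nat_le_iff of_nat_numeral of_nat_power)
      then have "real p * (2 ^ j * \<psi> n) \<le> 2 ^ p * (2 ^ j * \<psi> n)" using assms(3) by (intro mult_right_mono) auto
      then show "real p * (2 ^ j * \<psi> n) \<le> 2 ^ (j + p) * \<psi> n" by (simp add: power_add mult_ac)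
    qed
    finally show "n \<in> A \<and> real p * x + s \<in> reduced_nbhd (\<lambda>n. 2 ^ (j + p) * \<psi> n) n"
      using n assms(5) by simp
  qed simp
  then show ?thesis unfolding dilated_limsup_def by blast
qed

lemma dilated_limsup_translate:
  assumes "A \<subseteq> {1..}" "\<And>n. \<psi> n \<ge> 0" "x \<in> dilated_limsup \<psi> A" "prime q" "finite {n\<in>A. \<not> q\<^sup>2 dvd n}"
  shows "x + 1 / real q \<in> dilated_limsup \<psi> A"
proof -
  obtain j :: nat where j: "x \<in> limsup_nbhd (\<lambda>n. 2 ^ j * \<psi> n) A" using assms(3) by (auto simp: dilated_limsup_def)
  have "x + 1 / real q \<in> limsup_nbhd (\<lambda>n. 2 ^ j * \<psi> n) A"
  proof (rule limsup_nbhd_mapI[OF j assms(5)])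
    fix n assume n: "n \<in> A" "q\<^sup>2 dvd n" "x \<in> reduced_nbhd (\<lambda>n. 2 ^ j * \<psi> n) n"
    have n1: "n \<ge> 1" using n(1) assms(1) by auto
    obtain l where "n = q\<^sup>2 * l" using n(2) by (auto elim: dvdE)
    then have m: "n = q * (q * l)" "q dvd q * l" by (auto simp: power2_eq_square)
    have eq: "of_int (int (q * l)) / real n = 1 / real q" using n1 by (simp add: m(1))
    have "real 1 * x + of_int (int (q * l)) / real n \<in> reduced_nbhd (\<lambda>n. real 1 * (2 ^ j * \<psi> n)) n \<or> (1::nat) = 0"
      using n1 n(3) coprime_shift_square[OF assms(4) m] by (intro reduced_nbhd_shift) auto
    then show "n \<in> A \<and> x + 1 / real q \<in> reduced_nbhd (\<lambda>n. 2 ^ j * \<psi> n) n"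
      unfolding eq using n(1) by simp
  qed
  then show ?thesis unfolding dilated_limsup_def by blast
qed

lemma emeasure_dilated_limsup_pos:
  assumes \<psi>: "\<And>n. \<psi> n \<ge> 0" "\<And>n. \<psi> n \<le> real n" and "\<epsilon> > 0" and A: "A \<subseteq> {1..}"
    and div: "\<not> summable (\<lambda>n. if n \<in> A then weighted_term \<psi> \<epsilon> n else 0)"
  shows "emeasure lebesgue (dilated_limsup \<psi> A) > 0"
proof -
  define \<phi> where "\<phi> n = (if n \<in> A then \<psi> n else 0)" for n
  have "weighted_term \<phi> \<epsilon> n
      = (if n \<in> A then weighted_term \<psi> \<epsilon> n else 0)" for n
    by (simp add: \<phi>_def)
  then have "\<not> summable (\<lambda>n. weighted_term \<phi> \<epsilon> n)"
    using div by simp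
  then have "emeasure lborel {x. infinite {n. 1 \<le> n \<and> x \<in> approx_set \<phi> n}} > 0"
    using \<psi> assms(3) by (intro emeasure_limsup_approx_set_pos) (auto simp: \<phi>_def)
  also have "emeasure lborel {x. infinite {n. 1 \<le> n \<and> x \<in> approx_set \<phi> n}} \<le> emeasure lborel (dilated_limsup \<psi> A)"
  proof (rule emeasure_mono)
    show "{x. infinite {n. 1 \<le> n \<and> x \<in> approx_set \<phi> n}} \<subseteq> dilated_limsup \<psi> A"
    proof
      fix x assume "x \<in> {x. infinite {n. 1 \<le> n \<and> x \<in> approx_set \<phi> n}}"
      then have inf: "infinite {n. 1 \<le> n \<and> x \<in> approx_set \<phi> n}" by (rule CollectD)
      have "{n. 1 \<le> n \<and> x \<in> approx_set \<phi> n} \<subseteq> {n\<in>A. x \<in> reduced_nbhd (\<lambda>n. 2 ^ 0 * \<psi> n) n}"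
      proof
        fix n assume n: "n \<in> {n. 1 \<le> n \<and> x \<in> approx_set \<phi> n}"
        have "n \<in> A"
        proof (rule ccontr)
          assume "n \<notin> A"
          then have "approx_set \<phi> n = {}" by (simp add: approx_set_def \<phi>_def)
          then show False using n by simp
        qed
        have "x + of_int 0 \<in> approx_set \<phi> n" using n by simp
        then have "x \<in> reduced_nbhd \<phi> n" using mem_reduced_nbhd_iff[of n x \<phi>] n by blast
        then have "x \<in> reduced_nbhd (\<lambda>n. 2 ^ 0 * \<psi> n) n"
          using reduced_nbhd_mono[of \<phi> n "\<lambda>n. 2 ^ 0 * \<psi> n"] \<open>n \<in> A\<close> by (auto simp: \<phi>_def)
        with \<open>n \<in> A\<close> show "n \<in> {n\<in>A. x \<in> reduced_nbhd (\<lambda>n. 2 ^ 0 * \<psi> n) n}" by simp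
      qed
      then have "x \<in> limsup_nbhd (\<lambda>n. 2 ^ 0 * \<psi> n) A"
        unfolding limsup_nbhd_def using infinite_super[OF _ inf] by blast
      then show "x \<in> dilated_limsup \<psi> A" unfolding dilated_limsup_def by (intro UN_I[of 0]) auto
    qed
  qed (simp add: borel_dilated_limsup)
  also have "\<dots> = emeasure lebesgue (dilated_limsup \<psi> A)" by (simp add: borel_dilated_limsup)
  finally show ?thesis .
qed

section \<open>Choice of the support and full measure\<close>

lemma summable_tail_le:
  fixes f :: "nat \<Rightarrow> real"
  assumes "summable f" "\<And>n. f n \<ge> 0" "r > 0"
  shows "\<exists>N. \<forall>M. (\<Sum>n\<in>{N..<M}. f n) \<le> r"
proof -
  obtain N where N: "norm (\<Sum>i. f (i + N)) < r"
    using suminf_exist_split[OF assms(3,1)] by blast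
  have "(\<Sum>n\<in>{N..<M}. f n) \<le> r" for M
  proof -
    have "(\<Sum>n\<in>{N..<M}. f n) = (\<Sum>i<M - N. f (i + N))"
      by (rule sum.reindex_bij_witness[of _ "\<lambda>i. i + N" "\<lambda>n. n - N"]) auto
    also have "\<dots> \<le> (\<Sum>i. f (i + N))"
      using assms by (intro sum_le_suminf) (auto simp: summable_iff_shift)
    also have "\<dots> \<le> r" using N by simp
    finally show ?thesis .
  qed
  then show ?thesis by blast
qed

text \<open>Discard the \<open>n \<ge> N p\<close> not divisible by \<open>p\<^sup>2\<close>, where \<open>N p\<close> is such that this costs at most \<open>(1/2)^p\<close>.\<close>
lemma exists_divergent_support_divisible_by_prime_squares:
  fixes e :: "nat \<Rightarrow> real"
  assumes e: "\<And>n. e n \<ge> 0" "e 0 = 0" "\<not> summable e"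
    and conv: "\<And>p. prime p \<Longrightarrow> summable (\<lambda>n. if p\<^sup>2 dvd n then 0 else e n)"
  shows "\<exists>A\<subseteq>{1..}. \<not> summable (\<lambda>n. if n \<in> A then e n else 0) \<and> (\<forall>q. prime q \<longrightarrow> finite {n\<in>A. \<not> q\<^sup>2 dvd n})"
proof -
  have "\<forall>p. \<exists>N. prime p \<longrightarrow> (\<forall>M. (\<Sum>n\<in>{N..<M}. if p\<^sup>2 dvd n then 0 else e n) \<le> (1/2) ^ p)"
  proof
    fix p :: nat
    show "\<exists>N. prime p \<longrightarrow> (\<forall>M. (\<Sum>n\<in>{N..<M}. if p\<^sup>2 dvd n then 0 else e n) \<le> (1/2) ^ p)"
    proof (cases "prime p")
      case True
      show ?thesis using summable_tail_le[OF conv[OF True], of "(1/2) ^ p"] e by auto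
    qed simp
  qed
  then obtain N where N: "\<And>p M. prime p \<Longrightarrow> (\<Sum>n\<in>{N p..<M}. if p\<^sup>2 dvd n then 0 else e n) \<le> (1/2) ^ p"
    by metis
  define A where "A = {n. 1 \<le> n \<and> (\<forall>p. prime p \<longrightarrow> N p \<le> n \<longrightarrow> p\<^sup>2 dvd n)}"
  have s0: "summable (\<lambda>n. if n \<in> A then 0 else e n)"
  proof (rule summableI_nonneg_bounded)
    fix M :: nat
    define B where "B = {n. n < M \<and> 1 \<le> n \<and> n \<notin> A}"
    have finB: "finite B" by (simp add: B_def)
    have "\<forall>n\<in>B. \<exists>p. prime p \<and> N p \<le> n \<and> \<not> p\<^sup>2 dvd n" by (auto simp: A_def B_def)
    \<comment> \<open>Each discarded index is charged to one prime that excludes it, so the total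
      loss is at most the geometric series of the losses per prime.\<close>
    then obtain g where g: "\<And>n. n \<in> B \<Longrightarrow> prime (g n) \<and> N (g n) \<le> n \<and> \<not> (g n)\<^sup>2 dvd n" by metis
    have "(\<Sum>n<M. if n \<in> A then 0 else e n) = (\<Sum>n\<in>B. e n)"
    proof (rule sum.mono_neutral_cong_right)
      show "\<forall>i\<in>{..<M} - B. (if i \<in> A then 0 else e i) = 0"
      proof
        fix i assume "i \<in> {..<M} - B"
        then show "(if i \<in> A then 0 else e i) = 0" using e(2) by (cases "i = 0") (auto simp: B_def)
      qed
    qed (auto simp: B_def)
    also have "\<dots> = (\<Sum>p\<in>g ` B. \<Sum>n\<in>{n\<in>B. g n = p}. e n)"
      using finB by (intro sum.group[symmetric]) auto
    also have "\<dots> \<le> (\<Sum>p\<in>g ` B. (1/2) ^ p)"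
    proof (rule sum_mono)
      fix p assume "p \<in> g ` B"
      then have p: "prime p" using g by auto
      have "(\<Sum>n\<in>{n\<in>B. g n = p}. e n) = (\<Sum>n\<in>{n\<in>B. g n = p}. if p\<^sup>2 dvd n then 0 else e n)"
        using g by (intro sum.cong) auto
      also have "\<dots> \<le> (\<Sum>n\<in>{N p..<M}. if p\<^sup>2 dvd n then 0 else e n)"
        using g e(1) by (intro sum_mono2) (auto simp: B_def)
      also have "\<dots> \<le> (1/2) ^ p" by (rule N[OF p])
      finally show "(\<Sum>n\<in>{n\<in>B. g n = p}. e n) \<le> (1/2) ^ p" .
    qed
    also have "\<dots> \<le> (\<Sum>p. (1/2) ^ p)"
      using finB by (intro sum_le_suminf summable_geometric) auto
    finally show "(\<Sum>n<M. if n \<in> A then 0 else e n) \<le> (\<Sum>p. (1/2) ^ p)" .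
  qed (use e in auto)
  have "\<not> summable (\<lambda>n. if n \<in> A then e n else 0)"
  proof
    assume "summable (\<lambda>n. if n \<in> A then e n else 0)"
    then have "summable (\<lambda>n. (if n \<in> A then e n else 0) + (if n \<in> A then 0 else e n))" using s0 by (rule summable_add)
    also have "(\<lambda>n. (if n \<in> A then e n else 0) + (if n \<in> A then 0 else e n)) = e" by auto
    finally show False using e(3) by contradiction
  qed
  moreover have "finite {n\<in>A. \<not> q\<^sup>2 dvd n}" if "prime q" for q
    by (rule finite_subset[of _ "{..<N q}"]) (use that in \<open>auto simp: A_def not_le[symmetric]\<close>)
  moreover have "A \<subseteq> {1..}" by (auto simp: A_def)
  ultimately show ?thesis by blast
qed

lemma full_measure_dilated_limsup:
  assumes \<psi>: "\<And>n. \<psi> n \<ge> 0" "\<And>n. \<psi> n \<le> real n" and "\<epsilon> > 0"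
    and div: "\<not> summable (\<lambda>n. weighted_term \<psi> \<epsilon> n)"
  shows "\<exists>A\<subseteq>{1..}. measure lebesgue (dilated_limsup \<psi> A \<inter> {0..<1}) = 1"
proof -
  define e where "e n = weighted_term \<psi> \<epsilon> n" for n
  have e: "e n \<ge> 0" "e 0 = 0" for n using \<psi> by (auto simp: e_def)
  have div: "\<not> summable e" using div unfolding e_def[abs_def] .
  have leb: "dilated_limsup \<psi> A \<in> sets lebesgue" for A by (simp add: borel_dilated_limsup sets_completionI_sets)
  have pos: "emeasure lebesgue (dilated_limsup \<psi> A) > 0"
    if "A \<subseteq> {1..}" "\<not> summable (\<lambda>n. if n \<in> A then e n else 0)" for A
    using that(2) unfolding e_def by (rule emeasure_dilated_limsup_pos[OF \<psi> assms(3) that(1)])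
  show ?thesis
  proof (cases "\<forall>p. prime p \<longrightarrow> summable (\<lambda>n. if p\<^sup>2 dvd n then 0 else e n)")
    case True
    then obtain A where A: "A \<subseteq> {1..}" "\<not> summable (\<lambda>n. if n \<in> A then e n else 0)"
      "\<And>q. prime q \<Longrightarrow> finite {n\<in>A. \<not> q\<^sup>2 dvd n}"
      using exists_divergent_support_divisible_by_prime_squares[OF e div] by blast
    have "measure lebesgue (dilated_limsup \<psi> A \<inter> {0..<1}) = 1"
      using A \<psi> by (intro full_measure_of_prime_translations leb pos dilated_limsup_periodic dilated_limsup_translate) auto
    then show ?thesis using A(1) by blast
  next
    case False
    then obtain p where p: "prime p" "\<not> summable (\<lambda>n. if p\<^sup>2 dvd n then 0 else e n)" by blast
    define A1 where "A1 = {n. 1 \<le> n \<and> \<not> p dvd n}"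
    define A2 where "A2 = {n. 1 \<le> n \<and> p dvd n \<and> \<not> p\<^sup>2 dvd n}"
    have p2: "p \<ge> 2" using p(1) by (rule prime_ge_2_nat)
    \<comment> \<open>The divergent sum over indices not divisible by the square of \<open>p\<close>
      splits according to whether \<open>p\<close> divides them at all, and one of the two halves
      must diverge.\<close>
    have "(if p\<^sup>2 dvd n then 0 else e n) = (if n \<in> A1 then e n else 0) + (if n \<in> A2 then e n else 0)" for n
    proof (cases "n = 0")
      case False
      have "p\<^sup>2 dvd n \<Longrightarrow> p dvd n" by (metis dvd_mult_left power2_eq_square)
      then show ?thesis using False by (auto simp: A1_def A2_def)
    qed (use e(2) in \<open>auto simp: A1_def A2_def\<close>)
    then have "\<not> summable (\<lambda>n. (if n \<in> A1 then e n else 0) + (if n \<in> A2 then e n else 0))"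
      using p(2) by simp
    then consider "\<not> summable (\<lambda>n. if n \<in> A1 then e n else 0)" | "\<not> summable (\<lambda>n. if n \<in> A2 then e n else 0)"
      using summable_add[of "\<lambda>n. if n \<in> A1 then e n else 0" "\<lambda>n. if n \<in> A2 then e n else 0"] by blast
    then show ?thesis
    proof cases
      case 1
      have sub: "A1 \<subseteq> {1..}" by (auto simp: A1_def)
      have "measure lebesgue (dilated_limsup \<psi> A1 \<inter> {0..<1}) = 1"
      proof (rule full_measure_of_expanding[OF borel_dilated_limsup pos[OF sub 1] dilated_limsup_periodic[OF sub] p2])
        fix x assume "x \<in> dilated_limsup \<psi> A1"
        then show "real p * x + 0 \<in> dilated_limsup \<psi> A1"
          using coprime_shift_not_dvd[OF p(1)] p2 \<psi>(1) sub
          by (intro dilated_limsup_expanding[where b = "\<lambda>_. 0"]) (auto simp: A1_def)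
      qed
      then show ?thesis using sub by blast
    next
      case 2
      have sub: "A2 \<subseteq> {1..}" by (auto simp: A2_def)
      have "measure lebesgue (dilated_limsup \<psi> A2 \<inter> {0..<1}) = 1"
      proof (rule full_measure_of_expanding[OF borel_dilated_limsup pos[OF sub 2] dilated_limsup_periodic[OF sub] p2])
        fix x assume x: "x \<in> dilated_limsup \<psi> A2"
        have m: "n = p * (n div p)" "\<not> p dvd n div p" "n > 0" if "n \<in> A2" for n
        proof -
          show n: "n = p * (n div p)" "n > 0" using that by (auto simp: A2_def)
          show "\<not> p dvd n div p"
          proof
            assume "p dvd n div p"
            then have "p * p dvd p * (n div p)" by simp
            then show False using n that by (simp add: A2_def power2_eq_square)
          qed
        qed
        show "real p * x + 1 / real p \<in> dilated_limsup \<psi> A2"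
        proof (rule dilated_limsup_expanding[OF sub _ \<psi>(1) x, where b = "\<lambda>n. int (n div p)"])
          fix n assume n: "n \<in> A2"
          have "real n = real p * real (n div p)" using m(1)[OF n] by (metis of_nat_mult)
          moreover have "real n > 0" using m(3)[OF n] by simp
          ultimately show "of_int (int (n div p)) / real n = 1 / real p" by (auto simp: field_simps)
          show "coprime (int p * a + int (n div p)) (int n)" if "coprime a (int n)" for a
            using coprime_shift_exactly[OF p(1) m[OF n] that] .
        qed (use p2 in auto)
      qed
      then show ?thesis using sub by blast
    qed
  qed
qed

lemma finite_plog_plog_less: "finite {n. plog (plog (real n)) < X}"
proof (rule finite_subset)
  show "{n. plog (plog (real n)) < X} \<subseteq> {..nat \<lfloor>exp (exp X)\<rfloor>}"
  proof
    fix n assume "n \<in> {n. plog (plog (real n)) < X}"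
    then have n: "plog (plog (real n)) < X" by simp
    have p1: "plog x \<ge> 1" "ln x \<le> plog x" for x by (auto simp: plog_def)
    have "ln (plog (real n)) \<le> X" using p1(2)[of "plog (real n)"] n by simp
    then have "plog (real n) \<le> exp X" using p1(1)[of "real n"] by (intro le_exp_of_ln_le) auto
    then have "ln (real n) \<le> exp X" using p1(2)[of "real n"] by linarith
    then have "real n \<le> exp (exp X)" by (cases "n = 0") (auto intro!: le_exp_of_ln_le[of "real n"])
    then show "n \<in> {..nat \<lfloor>exp (exp X)\<rfloor>}" by (simp add: le_nat_floor)
  qed
qed simp

theorem theorem1:
  fixes \<psi> :: "nat \<Rightarrow> real" and \<epsilon> :: real
  assumes "\<And>n. 1 \<le> n \<Longrightarrow> 0 \<le> \<psi> n"
    and "0 < \<epsilon>"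
    and "filterlim (\<lambda>N. \<Sum>n=1..N. \<psi> n * real (totient n) / (real n * (plog (plog (real n))) powr \<epsilon>))
           at_top sequentially"
  shows "emeasure lebesgue (W \<psi>) = 1"
proof (cases "finite {n. 1 \<le> n \<and> \<psi> n > real n}")
  case False
  have "W \<psi> = {0..1}"
  proof -
    have "x \<in> limsup_nbhd \<psi> {1..}" if x: "x \<in> {0..1}" for x
    proof -
      \<comment> \<open>Numerator 1 is always admissible, and radius above 1 around
        \<open>1 / n\<close> covers the unit interval.\<close>
      have "{n. 1 \<le> n \<and> \<psi> n > real n} \<subseteq> {n\<in>{1..}. x \<in> reduced_nbhd \<psi> n}"
      proof
        fix n assume n: "n \<in> {n. 1 \<le> n \<and> \<psi> n > real n}"
        have "0 \<le> 1 / real n" "1 / real n \<le> 1" using n by auto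
        then have "\<bar>x - 1 / real n\<bar> \<le> 1" using x unfolding atLeastAtMost_iff by linarith
        also have "1 < \<psi> n / real n" using n by simp
        finally show "n \<in> {n\<in>{1..}. x \<in> reduced_nbhd \<psi> n}"
          using n unfolding reduced_nbhd_def by (auto intro!: exI[of _ 1])
      qed
      then show ?thesis unfolding limsup_nbhd_def using False infinite_super by blast
    qed
    then show ?thesis unfolding W_eq by blast
  qed
  then show ?thesis by simp
next
  case True
  define ll where "ll n = plog (plog (real n))" for n
  have ll1: "ll n \<ge> 1" for n by (simp add: ll_def plog_def)
  define \<delta> where "\<delta> = \<epsilon> / 2"
  have \<delta>: "\<delta> > 0" "\<epsilon> = \<delta> + \<delta>" using assms(2) by (auto simp: \<delta>_def)
  define \<phi> where "\<phi> n = (if n = 0 \<or> \<psi> n > real n then 0 else \<psi> n)" for n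
  \<comment> \<open>Half of the extra divergence is spent here: the divisor tends to infinity, so
    each fixed dilate of \<theta> is eventually below \<phi>, while the other half remains for the
    full-measure result.\<close>
  define \<theta> where "\<theta> n = \<phi> n / ll n powr \<delta>" for n
  have lld: "ll n powr \<delta> \<ge> 1" for n using ll1[of n] \<delta> by (intro ge_one_powr_ge_zero) auto
  have \<phi>: "0 \<le> \<phi> n" "\<phi> n \<le> real n" for n using assms(1)[of n] by (auto simp: \<phi>_def)
  have \<theta>: "0 \<le> \<theta> n" "\<theta> n \<le> real n" for n
  proof -
    show "0 \<le> \<theta> n" using \<phi>(1)[of n] by (simp add: \<theta>_def)
    have "\<phi> n / ll n powr \<delta> \<le> \<phi> n / 1" using lld[of n] \<phi>(1)[of n] by (intro divide_left_mono) auto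
    then show "\<theta> n \<le> real n" using \<phi>(2)[of n] by (simp add: \<theta>_def)
  qed
  define e where "e n = (if n = 0 then 0 else \<psi> n * real (totient n) / (real n * ll n powr \<epsilon>))" for n
  have e0: "e n \<ge> 0" for n using assms(1)[of n] by (auto simp: e_def)
  have e_sum: "(\<Sum>n=1..N. weighted_term \<psi> \<epsilon> n) = (\<Sum>n=1..N. e n)" for N
    by (intro sum.cong) (auto simp: e_def ll_def)
  have nsum: "\<not> summable e"
  proof
    assume s: "summable e"
    have le: "(\<Sum>n=1..N. e n) \<le> suminf e" for N using s e0 by (intro sum_le_suminf) auto
    have "eventually (\<lambda>N. (\<Sum>n=1..N. e n) \<ge> suminf e + 1) sequentially"
      using assms(3) unfolding e_sum filterlim_at_top by blast
    then obtain N where "suminf e + 1 \<le> (\<Sum>n=1..N. e n)"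
      using eventually_happens'[OF sequentially_bot] by blast
    then show False using le[of N] by simp
  qed
  have "\<not> summable (\<lambda>n. weighted_term \<theta> \<delta> n)"
  proof
    assume s: "summable (\<lambda>n. weighted_term \<theta> \<delta> n)"
    have "eventually (\<lambda>n. weighted_term \<theta> \<delta> n = e n) sequentially"
    proof -
      have fin: "finite (insert 0 {n. 1 \<le> n \<and> \<psi> n > real n})" using True by simp
      have "weighted_term \<theta> \<delta> n = e n"
        if "n \<notin> insert 0 {n. 1 \<le> n \<and> \<psi> n > real n}" for n
      proof -
        have "\<phi> n = \<psi> n" "n \<noteq> 0" using that by (auto simp: \<phi>_def)
        moreover have "ll n powr \<epsilon> = ll n powr \<delta> * ll n powr \<delta>" unfolding \<delta>(2) powr_add ..
        ultimately show ?thesis by (simp add: \<theta>_def e_def ll_def)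
      qed
      then have "{n. \<not> (weighted_term \<theta> \<delta> n = e n)} \<subseteq> insert 0 {n. 1 \<le> n \<and> \<psi> n > real n}" by blast
      then have "eventually (\<lambda>n. weighted_term \<theta> \<delta> n = e n) cofinite"
        unfolding eventually_cofinite using fin finite_subset by blast
      then show ?thesis by (simp add: cofinite_eq_sequentially)
    qed
    then have "summable e" using s by (simp only: summable_cong)
    then show False using nsum by contradiction
  qed
  then obtain A where A: "A \<subseteq> {1..}" "measure lebesgue (dilated_limsup \<theta> A \<inter> {0..<1}) = 1"
    using full_measure_dilated_limsup[OF \<theta> \<delta>(1)] by blast
  have sub: "dilated_limsup \<theta> A \<subseteq> limsup_nbhd \<psi> {1..}"
  proof
    fix x assume "x \<in> dilated_limsup \<theta> A"
    then obtain j :: nat where j: "x \<in> limsup_nbhd (\<lambda>n. 2 ^ j * \<theta> n) A" by (auto simp: dilated_limsup_def)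
    show "x \<in> limsup_nbhd \<psi> {1..}"
    \<comment> \<open>The exceptional indices are those with
      \<open>ll n powr \<delta> < 2 ^ j\<close>, a finite set for each fixed
      \<open>j\<close>.\<close>
    proof (rule limsup_nbhd_mapI[OF j, where Q = "\<lambda>n. 2 ^ j \<le> ll n powr \<delta>"])
      have "{n. \<not> 2 ^ j \<le> ll n powr \<delta>} \<subseteq> {n. plog (plog (real n)) < (2 ^ j) powr (1 / \<delta>)}"
      proof
        fix n assume "n \<in> {n. \<not> 2 ^ j \<le> ll n powr \<delta>}"
        then have "(ll n powr \<delta>) powr (1 / \<delta>) < (2 ^ j) powr (1 / \<delta>)"
          using \<delta> by (intro powr_less_mono2) auto
        then show "n \<in> {n. plog (plog (real n)) < (2 ^ j) powr (1 / \<delta>)}"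
          using \<delta> ll1[of n] by (simp add: powr_powr ll_def)
      qed
      then have "{n\<in>A. \<not> 2 ^ j \<le> ll n powr \<delta>} \<subseteq> {n. plog (plog (real n)) < (2 ^ j) powr (1 / \<delta>)}" by blast
      then show "finite {n\<in>A. \<not> 2 ^ j \<le> ll n powr \<delta>}" by (rule finite_subset[OF _ finite_plog_plog_less])
    next
      fix n assume n: "n \<in> A" "2 ^ j \<le> ll n powr \<delta>" "x \<in> reduced_nbhd (\<lambda>n. 2 ^ j * \<theta> n) n"
      have n1: "1 \<le> n" using n(1) A(1) by auto
      have "2 ^ j * \<theta> n = \<phi> n * (2 ^ j / ll n powr \<delta>)" by (simp add: \<theta>_def)
      also have "\<dots> \<le> \<phi> n * 1"
      proof (intro mult_left_mono \<phi>)
        have "ll n powr \<delta> > 0" using lld[of n] by linarith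
        then show "2 ^ j / ll n powr \<delta> \<le> 1" using n(2) by (simp only: pos_divide_le_eq mult_1)
      qed
      also have "\<phi> n * 1 \<le> \<psi> n" using assms(1)[OF n1] by (auto simp: \<phi>_def)
      finally have "reduced_nbhd (\<lambda>n. 2 ^ j * \<theta> n) n \<subseteq> reduced_nbhd \<psi> n" by (rule reduced_nbhd_mono)
      then show "n \<in> {1..} \<and> x \<in> reduced_nbhd \<psi> n" using n(3) n1 by auto
    qed
  qed
  have W: "W \<psi> \<in> sets borel" unfolding W_eq by (intro sets.Int borel_limsup_nbhd) auto
  have "ennreal 1 = ennreal (measure lebesgue (dilated_limsup \<theta> A \<inter> {0..<1}))" by (simp only: A(2))
  also have "\<dots> = emeasure lebesgue (dilated_limsup \<theta> A \<inter> {0..<1})"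
  proof (rule emeasure_eq_measure2[symmetric])
    show "dilated_limsup \<theta> A \<inter> {0..<1} \<in> lmeasurable"
      by (intro bounded_set_imp_lmeasurable sets_completionI_sets) (auto simp: borel_dilated_limsup)
  qed
  also have "\<dots> \<le> emeasure lebesgue (W \<psi>)"
    using sub W by (intro emeasure_mono) (auto simp: W_eq sets_completionI_sets)
  finally have "1 \<le> emeasure lebesgue (W \<psi>)" by simp
  moreover have "emeasure lebesgue (W \<psi>) \<le> emeasure lebesgue {0..1::real}"
    by (intro emeasure_mono) (auto simp: W_def)
  ultimately show ?thesis by (intro antisym) auto
qed

end
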